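(* For every integer $d\ge 1$ there is a constant $L_d\in(0,\infty)$, depending only on $d$, such that the following holds. Let $n\ge1$ and let $(X_i^j)_{1\le i\le n,\,1\le j\le d}$ be independent symmetric real random variables with $N_i^j(t)=-\ln\mathbb P(|X_i^j|\ge t)=t$ for all $i,j$ and all $t>0$ (i.e. symmetric exponential variables). Then for every real array $(a_{\mathbf i})_{\mathbf i\in\{1,\dots,n\}^d}$ and every $p\ge 2$, $$\Big\|\sum_{\mathbf i\in\{1,\dots,n\}^d}a_{\mathbf i}X_{i_1}^{1}\cdots X_{i_d}^{d}\Big\|_p\ \le\ L_d\sum_{\mathcal J\in P_d}\|(a_{\mathbf i})\|_{\mathcal J,p}^{\mathcal N}.$$
   Context: For a real random variable $X$, $\|X\|_p=(\mathbb E|X|^p)^{1/p}$. Put $\hat N_i^j(t)=t^2$ for $|t|\le 1$ and $\hat N_i^j(t)=N_i^j(|t|)$ for $|t|>1$; here thus $\hat N_i^j(t)=|t|$ for $|t|>1$. $P_d$ is the family of all partitions of $\{1,\dots,d\}$ into nonempty pairwise disjoint sets. For $\mathbf i=(i_1,\dots,i_d)\in\{1,\dots,n\}^d$ and $I\subset\{1,\dots,d\}$, $\mathbf i_I=(i_k)_{k\in I}$. For $\mathcal J=\{I_1,\dots,I_k\}\in P_d$ define $$\|(a_{\mathbf i})\|_{\mathcal J,p}^{\mathcal N}=\sum_{s_1\in I_1,\dots,s_k\in I_k}\sup\Big\{\sum_{\mathbf i}a_{\mathbf i}\prod_{l=1}^k x^l_{\mathbf i_{I_l}}\ :\ \sum_{i_{s_l}=1}^n\hat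 N_{i_{s_l}}^{s_l}\big(\|(x^l_{\mathbf i_{I_l}})_{\mathbf i_{I_l\setminus\{s_l\}}}\|_2\big)\le p,\ 1\le l\le k\Big\},$$ where the supremum is over real arrays $x^l=(x^l_{\mathbf i_{I_l}})$ indexed by $\{1,\dots,n\}^{I_l}$, and, for a fixed value of $i_{s_l}$, $\|(x^l_{\mathbf i_{I_l}})_{\mathbf i_{I_l\setminus\{s_l\}}}\|_2=\big(\sum_{\mathbf i_{I_l\setminus\{s_l\}}}(x^l_{\mathbf i_{I_l}})^2\big)^{1/2}$ (which equals $|x^l_{i_{s_l}}|$ if $I_l=\{s_l\}$). *)

theory Defs
  imports "HOL-Probability.Probability"
begin

text \<open>Sub-multi-indices \<open>i_I\<close> are functions on \<open>I\<close>, made \<open>undefined\<close> outside \<open>I\<close>, so that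
  passing from \<open>i\<close> to \<open>i_I\<close> is \<^const>\<open>restrict\<close>.\<close>

definition multi_idx :: "nat \<Rightarrow> nat set \<Rightarrow> (nat \<Rightarrow> nat) set" where
  "multi_idx n I = (I \<rightarrow>\<^sub>E {1..n})"

text \<open>Where the tail probability vanishes the mathematical value is infinite, whereas here it is
  \<open>0\<close>. This does not occur for variables satisfying \<open>tail_fun M Y t = t\<close> for all \<open>t > 0\<close>.\<close>

definition tail_fun :: "'a measure \<Rightarrow> ('a \<Rightarrow> real) \<Rightarrow> real \<Rightarrow> real" where
  "tail_fun M Y t = - ln (measure M {\<omega> \<in> space M. t \<le> \<bar>Y \<omega>\<bar>})"

definition hat_fun :: "(real \<Rightarrow> real) \<Rightarrow> real \<Rightarrow> real" where
  "hat_fun N t = (if \<bar>t\<bar> \<le> 1 then t\<^sup>2 else N \<bar>t\<bar>)"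

text \<open>A block \<open>I = I_l\<close> of the partition \<open>J\<close> serves as its own label: \<open>x I\<close> is the array \<open>x^l\<close> and
  \<open>s I\<close> is \<open>s_l\<close>. The argument \<open>N m j\<close> stands for \<open>N_m^j\<close>. In the constraint, \<open>m\<close> is the value
  of the index \<open>i_{s_l}\<close>. The supremum is taken in the reals; for \<open>N_m^j(t) = t\<close> on \<open>t > 1\<close> and
  \<open>p \<ge> 2\<close> every entry of \<open>x I\<close> is at most \<open>p\<close> in absolute value, so the set is bounded, and it
  contains the value at \<open>x = 0\<close>.\<close>

definition partition_norm ::
  "nat \<Rightarrow> nat \<Rightarrow> (nat \<Rightarrow> nat \<Rightarrow> real \<Rightarrow> real) \<Rightarrow> real \<Rightarrow> nat set set \<Rightarrow> ((nat \<Rightarrow> nat) \<Rightarrow> real) \<Rightarrow> real" where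
  "partition_norm n d N p J a =
     (\<Sum>s \<in> (\<Pi>\<^sub>E I\<in>J. I).
        SUP x \<in> {x :: nat set \<Rightarrow> (nat \<Rightarrow> nat) \<Rightarrow> real.
                   \<forall>I\<in>J. (\<Sum>m=1..n. hat_fun (N m (s I))
                            (L2_set (x I) {k \<in> multi_idx n I. k (s I) = m})) \<le> p}.
          \<Sum>i \<in> multi_idx n {1..d}. a i * (\<Prod>I\<in>J. x I (restrict i I)))"

definition Lp_norm :: "'a measure \<Rightarrow> real \<Rightarrow> ('a \<Rightarrow> real) \<Rightarrow> real" where
  "Lp_norm M p Y = (\<integral>\<omega>. \<bar>Y \<omega>\<bar> powr p \<partial>M) powr (1 / p)"

definition chaos ::
  "nat \<Rightarrow> nat \<Rightarrow> ((nat \<Rightarrow> nat) \<Rightarrow> real) \<Rightarrow> (nat \<Rightarrow> nat \<Rightarrow> 'a \<Rightarrow> real) \<Rightarrow> 'a \<Rightarrow> real" where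
  "chaos n d a X \<omega> = (\<Sum>i \<in> multi_idx n {1..d}. a i * (\<Prod>j=1..d. X (i j) j \<omega>))"

definition symmetric_exponential_family ::
  "'a measure \<Rightarrow> nat \<Rightarrow> nat \<Rightarrow> (nat \<Rightarrow> nat \<Rightarrow> 'a \<Rightarrow> real) \<Rightarrow> bool" where
  "symmetric_exponential_family M n d X \<longleftrightarrow>
     prob_space M \<and>
     prob_space.indep_vars M (\<lambda>_. borel) (\<lambda>(i, j). X i j) ({1..n} \<times> {1..d}) \<and>
     (\<forall>i\<in>{1..n}. \<forall>j\<in>{1..d}.
        distr M borel (X i j) = distr M borel (\<lambda>\<omega>. - X i j \<omega>) \<and>
        (\<forall>t>0. tail_fun M (X i j) t = t))"

text \<open>\<open>chaos_moment_bound TYPE('a) d L\<close>: the constant \<open>L\<close> works for all families defined on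
  probability spaces with sample points in \<open>'a\<close>. Integrability says that the \<open>p\<close>-norm is finite,
  which the inequality between extended real numbers contains, but which the Bochner integral
  (\<open>0\<close> for a non-integrable function) would not express.\<close>

definition chaos_moment_bound :: "'a itself \<Rightarrow> nat \<Rightarrow> real \<Rightarrow> bool" where
  "chaos_moment_bound _ d L \<longleftrightarrow>
     (\<forall>n\<ge>1. \<forall>(M :: 'a measure) X. symmetric_exponential_family M n d X \<longrightarrow>
       (\<forall>a. \<forall>p\<ge>2.
          integrable M (\<lambda>\<omega>. \<bar>chaos n d a X \<omega>\<bar> powr p) \<and>
          Lp_norm M p (chaos n d a X) \<le>
            L * (\<Sum>J | partition_on {1..d} J.
                   partition_norm n d (\<lambda>i j. tail_fun M (X i j)) p J a)))"

text \<open>A constant obtained from \<open>\<exists>L>0. chaos_moment_bound TYPE('a) d L\<close> could depend on the type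
  \<open>'a\<close>, over which one cannot quantify inside a formula. To say that one constant, depending on
  \<open>d\<close> only, serves for all probability spaces, its existence is asserted for a fixed type of sample
  points, which carries the joint law of every finite family, together with the fact that such a
  constant is then valid for an arbitrary type.\<close>

type_synonym canonical_sample = "nat \<times> nat \<Rightarrow> real"

end

theory Submission
  imports Defs
begin

text \<open>The variables are integrated out one column at a time. For Laplace variables
  \<open>E exp (l X - l\<^sup>2 \<bar>X\<bar>) \<le> 1\<close> for every real \<open>l\<close>, and \<open>sgn X * sqrt \<bar>X\<bar>\<close> is sub-Gaussian. To
  bound a supremum of \<open>\<Sum>\<^sub>i b\<^sub>i X\<^sub>i\<^sub>j \<Prod>\<^sub>l x\<^sup>l\<close> over arrays of Euclidean norm at most \<open>sqrt p\<close>, each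
  array is smoothed by standard Gaussian noise: this costs relative entropy of order \<open>p\<close>
  (PAC-Bayes), and the variance under the smoothed law is a sum of squared norms of the same kind, in which some blocks have been
  merged with the column \<open>j\<close> and \<open>X\<close> is replaced by \<open>sqrt \<bar>X\<bar>\<close>. A second such step removes
  \<open>sqrt \<bar>X\<bar>\<close>. In the end each coordinate lies in one or two blocks; fixing a coordinate that lies in
  two blocks leads to the point masses of size \<open>p\<close> that the norms of the theorem allow in their
  singleton blocks.\<close>

section \<open>Symmetric exponential laws\<close>

text \<open>The moment generating function of an exponential variable is infinite from 1 on, whereas
  the method needs exponents \<open>\<theta> = p / r\<close> times arbitrary coefficients.
  Subtracting a multiple of \<open>l\<^sup>2 * \<bar>X\<bar>\<close> gives a bound for every
  \<open>l\<close>, at the price of a random variance; this forces two steps per column, the second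
  having a constant variance proxy. Heuristically each column is replaced by two Gaussian columns
  with the same index, which is why a coordinate may end up in two blocks. Once a column has been
  treated, the quantity to bound is a supremum over arrays, where a union bound would bring in the
  dimension \<open>n\<close>. The centred Gaussian law serves as one prior for all arrays at once:
  the entropy cost is in proportion to the order of the moment, and only the number of arrays enters
  the constant. Since the variance is a sum of squares, each step asks for moments of twice the
  order; after \<open>2 * d\<close> steps the order is still a multiple of \<open>p\<close> bounded
  in terms of \<open>d\<close>.\<close>

lemma nn_integral_exp_exponential_density:
  assumes "s > -1"
  shows "(\<integral>\<^sup>+t. ennreal (exponential_density 1 t) * ennreal (exp (- (s * t))) \<partial>lborel)
    = ennreal (1 / (1 + s))"
proof -
  have "ennreal (exponential_density 1 t) * ennreal (exp (- (s * t)))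
      = ennreal (1 / (1 + s)) * ennreal (exponential_density (1 + s) t)" for t :: real
  proof -
    have "exponential_density 1 t * exp (- (s * t)) = 1 / (1 + s) * exponential_density (1 + s) t"
    proof -
      have "exp (- t) * exp (- (s * t)) = exp (- (t * (1 + s)))"
        by (simp add: mult_exp_exp algebra_simps)
      then show ?thesis using assms by (simp add: exponential_density_def)
    qed
    then show ?thesis
      using assms by (simp add: exponential_density_nonneg flip: ennreal_mult)
  qed
  then have "(\<integral>\<^sup>+t. ennreal (exponential_density 1 t) * ennreal (exp (- (s * t))) \<partial>lborel)
      = ennreal (1 / (1 + s)) * (\<integral>\<^sup>+t. ennreal (exponential_density (1 + s) t) \<partial>lborel)"
    by (simp add: nn_integral_cmult)
  also have "(\<integral>\<^sup>+t. ennreal (exponential_density (1 + s) t) \<partial>lborel) = 1"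
    using prob_space.emeasure_space_1[OF prob_space_exponential_density[of "1 + s"]] assms
    by (simp add: emeasure_density)
  finally show ?thesis by simp
qed

text \<open>The canonical assumption of the theory of self-normalized sums: \<open>v\<^sup>2\<close>
  is a random variance proxy, and \<open>l\<close> is not restricted in size. A constant
  \<open>v\<close> gives sub-Gaussian variables.\<close>

definition self_normalized :: "real measure \<Rightarrow> (real \<Rightarrow> real) \<Rightarrow> (real \<Rightarrow> real) \<Rightarrow> bool" where
  "self_normalized \<nu> Y v \<longleftrightarrow> (\<forall>l. (\<integral>\<^sup>+x. ennreal (exp (l * Y x - l\<^sup>2 * (v x)\<^sup>2)) \<partial>\<nu>) \<le> 1)"

definition symmetric_exponential_law :: "real measure \<Rightarrow> bool" where
  "symmetric_exponential_law \<nu> \<longleftrightarrow> prob_space \<nu> \<and> sets \<nu> = sets borel \<and>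
     distr \<nu> borel uminus = \<nu> \<and> (\<forall>t>0. measure \<nu> {x. t \<le> \<bar>x\<bar>} = exp (- t))"

text \<open>The hypothesis gives closed tails, the criterion for exponential laws asks for the
  distribution function. The difference is a possible atom of \<open>\<bar>x\<bar>\<close> at
  \<open>a\<close>, excluded by letting the closed tail at \<open>a + e\<close> tend to the open
  tail at \<open>a\<close>.\<close>

lemma abs_exponential_distributed:
  assumes "symmetric_exponential_law \<nu>"
  shows "distributed \<nu> lborel abs (exponential_density 1)"
proof -
  interpret prob_space \<nu> using assms by (simp add: symmetric_exponential_law_def)
  have s[measurable_cong, simp]: "sets \<nu> = sets borel"
    and tail: "\<And>t. t > 0 \<Longrightarrow> measure \<nu> {x. t \<le> \<bar>x\<bar>} = exp (- t)"
    using assms by (auto simp: symmetric_exponential_law_def)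
  have sp: "space \<nu> = UNIV" using sets_eq_imp_space_eq[OF s] by simp
  have "measure \<nu> {x. \<bar>x\<bar> \<le> a} = 1 - exp (- a)" if "a \<ge> 0" for a
  proof -
    have m: "{x. a < \<bar>x\<bar>} \<in> sets \<nu>" by measurable
    have c: "measure \<nu> {x. \<bar>x\<bar> \<le> a} = 1 - measure \<nu> {x. a < \<bar>x\<bar>}"
      using prob_compl[OF m] by (simp add: sp Compl_eq_Diff_UNIV[symmetric] not_less Collect_neg_eq[symmetric])
    have "measure \<nu> {x. a < \<bar>x\<bar>} \<le> exp (- a)"
    proof (cases "a = 0")
      case False
      then have "measure \<nu> {x. a < \<bar>x\<bar>} \<le> measure \<nu> {x. a \<le> \<bar>x\<bar>}"
        by (intro finite_measure_mono) auto
      then show ?thesis using tail[of a] False that by simp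
    qed simp
    moreover have "exp (- a) \<le> measure \<nu> {x. a < \<bar>x\<bar>}"
    proof (rule tendsto_upperbound)
      show "((\<lambda>e. exp (- (a + e))) \<longlongrightarrow> exp (- a)) (at_right 0)"
        by (auto intro!: tendsto_eq_intros)
      show "\<forall>\<^sub>F e in at_right 0. exp (- (a + e)) \<le> measure \<nu> {x. a < \<bar>x\<bar>}"
      proof (rule eventually_at_right_less[THEN eventually_mono])
        fix e :: real assume "0 < e"
        then have "exp (- (a + e)) = measure \<nu> {x. a + e \<le> \<bar>x\<bar>}"
          using tail[of "a + e"] that by simp
        also have "\<dots> \<le> measure \<nu> {x. a < \<bar>x\<bar>}"
          using \<open>0 < e\<close> by (intro finite_measure_mono) auto
        finally show "exp (- (a + e)) \<le> measure \<nu> {x. a < \<bar>x\<bar>}" .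
      qed
    qed simp
    ultimately show ?thesis using c by simp
  qed
  then show ?thesis
    by (subst exponential_distributed_iff) (auto simp: sp)
qed

text \<open>Symmetry allows averaging over the two signs of the variable. With \<open>Y\<close> odd
  and \<open>v\<close> even the average depends on the absolute value only, whose density is known;
  the 2 on the right counts the signs.\<close>

lemma self_normalizedI:
  assumes \<nu>: "symmetric_exponential_law \<nu>"
    and [measurable]: "Y \<in> borel_measurable borel" "v \<in> borel_measurable borel"
    and odd: "\<And>x. Y (- x) = - Y x" and even: "\<And>x. v (- x) = v x"
    and le: "\<And>l. (\<integral>\<^sup>+t. ennreal (exponential_density 1 t) *
          ennreal ((exp (l * Y t) + exp (- (l * Y t))) * exp (- (l\<^sup>2 * (v t)\<^sup>2))) \<partial>lborel) \<le> 2"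
  shows "self_normalized \<nu> Y v"
  unfolding self_normalized_def
proof
  fix l
  have s[measurable_cong, simp]: "sets \<nu> = sets borel" and sym: "distr \<nu> borel uminus = \<nu>"
    using \<nu> by (auto simp: symmetric_exponential_law_def)
  define g where "g x = exp (l * Y x - l\<^sup>2 * (v x)\<^sup>2)" for x
  have [measurable]: "g \<in> borel_measurable borel" unfolding g_def by measurable
  have "(\<integral>\<^sup>+x. g x \<partial>\<nu>) = (\<integral>\<^sup>+x. g x \<partial>distr \<nu> borel uminus)" by (simp add: sym)
  also have "\<dots> = (\<integral>\<^sup>+x. g (- x) \<partial>\<nu>)" by (subst nn_integral_distr) auto
  finally have e: "(\<integral>\<^sup>+x. g x \<partial>\<nu>) = (\<integral>\<^sup>+x. g (- x) \<partial>\<nu>)" .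
  have "2 * (\<integral>\<^sup>+x. g x \<partial>\<nu>) = (\<integral>\<^sup>+x. g x \<partial>\<nu>) + (\<integral>\<^sup>+x. g (- x) \<partial>\<nu>)"
    by (simp add: mult_2 flip: e)
  also have "\<dots> = (\<integral>\<^sup>+x. ennreal (g x + g (- x)) \<partial>\<nu>)"
    by (subst nn_integral_add[symmetric]) (auto simp: g_def ennreal_plus)
  also have "\<dots> = (\<integral>\<^sup>+x. ennreal (g \<bar>x\<bar> + g (- \<bar>x\<bar>)) \<partial>\<nu>)"
    by (intro nn_integral_cong) (auto simp: abs_if add.commute)
  also have "\<dots> = (\<integral>\<^sup>+t. ennreal (exponential_density 1 t) * ennreal (g t + g (- t)) \<partial>lborel)"
    by (rule distributed_nn_integral[OF abs_exponential_distributed[OF \<nu>], symmetric]) measurable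
  also have "\<dots> = (\<integral>\<^sup>+t. ennreal (exponential_density 1 t) *
          ennreal ((exp (l * Y t) + exp (- (l * Y t))) * exp (- (l\<^sup>2 * (v t)\<^sup>2))) \<partial>lborel)"
    by (intro nn_integral_cong)
      (simp add: g_def odd even algebra_simps mult_exp_exp)
  also have "\<dots> \<le> 2 * 1" using le by simp
  finally show "(\<integral>\<^sup>+x. ennreal (exp (l * Y x - l\<^sup>2 * (v x)\<^sup>2)) \<partial>\<nu>) \<le> 1"
    unfolding g_def using ennreal_mult_le_mult_iff[of 2 _ 1] by simp
qed

text \<open>The normalization by \<open>\<bar>x\<bar>\<close> instead of \<open>x\<^sup>2\<close> is what makes exponential tails behave like
  those of a product of two Gaussian variables.\<close>

lemma self_normalized_exponential:
  assumes "symmetric_exponential_law \<nu>"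
  shows "self_normalized \<nu> (\<lambda>x. x / 2) (\<lambda>x. sqrt (\<bar>x\<bar> / 2))"
proof (rule self_normalizedI[OF assms])
  fix l :: real
  define u where "u = l\<^sup>2 / 2"
  have u: "u \<ge> 0" "u - l / 2 > -1" "u + l / 2 > -1"
    using zero_le_power2[of "l - 1 / 2"] zero_le_power2[of "l + 1 / 2"]
    by (auto simp: u_def power2_eq_square algebra_simps)
  have "(\<integral>\<^sup>+t. ennreal (exponential_density 1 t) *
      ennreal ((exp (l * (t / 2)) + exp (- (l * (t / 2)))) * exp (- (l\<^sup>2 * (sqrt (\<bar>t\<bar> / 2))\<^sup>2))) \<partial>lborel)
    = (\<integral>\<^sup>+t. ennreal (exponential_density 1 t) * ennreal (exp (- ((u - l / 2) * t))) +
         ennreal (exponential_density 1 t) * ennreal (exp (- ((u + l / 2) * t))) \<partial>lborel)"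
    by (intro nn_integral_cong)
      (auto simp: exponential_density_def u_def mult_exp_exp algebra_simps
        simp flip: ennreal_plus ennreal_mult)
  also have "\<dots> = ennreal (1 / (1 + (u - l / 2))) + ennreal (1 / (1 + (u + l / 2)))"
    by (subst nn_integral_add) (use u in \<open>auto simp: nn_integral_exp_exponential_density\<close>)
  also have "\<dots> = ennreal (1 / (1 + (u - l / 2)) + 1 / (1 + (u + l / 2)))"
    using u by (simp flip: ennreal_plus)
  \<comment> \<open>The product of the denominators is
    \<open>(1 + u)\<^sup>2 - l\<^sup>2 / 4\<close>, and \<open>l\<^sup>2 / 4 = u / 2\<close>, so it
    dominates \<open>1 + u\<close>.\<close>
  also have "1 / (1 + (u - l / 2)) + 1 / (1 + (u + l / 2)) \<le> 2"
  proof -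
    have "(1 + (u - l / 2)) * (1 + (u + l / 2)) = (1 + u)\<^sup>2 - u / 2"
      by (simp add: u_def power2_eq_square algebra_simps)
    moreover have "(1 + u) \<le> (1 + u)\<^sup>2 - u / 2"
      using u(1) mult_nonneg_nonneg[OF u(1) u(1)] unfolding power2_eq_square by argo
    moreover have "1 / (1 + (u - l / 2)) + 1 / (1 + (u + l / 2))
        = 2 * (1 + u) / ((1 + (u - l / 2)) * (1 + (u + l / 2)))"
      using u by (simp add: field_simps)
    moreover have "0 < (1 + (u - l / 2)) * (1 + (u + l / 2))" using u by simp
    ultimately show ?thesis by (simp add: divide_le_eq)
  qed
  finally show "(\<integral>\<^sup>+t. ennreal (exponential_density 1 t) *
      ennreal ((exp (l * (t / 2)) + exp (- (l * (t / 2)))) * exp (- (l\<^sup>2 * (sqrt (\<bar>t\<bar> / 2))\<^sup>2))) \<partial>lborel) \<le> 2"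
    by (simp add: ennreal_leI)
qed auto

text \<open>Hoeffding's lemma for a random sign: \<open>exp x * cosh x\<close> is the moment
  generating function at \<open>2 * x\<close> of a fair Bernoulli variable.\<close>

lemma cosh_le_exp_power2: "cosh (x::real) \<le> exp (x\<^sup>2 / 2)"
proof -
  have *: "cosh x \<le> exp (x\<^sup>2 / 2)" if "x \<ge> 0" for x :: real
  proof -
    have "1 + 1 / 2 * (exp (2 * x) - 1) = exp x * cosh x"
      by (simp add: cosh_def mult_exp_exp distrib_left diff_divide_distrib)
    moreover have "- (2 * x) * (1 / 2) + ln (1 + 1 / 2 * (exp (2 * x) - 1)) \<le> (2 * x)\<^sup>2 / 8"
      using that by (intro Hoeffdings_lemma_aux) auto
    ultimately have "ln (cosh x) \<le> x\<^sup>2 / 2"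
      using cosh_real_pos[of x] by (simp add: ln_mult power_mult_distrib)
    then show ?thesis using cosh_real_pos[of x] by (metis exp_le_cancel_iff exp_ln)
  qed
  show ?thesis using *[of x] *[of "- x"] by (cases "x \<ge> 0") auto
qed

text \<open>The square root of an exponential variable has Gaussian tails. The scaling is chosen so
  that the absolute value of this variable is exactly the \<open>v\<close> of
  \<open>self_normalized_exponential\<close>, which lets the two steps follow each other.\<close>

lemma self_normalized_sqrt_exponential:
  assumes "symmetric_exponential_law \<nu>"
  shows "self_normalized \<nu> (\<lambda>x. sgn x * sqrt (\<bar>x\<bar> / 2)) (\<lambda>x. 1)"
proof (rule self_normalizedI[OF assms])
  fix l :: real
  \<comment> \<open>A dominating function \<open>A * exp (- (s * t))\<close> integrates to
    \<open>A / (1 + s)\<close>. For small \<open>l\<close> the bound on \<open>cosh\<close> gives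
    \<open>s = - l\<^sup>2 / 4\<close>, integrable only if \<open>l\<^sup>2 < 4\<close>. For large
    \<open>l\<close> the inequality between arithmetic and geometric means gives
    \<open>s = - 1 / 2\<close>, whose factor 2 is absorbed by
    \<open>exp (3 * l\<^sup>2 / 4)\<close>.\<close>
  obtain A s where A: "A > 0" "s > -1" "A / (1 + s) \<le> exp (l\<^sup>2)"
    and b: "\<And>t. t \<ge> 0 \<Longrightarrow> exp (l * sqrt (t / 2)) + exp (- (l * sqrt (t / 2))) \<le> 2 * (A * exp (- (s * t)))"
  proof (cases "l\<^sup>2 \<le> 2")
    case True
    show ?thesis
    proof (rule that)
      have "1 \<le> (1 - l\<^sup>2 / 4) * (1 + l\<^sup>2)"
      proof -
        have "(1 - l\<^sup>2 / 4) * (1 + l\<^sup>2) = 1 + l\<^sup>2 * (1 / 4) + l\<^sup>2 * (2 - l\<^sup>2) / 4"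
          by algebra
        then show ?thesis using True by simp
      qed
      also have "\<dots> \<le> (1 - l\<^sup>2 / 4) * exp (l\<^sup>2)"
        using True by (intro mult_left_mono) (auto simp: exp_ge_add_one_self)
      finally show "1 / (1 + - (l\<^sup>2 / 4)) \<le> exp (l\<^sup>2)"
        using True by (simp add: divide_le_eq mult.commute)
      fix t :: real assume t: "t \<ge> 0"
      have "exp (l * sqrt (t / 2)) + exp (- (l * sqrt (t / 2))) = 2 * cosh (l * sqrt (t / 2))"
        by (simp add: cosh_def)
      also note cosh_le_exp_power2[of "l * sqrt (t / 2)"]
      also have "(l * sqrt (t / 2))\<^sup>2 / 2 = - (- (l\<^sup>2 / 4) * t)"
        using t by (simp add: power_mult_distrib)
      finally show "exp (l * sqrt (t / 2)) + exp (- (l * sqrt (t / 2))) \<le> 2 * (1 * exp (- (- (l\<^sup>2 / 4) * t)))"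
        by simp
    qed (use True in auto)
  next
    case False
    show ?thesis
    proof (rule that)
      have "2 * exp (l\<^sup>2 / 4) \<le> exp (3 * l\<^sup>2 / 4) * exp (l\<^sup>2 / 4)"
        using exp_ge_add_one_self[of "3 * l\<^sup>2 / 4"] False by (intro mult_right_mono) (linarith, simp)
      also have "\<dots> = exp (l\<^sup>2)" by (simp add: mult_exp_exp)
      finally show "exp (l\<^sup>2 / 4) / (1 + - (1 / 2)) \<le> exp (l\<^sup>2)" by simp
      fix t :: real assume t: "t \<ge> 0"
      have st: "(sqrt (t / 2))\<^sup>2 = t / 2" using t by simp
      have "l * sqrt (t / 2) \<le> l\<^sup>2 / 4 + t / 2" "- (l * sqrt (t / 2)) \<le> l\<^sup>2 / 4 + t / 2"
        using zero_le_power2[of "l / 2 - sqrt (t / 2)"] zero_le_power2[of "l / 2 + sqrt (t / 2)"] st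
        by (simp_all add: power2_eq_square algebra_simps)
      then have "exp (l * sqrt (t / 2)) + exp (- (l * sqrt (t / 2)))
          \<le> exp (l\<^sup>2 / 4 + t / 2) + exp (l\<^sup>2 / 4 + t / 2)"
        by (intro add_mono) auto
      also have "\<dots> = 2 * (exp (l\<^sup>2 / 4) * exp (- (- (1 / 2) * t)))"
        by (simp add: mult_exp_exp)
      finally show "exp (l * sqrt (t / 2)) + exp (- (l * sqrt (t / 2)))
          \<le> 2 * (exp (l\<^sup>2 / 4) * exp (- (- (1 / 2) * t)))" .
    qed auto
  qed
  have "(\<integral>\<^sup>+t. ennreal (exponential_density 1 t) *
      ennreal ((exp (l * (sgn t * sqrt (\<bar>t\<bar> / 2))) + exp (- (l * (sgn t * sqrt (\<bar>t\<bar> / 2)))))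
        * exp (- (l\<^sup>2 * 1\<^sup>2))) \<partial>lborel)
    \<le> (\<integral>\<^sup>+t. ennreal (2 * A * exp (- l\<^sup>2)) * (ennreal (exponential_density 1 t) * ennreal (exp (- (s * t)))) \<partial>lborel)"
  proof (rule nn_integral_mono)
    fix t :: real
    show "ennreal (exponential_density 1 t) *
      ennreal ((exp (l * (sgn t * sqrt (\<bar>t\<bar> / 2))) + exp (- (l * (sgn t * sqrt (\<bar>t\<bar> / 2)))))
        * exp (- (l\<^sup>2 * 1\<^sup>2)))
      \<le> ennreal (2 * A * exp (- l\<^sup>2)) * (ennreal (exponential_density 1 t) * ennreal (exp (- (s * t))))"
    proof (cases "t \<ge> 0")
      case True
      have "sgn t * sqrt (\<bar>t\<bar> / 2) = sqrt (t / 2)" using True by (simp add: sgn_if)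
      then have "(exp (l * (sgn t * sqrt (\<bar>t\<bar> / 2))) + exp (- (l * (sgn t * sqrt (\<bar>t\<bar> / 2)))))
          * exp (- (l\<^sup>2 * 1\<^sup>2)) \<le> 2 * (A * exp (- (s * t))) * exp (- l\<^sup>2)"
        using b[OF True] by (simp add: mult_right_mono)
      then have "exponential_density 1 t * ((exp (l * (sgn t * sqrt (\<bar>t\<bar> / 2))) + exp (- (l * (sgn t * sqrt (\<bar>t\<bar> / 2)))))
          * exp (- (l\<^sup>2 * 1\<^sup>2))) \<le> exponential_density 1 t * (2 * (A * exp (- (s * t))) * exp (- l\<^sup>2))"
        by (intro mult_left_mono) (auto simp: exponential_density_nonneg)
      then show ?thesis using A
        by (simp add: exponential_density_nonneg mult_ac ennreal_leI flip: ennreal_mult)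
    qed (simp add: exponential_density_def)
  qed
  also have "\<dots> = ennreal (2 * A * exp (- l\<^sup>2)) * ennreal (1 / (1 + s))"
    using A by (simp add: nn_integral_cmult nn_integral_exp_exponential_density)
  also have "\<dots> = ennreal (2 * (A / (1 + s)) * exp (- l\<^sup>2))"
    using A by (simp flip: ennreal_mult add: field_simps)
  also have "2 * (A / (1 + s)) * exp (- l\<^sup>2) \<le> 2 * exp (l\<^sup>2) * exp (- l\<^sup>2)"
    using A by (intro mult_right_mono) auto
  also have "\<dots> = 2" by (simp add: exp_minus)
  finally show "(\<integral>\<^sup>+t. ennreal (exponential_density 1 t) *
      ennreal ((exp (l * (sgn t * sqrt (\<bar>t\<bar> / 2))) + exp (- (l * (sgn t * sqrt (\<bar>t\<bar> / 2)))))
        * exp (- (l\<^sup>2 * 1\<^sup>2))) \<partial>lborel) \<le> 2"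
    by (simp add: ennreal_leI)
qed (auto simp: sgn_minus)

section \<open>Lower bounds for the partition norms\<close>

lemma finite_multi_idx [simp]: "finite I \<Longrightarrow> finite (multi_idx n I)"
  by (simp add: multi_idx_def finite_PiE)

lemma restrict_multi_idx: "i \<in> multi_idx n I \<Longrightarrow> J \<subseteq> I \<Longrightarrow> restrict i J \<in> multi_idx n J"
  by (auto simp: multi_idx_def)

lemma multi_idx_empty [simp]: "multi_idx n {} = {\<lambda>_. undefined}"
  by (simp add: multi_idx_def)

lemma sum_multi_idx_split:
  assumes "j \<in> I"
  shows "(\<Sum>k\<in>multi_idx n I. f k) = (\<Sum>m=1..n. \<Sum>k\<in>multi_idx n (I - {j}). f (k(j := m)))"
proof -
  have "multi_idx n I = (\<lambda>(m, k). k(j := m)) ` ({1..n} \<times> multi_idx n (I - {j}))"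
    using PiE_insert_eq[of j "I - {j}" "\<lambda>_. {1..n}"] assms by (simp add: multi_idx_def insert_absorb)
  moreover have "inj_on (\<lambda>(m, k). k(j := m)) ({1..n} \<times> multi_idx n (I - {j}))"
    using inj_combinator[of j "I - {j}" "\<lambda>_. {1..n}"] by (simp add: multi_idx_def)
  ultimately have "(\<Sum>k\<in>multi_idx n I. f k)
      = (\<Sum>(m, k)\<in>{1..n} \<times> multi_idx n (I - {j}). f (k(j := m)))"
    by (simp add: sum.reindex case_prod_unfold)
  then show ?thesis by (simp add: sum.cartesian_product)
qed

lemma hat_fun_nonneg:
  assumes "\<And>t. t > 0 \<Longrightarrow> N t = t"
  shows "0 \<le> hat_fun N t"
  using assms[of "\<bar>t\<bar>"] by (auto simp: hat_fun_def)

text \<open>This makes every array of Euclidean norm at most \<open>sqrt p\<close> admissible for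
  its block.\<close>

lemma hat_fun_le_power2:
  assumes "\<And>t. t > 0 \<Longrightarrow> N t = t"
  shows "hat_fun N t \<le> t\<^sup>2"
proof (cases "\<bar>t\<bar> \<le> 1")
  case False
  then have "1 * \<bar>t\<bar> \<le> \<bar>t\<bar> * \<bar>t\<bar>" by (intro mult_right_mono) auto
  with False assms[of "\<bar>t\<bar>"] show ?thesis by (simp add: hat_fun_def power2_eq_square)
qed (simp add: hat_fun_def)

text \<open>Linear growth admits a point mass of size \<open>p\<close>, far beyond the Euclidean
  radius \<open>sqrt p\<close>.\<close>

lemma hat_fun_le:
  assumes "\<And>t. t > 0 \<Longrightarrow> N t = t" and "1 \<le> p" "\<bar>t\<bar> \<le> p"
  shows "hat_fun N t \<le> p"
proof (cases "\<bar>t\<bar> \<le> 1")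
  case True
  then have "t\<^sup>2 \<le> 1" by (simp add: abs_square_le_1)
  with True assms show ?thesis by (simp add: hat_fun_def)
next
  case False
  with assms show ?thesis by (simp add: hat_fun_def)
qed

lemma abs_le_of_hat_fun_le:
  assumes "\<And>t. t > 0 \<Longrightarrow> N t = t" and "1 \<le> p" "hat_fun N t \<le> p"
  shows "\<bar>t\<bar> \<le> p"
  using assms by (cases "\<bar>t\<bar> \<le> 1") (auto simp: hat_fun_def)

lemma abs_le_L2_set: "finite A \<Longrightarrow> k \<in> A \<Longrightarrow> \<bar>f k\<bar> \<le> L2_set f A"
  using member_le_L2_set[of A k "\<lambda>i. \<bar>f i\<bar>"] by (simp add: L2_set_def)

text \<open>The constraint bounds each entry by \<open>p\<close>, so the real suprema are genuine
  upper bounds; the zero arrays make each of them nonnegative, so one selection \<open>s\<close> may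
  be compared with the whole sum. The absolute value comes from negating one array.\<close>

lemma abs_le_partition_norm:
  fixes p :: real
  assumes N: "\<And>m j t. m \<in> {1..n} \<Longrightarrow> j \<in> {1..d} \<Longrightarrow> t > 0 \<Longrightarrow> N m j t = t"
    and p: "1 \<le> p" and J: "partition_on {1..d} J" "J \<noteq> {}" and s: "s \<in> (\<Pi>\<^sub>E I\<in>J. I)"
    and x: "\<forall>I\<in>J. (\<Sum>m=1..n. hat_fun (N m (s I)) (L2_set (x I) {k \<in> multi_idx n I. k (s I) = m})) \<le> p"
  shows "\<bar>\<Sum>i\<in>multi_idx n {1..d}. a i * (\<Prod>I\<in>J. x I (restrict i I))\<bar> \<le> partition_norm n d N p J a"
proof -
  define F where "F s = {x :: nat set \<Rightarrow> (nat \<Rightarrow> nat) \<Rightarrow> real.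
      \<forall>I\<in>J. (\<Sum>m=1..n. hat_fun (N m (s I)) (L2_set (x I) {k \<in> multi_idx n I. k (s I) = m})) \<le> p}" for s
  define v where "v x = (\<Sum>i\<in>multi_idx n {1..d}. a i * (\<Prod>I\<in>J. x I (restrict i I)))"
    for x :: "nat set \<Rightarrow> (nat \<Rightarrow> nat) \<Rightarrow> real"
  have sub: "I \<subseteq> {1..d}" if "I \<in> J" for I
    using J(1) that by (auto simp: partition_on_def)
  have finJ: "finite J" using J(1) finite_elements by blast
  have finI: "finite I" if "I \<in> J" for I using sub[OF that] finite_subset by blast
  have bdd: "bdd_above (v ` F s)" if s: "s \<in> (\<Pi>\<^sub>E I\<in>J. I)" for s
  proof (rule bdd_aboveI2)
    fix y assume y: "y \<in> F s"
    have entry: "\<bar>y I k\<bar> \<le> p" if I: "I \<in> J" and k: "k \<in> multi_idx n I" for I k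
    proof -
      have sI: "s I \<in> I" using s I by (rule PiE_mem)
      with sub[OF I] have sd: "s I \<in> {1..d}" by blast
      define m where "m = k (s I)"
      have m: "m \<in> {1..n}" using k sI by (auto simp: m_def multi_idx_def)
      define T where "T m = L2_set (y I) {k \<in> multi_idx n I. k (s I) = m}" for m
      have "hat_fun (N m (s I)) (T m) \<le> (\<Sum>m=1..n. hat_fun (N m (s I)) (T m))"
        using m N sd by (intro member_le_sum hat_fun_nonneg) auto
      also have "\<dots> \<le> p" using y I by (auto simp: F_def T_def)
      finally have "\<bar>T m\<bar> \<le> p" using N m sd p by (intro abs_le_of_hat_fun_le[of "N m (s I)"]) auto
      moreover have "\<bar>y I k\<bar> \<le> T m"
        unfolding T_def using k finI[OF I] by (intro abs_le_L2_set) (auto simp: m_def)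
      ultimately show ?thesis by linarith
    qed
    have "v y \<le> (\<Sum>i\<in>multi_idx n {1..d}. \<bar>a i\<bar> * p ^ card J)"
      unfolding v_def
    proof (rule sum_mono)
      fix i assume i: "i \<in> multi_idx n {1..d}"
      have "\<bar>\<Prod>I\<in>J. y I (restrict i I)\<bar> = (\<Prod>I\<in>J. \<bar>y I (restrict i I)\<bar>)" by (rule abs_prod)
      also have "\<dots> \<le> (\<Prod>I\<in>J. p)"
        using entry restrict_multi_idx[OF i] sub by (intro prod_mono) auto
      finally have "\<bar>a i\<bar> * \<bar>\<Prod>I\<in>J. y I (restrict i I)\<bar> \<le> \<bar>a i\<bar> * p ^ card J"
        by (intro mult_left_mono) auto
      moreover have "a i * (\<Prod>I\<in>J. y I (restrict i I)) \<le> \<bar>a i\<bar> * \<bar>\<Prod>I\<in>J. y I (restrict i I)\<bar>"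
        by (simp flip: abs_mult)
      ultimately show "a i * (\<Prod>I\<in>J. y I (restrict i I)) \<le> \<bar>a i\<bar> * p ^ card J" by linarith
    qed
    then show "v y \<le> (\<Sum>i\<in>multi_idx n {1..d}. \<bar>a i\<bar> * p ^ card J)" .
  qed
  have "0 \<le> (SUP x\<in>F s. v x)" if s: "s \<in> (\<Pi>\<^sub>E I\<in>J. I)" for s
  proof (rule cSUP_upper2[OF bdd[OF s]])
    show "(\<lambda>_ _. 0) \<in> F s" using p by (simp add: F_def hat_fun_def L2_set_def)
    show "0 \<le> v (\<lambda>_ _. 0)" using J(2) finJ by (simp add: v_def power_0_left)
  qed
  then have "(SUP x\<in>F s. v x) \<le> (\<Sum>s\<in>(\<Pi>\<^sub>E I\<in>J. I). SUP x\<in>F s. v x)"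
    using s finJ finI by (intro member_le_sum) (auto intro!: finite_PiE)
  then have le: "v y \<le> partition_norm n d N p J a" if "y \<in> F s" for y
    unfolding partition_norm_def F_def[symmetric] v_def[symmetric]
    using cSUP_upper[OF that bdd[OF s]] by linarith
  obtain I0 where I0: "I0 \<in> J" using J(2) by auto
  define y where "y = x(I0 := (\<lambda>k. - x I0 k))"
  have "L2_set (\<lambda>k. - x I0 k) A = L2_set (x I0) A" for A by (simp add: L2_set_def)
  then have y: "y \<in> F s" using x by (simp add: F_def y_def)
  have "(\<Prod>I\<in>J. y I (restrict i I)) = - (\<Prod>I\<in>J. x I (restrict i I))" for i
    using I0 finJ by (simp add: prod.remove[of J I0] y_def)
  then have "v y = - v x" by (simp add: v_def sum_negf)
  moreover have "x \<in> F s" using x by (simp add: F_def)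
  ultimately show ?thesis using le[of x] le[OF y] unfolding v_def[symmetric] by linarith
qed

text \<open>Spreads a scalar over the point masses: one factor takes the remainder, all others are
  \<open>p\<close>.\<close>

lemma exists_prod_eq:
  fixes p c :: real
  assumes "finite S" "0 < p" "\<bar>c\<bar> \<le> p ^ card S" "S = {} \<Longrightarrow> c = 1"
  shows "\<exists>w. (\<forall>j\<in>S. \<bar>w j\<bar> \<le> p) \<and> (\<Prod>j\<in>S. w j) = c"
proof (cases "S = {}")
  case False
  then obtain j0 where j0: "j0 \<in> S" by auto
  have card: "card S = Suc (card (S - {j0}))" by (rule card.remove[OF assms(1) j0])
  define w where "w = (\<lambda>_. p)(j0 := c / p ^ card (S - {j0}))"
  have "(\<Prod>j\<in>S. w j) = c"
    using j0 assms(1,2) by (simp add: prod.remove[of S j0] w_def)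
  moreover have "\<bar>w j\<bar> \<le> p" for j
    using assms(2,3) card by (auto simp: w_def divide_le_eq abs_divide mult.commute)
  ultimately show ?thesis by (intro exI[of _ w]) auto
qed (use assms in auto)

text \<open>Injectivity and disjointness let a block of the partition determine its array. Empty
  blocks cannot belong to a partition and are left to be treated as scalars.\<close>

lemma partition_of_disjoint_blocks:
  assumes "S \<subseteq> A" and "\<And>l. l \<in> L \<Longrightarrow> B l \<subseteq> A - S"
    and one: "\<And>j. j \<in> A - S \<Longrightarrow> card {l \<in> L. j \<in> B l} = 1"
  defines "L0 \<equiv> {l \<in> L. B l \<noteq> {}}"
  shows "partition_on A ((\<lambda>j. {j}) ` S \<union> B ` L0)" and "inj_on B L0"
    and "(\<lambda>j. {j}) ` S \<inter> B ` L0 = {}"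
proof -
  have uniq: "l = l'" if "l \<in> L" "l' \<in> L" "j \<in> B l" "j \<in> B l'" for l l' j
  proof -
    have "j \<in> A - S" using assms(2)[OF that(1)] that(3) by auto
    from one[OF this] obtain z where z: "{l \<in> L. j \<in> B l} = {z}" by (auto simp: card_1_singleton_iff)
    have "l \<in> {l \<in> L. j \<in> B l}" "l' \<in> {l \<in> L. j \<in> B l}" using that by simp_all
    then show ?thesis unfolding z by simp
  qed
  have ex: "\<exists>l\<in>L. j \<in> B l" if "j \<in> A - S" for j
  proof -
    have "{l \<in> L. j \<in> B l} \<noteq> {}" using one[OF that] by (metis card.empty zero_neq_one)
    then show ?thesis by blast
  qed
  show "partition_on A ((\<lambda>j. {j}) ` S \<union> B ` L0)"
  proof (rule partition_onI)
    show "\<Union> ((\<lambda>j. {j}) ` S \<union> B ` L0) = A"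
    proof
      show "\<Union> ((\<lambda>j. {j}) ` S \<union> B ` L0) \<subseteq> A"
        by (auto simp: L0_def dest: subsetD[OF assms(1)] subsetD[OF assms(2)])
      show "A \<subseteq> \<Union> ((\<lambda>j. {j}) ` S \<union> B ` L0)"
      proof
        fix j assume "j \<in> A"
        show "j \<in> \<Union> ((\<lambda>j. {j}) ` S \<union> B ` L0)"
        proof (cases "j \<in> S")
          case False
          then obtain l where "l \<in> L" "j \<in> B l" using ex \<open>j \<in> A\<close> by auto
          then show ?thesis by (auto simp: L0_def)
        qed auto
      qed
    qed
    show "disjnt P Q" if PQ: "P \<in> (\<lambda>j. {j}) ` S \<union> B ` L0" "Q \<in> (\<lambda>j. {j}) ` S \<union> B ` L0" "P \<noteq> Q" for P Q
    proof (rule ccontr)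
      assume "\<not> disjnt P Q"
      then obtain j where j: "j \<in> P" "j \<in> Q" by (auto simp: disjnt_def)
      show False
      proof (cases "j \<in> S")
        case True
        then have "j \<notin> B l" if "l \<in> L" for l using assms(2)[OF that] by blast
        then have "P = {j}" "Q = {j}" using PQ j by (auto simp: L0_def)
        then show False using PQ by simp
      next
        case False
        then obtain l l' where "l \<in> L" "l' \<in> L" "P = B l" "Q = B l'" using PQ j by (auto simp: L0_def)
        then show False using uniq[of l l' j] j PQ by auto
      qed
    qed
  qed (auto simp: L0_def)
  show "inj_on B L0"
  proof (rule inj_onI)
    fix l l' assume l: "l \<in> L0" "l' \<in> L0" "B l = B l'"
    then obtain j where "j \<in> B l" by (auto simp: L0_def)
    then show "l = l'" using l by (intro uniq[of l l' j]) (auto simp: L0_def)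
  qed
  show "(\<lambda>j. {j}) ` S \<inter> B ` L0 = {}"
  proof -
    have "False" if "j \<in> S" "{j} = B l" "l \<in> L" for j l
      using assms(2)[OF that(3)] that by blast
    then show ?thesis by (auto simp: L0_def)
  qed
qed

text \<open>Each fixed coordinate becomes a singleton block carrying a point mass. Arrays with empty
  block are scalars of size at most \<open>sqrt p\<close>; as there are at most two of them per
  fixed coordinate, their product is at most \<open>p ^ card S\<close> and splits into weights of
  size at most \<open>p\<close> for the point masses.\<close>

lemma disjoint_blocks_bound:
  fixes p :: real and L :: "'l set"
  assumes N: "\<And>m j t. m \<in> {1..n} \<Longrightarrow> j \<in> {1..d} \<Longrightarrow> t > 0 \<Longrightarrow> N m j t = t"
    and p: "1 \<le> p" and d: "1 \<le> d" and L: "finite L" and S: "S \<subseteq> {1..d}"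
    and B: "\<And>l. l \<in> L \<Longrightarrow> B l \<subseteq> {1..d} - S"
    and one: "\<And>j. j \<in> {1..d} - S \<Longrightarrow> card {l \<in> L. j \<in> B l} = 1"
    and empty: "card {l \<in> L. B l = {}} \<le> 2 * card S"
    and x: "\<And>l. l \<in> L \<Longrightarrow> (\<Sum>k\<in>multi_idx n (B l). (x l k)\<^sup>2) \<le> p"
  shows "\<bar>\<Sum>i\<in>multi_idx n {1..d}. a i * (if \<forall>j\<in>S. i j = m j then 1 else 0) * (\<Prod>l\<in>L. x l (restrict i (B l)))\<bar>
     \<le> (\<Sum>J | partition_on {1..d} J. partition_norm n d N p J a)"
proof -
  define L0 where "L0 = {l \<in> L. B l \<noteq> {}}"
  define E where "E = {l \<in> L. B l = {}}"
  define J where "J = (\<lambda>j. {j}) ` S \<union> B ` L0"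
  note blocks = partition_of_disjoint_blocks[OF S B one, folded L0_def, folded J_def]
  have J: "partition_on {1..d} J" by (rule blocks) auto
  have inj: "inj_on B L0" by (rule blocks) auto
  have disj: "(\<lambda>j. {j}) ` S \<inter> B ` L0 = {}" by (rule blocks) auto
  have "J \<noteq> {}" using J d by (auto simp: partition_on_def)
  have finS: "finite S" using S finite_subset by blast
  have LE: "L = L0 \<union> E" "L0 \<inter> E = {}" "finite L0" "finite E"
    using L by (auto simp: L0_def E_def)
  define c where "c = (\<Prod>l\<in>E. x l (\<lambda>_. undefined))"
  have "\<bar>c\<bar> \<le> p ^ card S"
  proof -
    have "\<bar>x l (\<lambda>_. undefined)\<bar> \<le> sqrt p" if "l \<in> E" for l
    proof -
      have "(x l (\<lambda>_. undefined))\<^sup>2 \<le> p" using x[of l] that by (simp add: E_def)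
      then show ?thesis by (metis real_sqrt_abs real_sqrt_le_iff)
    qed
    then have "\<bar>c\<bar> \<le> (\<Prod>l\<in>E. sqrt p)"
      unfolding c_def abs_prod by (intro prod_mono) auto
    also have "\<dots> \<le> sqrt p ^ (2 * card S)"
      using empty p by (simp add: E_def power_increasing)
    also have "\<dots> = p ^ card S" using p by (simp add: power_mult)
    finally show ?thesis .
  qed
  \<comment> \<open>Without fixed coordinates there is no point mass to absorb a scalar, but then no
    block is empty either.\<close>
  moreover have "c = 1" if "S = {}"
    using empty LE(4) that unfolding E_def[symmetric] by (simp add: c_def)
  ultimately have "\<exists>w. (\<forall>j\<in>S. \<bar>w j\<bar> \<le> p) \<and> (\<Prod>j\<in>S. w j) = c"
    using finS p by (intro exists_prod_eq) auto
  then obtain w where w: "\<And>j. j \<in> S \<Longrightarrow> \<bar>w j\<bar> \<le> p" "(\<Prod>j\<in>S. w j) = c"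
    by blast
  \<comment> \<open>A block of the partition either carries a point mass or is traced back to its
    label by inverting \<open>B\<close>.\<close>
  define y where "y I k = (if I \<in> (\<lambda>j. {j}) ` S then (let j = the_elem I in w j * (if k j = m j then 1 else 0))
      else x (inv_into L0 B I) k)" for I k
  have yS: "y {j} k = w j * (if k j = m j then 1 else 0)" if "j \<in> S" for j k
    using that by (simp add: y_def)
  have yB: "y (B l) k = x l k" if "l \<in> L0" for l k
    using that disj inj by (auto simp: y_def)
  \<comment> \<open>An arbitrary selection is good enough: after \<open>hat_fun_le_power2\<close>
    the slices of an array add up to its full squared norm, whichever coordinate is used for
    slicing.\<close>
  define s where "s = (\<lambda>I\<in>J. SOME j. j \<in> I)"
  have s: "s I \<in> I" if "I \<in> J" for I
    using J that by (auto simp: s_def partition_on_def some_in_eq)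
  have sub: "I \<subseteq> {1..d}" if "I \<in> J" for I using J that by (auto simp: partition_on_def)
  have adm: "(\<Sum>m'=1..n. hat_fun (N m' (s I)) (L2_set (y I) {k \<in> multi_idx n I. k (s I) = m'})) \<le> p"
    if I: "I \<in> J" for I
  proof -
    have sd: "s I \<in> {1..d}" using s[OF I] sub[OF I] by auto
    have finI: "finite I" using sub[OF I] finite_subset by blast
    show ?thesis
    proof (cases "I \<in> (\<lambda>j. {j}) ` S")
      case True
      then obtain j where j: "j \<in> S" "I = {j}" by auto
      have sj: "s I = j" using s[OF I] j by auto
      have e: "L2_set (y I) {k \<in> multi_idx n I. k (s I) = m'} = (if m' = m j then \<bar>w j\<bar> else 0)"
        if m': "m' \<in> {1..n}" for m'
      proof -
        have "{k \<in> multi_idx n I. k (s I) = m'} = {\<lambda>i. if i = j then m' else undefined}"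
          unfolding sj using m' by (auto simp: j multi_idx_def PiE_def extensional_def fun_eq_iff)
        then show ?thesis by (simp add: j yS)
      qed
      have "(\<Sum>m'=1..n. hat_fun (N m' (s I)) (L2_set (y I) {k \<in> multi_idx n I. k (s I) = m'}))
          = (\<Sum>m'\<in>{1..n}. if m' = m j then hat_fun (N m' (s I)) \<bar>w j\<bar> else 0)"
        by (intro sum.cong) (auto simp: e hat_fun_def)
      also have "\<dots> \<le> p"
        using N sd w(1)[OF j(1)] p hat_fun_le[of "N (m j) (s I)" p "\<bar>w j\<bar>"] by (simp add: sum.delta')
      finally show ?thesis .
    next
      case False
      then obtain l where l: "l \<in> L0" "I = B l" using I by (auto simp: J_def)
      have "(\<Sum>m'=1..n. hat_fun (N m' (s I)) (L2_set (y I) {k \<in> multi_idx n I. k (s I) = m'}))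
          \<le> (\<Sum>m'=1..n. (L2_set (y I) {k \<in> multi_idx n I. k (s I) = m'})\<^sup>2)"
        using N sd by (intro sum_mono hat_fun_le_power2) auto
      also have "\<dots> = (\<Sum>m'=1..n. \<Sum>k\<in>{k \<in> multi_idx n I. k (s I) = m'}. (x l k)\<^sup>2)"
        by (intro sum.cong) (auto simp: L2_set_def sum_nonneg l yB)
      also have "\<dots> = (\<Sum>k\<in>multi_idx n I. (x l k)\<^sup>2)"
        using s[OF I] finI by (intro sum.group) (auto simp: multi_idx_def intro!: finite_PiE)
      also have "\<dots> \<le> p" using x[of l] l by (simp add: L0_def)
      finally show ?thesis .
    qed
  qed
  have prod_eq: "(\<Prod>I\<in>J. y I (restrict i I))
      = (if \<forall>j\<in>S. i j = m j then 1 else 0) * (\<Prod>l\<in>L. x l (restrict i (B l)))" for i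
  proof -
    have "(\<Prod>I\<in>J. y I (restrict i I))
        = (\<Prod>I\<in>(\<lambda>j. {j}) ` S. y I (restrict i I)) * (\<Prod>I\<in>B ` L0. y I (restrict i I))"
      unfolding J_def using finS LE disj by (intro prod.union_disjoint) auto
    also have "(\<Prod>I\<in>(\<lambda>j. {j}) ` S. y I (restrict i I)) = (\<Prod>j\<in>S. w j * (if i j = m j then 1 else 0))"
      by (simp add: prod.reindex yS)
    also have "\<dots> = c * (if \<forall>j\<in>S. i j = m j then 1 else 0)"
      using w(2) finS by (auto simp: prod.distrib)
    also have "(\<Prod>I\<in>B ` L0. y I (restrict i I)) = (\<Prod>l\<in>L0. x l (restrict i (B l)))"
      using inj by (simp add: prod.reindex yB)
    also have "c = (\<Prod>l\<in>E. x l (restrict i (B l)))"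
      unfolding c_def by (intro prod.cong) (auto simp: E_def restrict_def)
    finally show ?thesis
      unfolding LE(1) prod.union_disjoint[OF LE(3,4,2)] by (simp only: mult_ac)
  qed
  have nonneg: "0 \<le> partition_norm n d N p J' a" if J': "partition_on {1..d} J'" for J'
  proof -
    have "J' \<noteq> {}" using J' d by (auto simp: partition_on_def)
    have s': "(\<lambda>I\<in>J'. SOME j. j \<in> I) \<in> (\<Pi>\<^sub>E I\<in>J'. I)"
      using J' by (auto simp: partition_on_def some_in_eq)
    have "\<bar>\<Sum>i\<in>multi_idx n {1..d}. a i * (\<Prod>I\<in>J'. 0)\<bar> \<le> partition_norm n d N p J' a"
      using p by (intro abs_le_partition_norm[OF N p J' \<open>J' \<noteq> {}\<close> s', where x = "\<lambda>_ _. 0"])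
        (auto simp: L2_set_def hat_fun_def)
    then show ?thesis by linarith
  qed
  have "\<bar>\<Sum>i\<in>multi_idx n {1..d}. a i * (\<Prod>I\<in>J. y I (restrict i I))\<bar> \<le> partition_norm n d N p J a"
    using J \<open>J \<noteq> {}\<close> p adm s
    by (intro abs_le_partition_norm[OF N, where s = s]) (auto simp: s_def)
  also have "\<dots> \<le> (\<Sum>J | partition_on {1..d} J. partition_norm n d N p J a)"
    using J nonneg by (intro member_le_sum finitely_many_partition_on) auto
  finally show ?thesis by (simp add: prod_eq mult.assoc)
qed

text \<open>A coordinate \<open>j\<close> shared by two blocks is removed from both: the arrays are split into their
  slices \<open>i\<^sub>j = m\<close>, each rescaled to the radius \<open>sqrt p\<close>, and the products of the two slice norms
  sum over \<open>m\<close> to at most \<open>p\<close>, which is the size allowed to the new singleton block \<open>{j}\<close>.\<close>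

lemma shared_blocks_bound:
  fixes p :: real and L :: "'l set"
  assumes N: "\<And>m j t. m \<in> {1..n} \<Longrightarrow> j \<in> {1..d} \<Longrightarrow> t > 0 \<Longrightarrow> N m j t = t"
    and p: "1 \<le> p" and d: "1 \<le> d" and L: "finite L" and S: "S \<subseteq> {1..d}"
    and B: "\<And>l. l \<in> L \<Longrightarrow> B l \<subseteq> {1..d} - S"
    and cover: "\<And>j. j \<in> {1..d} - S \<Longrightarrow> card {l \<in> L. j \<in> B l} \<in> {1, 2}"
    and empty: "card {l \<in> L. B l = {}} \<le> 2 * card S"
    and x: "\<And>l. l \<in> L \<Longrightarrow> (\<Sum>k\<in>multi_idx n (B l). (x l k)\<^sup>2) \<le> p"
  shows "\<bar>\<Sum>i\<in>multi_idx n {1..d}. a i * (if \<forall>j\<in>S. i j = m j then 1 else 0) * (\<Prod>l\<in>L. x l (restrict i (B l)))\<bar>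
     \<le> (\<Sum>J | partition_on {1..d} J. partition_norm n d N p J a)"
  using S B cover empty x
proof (induction "card ({1..d} - S)" arbitrary: S B x m rule: less_induct)
  case less
  note S = less.prems(1) and B = less.prems(2) and cover = less.prems(3)
    and empty = less.prems(4) and x = less.prems(5)
  let ?R = "\<Sum>J | partition_on {1..d} J. partition_norm n d N p J a"
  show ?case
  proof (cases "\<exists>j\<in>{1..d} - S. card {l \<in> L. j \<in> B l} = 2")
    case False
    then have one: "card {l \<in> L. j \<in> B l} = 1" if "j \<in> {1..d} - S" for j
      using cover[OF that] that by auto
    show ?thesis by (rule disjoint_blocks_bound[OF N p d L S B one empty x])
  next
    case True
    then obtain j where j: "j \<in> {1..d} - S" "card {l \<in> L. j \<in> B l} = 2" by blast
    then obtain l1 l2 where l12: "{l \<in> L. j \<in> B l} = {l1, l2}" "l1 \<noteq> l2" by (auto simp: card_2_iff)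
    have jB: "j \<in> B l \<longleftrightarrow> l = l1 \<or> l = l2" if "l \<in> L" for l using l12 that by blast
    have l1: "l1 \<in> L" "j \<in> B l1" and l2: "l2 \<in> L" "j \<in> B l2" using l12 by blast+
    define B' where "B' l = B l - {j}" for l
    define u where "u l m' = sqrt (\<Sum>k\<in>multi_idx n (B' l). (x l (k(j := m')))\<^sup>2)" for l m'
    \<comment> \<open>If the slice vanishes, so does \<open>u l m'\<close>, and division by zero
      makes the rescaled slice zero, which is consistent with the bound and with the identity
      \<open>slice\<close>.\<close>
    define x' where "x' m' l k = (if j \<in> B l then sqrt p / u l m' * x l (k(j := m')) else x l k)" for m' l k
    define W where "W m' = (\<Sum>i\<in>multi_idx n {1..d}. a i *
        (if \<forall>j'\<in>insert j S. i j' = (m(j := m')) j' then 1 else 0) * (\<Prod>l\<in>L. x' m' l (restrict i (B' l))))" for m'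
    have finB: "finite (B l)" if "l \<in> L" for l using B[OF that] finite_subset by blast
    have u2: "(u l m')\<^sup>2 = (\<Sum>k\<in>multi_idx n (B' l). (x l (k(j := m')))\<^sup>2)" for l m'
      by (simp add: u_def sum_nonneg)
    have "\<bar>W m'\<bar> \<le> ?R" for m'
      unfolding W_def
    proof (rule less.hyps[where S = "insert j S" and B = B' and x = "x' m'" and m = "m(j := m')"])
      show "card ({1..d} - insert j S) < card ({1..d} - S)"
        unfolding Diff_insert[of _ j S] using j(1) by (intro card_Diff1_less) auto
      show "insert j S \<subseteq> {1..d}" using S j by auto
      show "B' l \<subseteq> {1..d} - insert j S" if "l \<in> L" for l using B[OF that] by (auto simp: B'_def)
      show "card {l \<in> L. j' \<in> B' l} \<in> {1, 2}" if "j' \<in> {1..d} - insert j S" for j'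
        using that cover[of j'] by (simp add: B'_def)
      \<comment> \<open>Removing \<open>j\<close> can empty only the two blocks that contain it,
        which is the budget of two scalars granted by the new fixed coordinate.\<close>
      have "card {l \<in> L. B' l = {}} \<le> card ({l \<in> L. B l = {}} \<union> {l1, l2})"
        using L jB by (intro card_mono) (auto simp: B'_def)
      also have "\<dots> \<le> card {l \<in> L. B l = {}} + card {l1, l2}" by (rule card_Un_le)
      also have "\<dots> \<le> 2 * card S + 2" using empty l12(2) by simp
      also have "\<dots> = 2 * card (insert j S)"
        using j S finite_subset[OF S] by simp
      finally show "card {l \<in> L. B' l = {}} \<le> 2 * card (insert j S)" .
      show "(\<Sum>k\<in>multi_idx n (B' l). (x' m' l k)\<^sup>2) \<le> p" if "l \<in> L" for l
      proof (cases "j \<in> B l")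
        case True
        then have "(\<Sum>k\<in>multi_idx n (B' l). (x' m' l k)\<^sup>2) = p / (u l m')\<^sup>2 * (u l m')\<^sup>2"
          using p unfolding u2[of l m'] sum_distrib_left
          by (intro sum.cong) (auto simp: x'_def power_mult_distrib power_divide u2)
        also have "\<dots> \<le> p" using p by simp
        finally show ?thesis .
      next
        case False
        then show ?thesis using x[OF that] by (simp add: x'_def B'_def)
      qed
    qed
    note W = this
    have slice: "u l m' * x' m' l (restrict i (B' l)) = sqrt p * x l (restrict i (B l))"
      if l: "l \<in> L" "j \<in> B l" and i: "i \<in> multi_idx n {1..d}" "i j = m'" for l m' i
    proof -
      have r: "(restrict i (B' l))(j := m') = restrict i (B l)"
        using l i by (auto simp: B'_def fun_eq_iff)
      have mem: "restrict i (B' l) \<in> multi_idx n (B' l)"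
        using i(1) B[OF l(1)] by (intro restrict_multi_idx[OF i(1)]) (auto simp: B'_def)
      show ?thesis
      proof (cases "u l m' = 0")
        case True
        then have "(\<Sum>k\<in>multi_idx n (B' l). (x l (k(j := m')))\<^sup>2) = 0" using u2[of l m'] by simp
        then have "(x l ((restrict i (B' l))(j := m')))\<^sup>2 = 0"
          using mem finB[OF l(1)] by (subst (asm) sum_nonneg_eq_0_iff) (auto simp: B'_def)
        then show ?thesis using True r by simp
      qed (use l r in \<open>simp add: x'_def\<close>)
    qed
    have Ls: "(\<Prod>l\<in>L. f l) = f l1 * f l2 * (\<Prod>l\<in>L - {l1} - {l2}. f l)" for f :: "'l \<Rightarrow> real"
      using L l1 l2 l12(2) by (simp add: prod.remove[of L l1] prod.remove[of "L - {l1}" l2])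
    have prod_slice: "p * (\<Prod>l\<in>L. x l (restrict i (B l)))
        = u l1 m' * u l2 m' * (\<Prod>l\<in>L. x' m' l (restrict i (B' l)))"
      if i: "i \<in> multi_idx n {1..d}" "i j = m'" for i m'
    proof -
      have "(\<Prod>l\<in>L - {l1} - {l2}. x l (restrict i (B l))) = (\<Prod>l\<in>L - {l1} - {l2}. x' m' l (restrict i (B' l)))"
        using jB by (intro prod.cong) (auto simp: x'_def B'_def)
      moreover have "p * (x l1 (restrict i (B l1)) * x l2 (restrict i (B l2)))
          = (u l1 m' * x' m' l1 (restrict i (B' l1))) * (u l2 m' * x' m' l2 (restrict i (B' l2)))"
      proof -
        have "(sqrt p * A) * (sqrt p * B) = p * (A * B)" for A B
          using p by (simp add: mult.left_commute[of A] flip: mult.assoc)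
        then show ?thesis unfolding slice[OF l1 i] slice[OF l2 i] using p by simp
      qed
      ultimately have "p * (x l1 (restrict i (B l1)) * x l2 (restrict i (B l2)))
            * (\<Prod>l\<in>L - {l1} - {l2}. x l (restrict i (B l)))
          = (u l1 m' * x' m' l1 (restrict i (B' l1))) * (u l2 m' * x' m' l2 (restrict i (B' l2)))
            * (\<Prod>l\<in>L - {l1} - {l2}. x' m' l (restrict i (B' l)))"
        by (simp only:)
      then show ?thesis unfolding Ls by (simp only: mult_ac)
    qed
    \<comment> \<open>The terms are sorted by the value of coordinate \<open>j\<close>. Undoing the
      rescaling of two slices costs \<open>sqrt p\<close> twice, which is the factor
      \<open>p\<close> on the left.\<close>
    have E: "p * (\<Sum>i\<in>multi_idx n {1..d}. a i * (if \<forall>j\<in>S. i j = m j then 1 else 0) * (\<Prod>l\<in>L. x l (restrict i (B l))))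
        = (\<Sum>m'=1..n. u l1 m' * u l2 m' * W m')" (is "p * ?V = _")
    proof -
      define f where "f i = a i * (if \<forall>j\<in>S. i j = m j then 1 else 0) * (p * (\<Prod>l\<in>L. x l (restrict i (B l))))" for i
      have "p * ?V = (\<Sum>i\<in>multi_idx n {1..d}. f i)"
        unfolding f_def sum_distrib_left by (simp add: mult_ac)
      also have "\<dots> = (\<Sum>m'=1..n. \<Sum>i\<in>{i \<in> multi_idx n {1..d}. i j = m'}. f i)"
        using j(1) by (intro sum.group[symmetric]) (auto simp: multi_idx_def intro!: finite_PiE)
      also have "\<dots> = (\<Sum>m'=1..n. u l1 m' * u l2 m' * W m')"
      proof (rule sum.cong[OF refl])
        fix m'
        have "u l1 m' * u l2 m' * W m' = (\<Sum>i\<in>multi_idx n {1..d}. if i j = m' then f i else 0)"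
          unfolding W_def sum_distrib_left
        proof (rule sum.cong[OF refl])
          fix i assume i: "i \<in> multi_idx n {1..d}"
          have c: "(\<forall>j'\<in>insert j S. i j' = (m(j := m')) j') \<longleftrightarrow> i j = m' \<and> (\<forall>j\<in>S. i j = m j)"
            using j(1) by auto
          show "u l1 m' * u l2 m' * (a i * (if \<forall>j'\<in>insert j S. i j' = (m(j := m')) j' then 1 else 0) *
              (\<Prod>l\<in>L. x' m' l (restrict i (B' l)))) = (if i j = m' then f i else 0)"
            unfolding c f_def using prod_slice[OF i] by (auto simp: mult_ac)
        qed
        then show "(\<Sum>i\<in>{i \<in> multi_idx n {1..d}. i j = m'}. f i) = u l1 m' * u l2 m' * W m'"
          by (simp add: sum.inter_filter)
      qed
      finally show ?thesis .
    qed
    have usum: "(\<Sum>m'=1..n. (u l m')\<^sup>2) \<le> p" if "l \<in> L" "j \<in> B l" for l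
      using x[OF that(1)] unfolding u2 B'_def
      by (subst (asm) sum_multi_idx_split[OF that(2)])
    have abs_p: "p * \<bar>v\<bar> = \<bar>p * v\<bar>" for v using p by (simp add: abs_mult)
    have "p * \<bar>?V\<bar> = \<bar>\<Sum>m'=1..n. u l1 m' * u l2 m' * W m'\<bar>"
      by (simp only: abs_p E)
    also have "\<dots> \<le> (\<Sum>m'=1..n. u l1 m' * u l2 m' * ?R)"
    proof (rule order_trans[OF sum_abs sum_mono])
      fix m'
      have nn: "0 \<le> u l1 m' * u l2 m'" by (simp add: u_def sum_nonneg)
      then have "\<bar>u l1 m' * u l2 m' * W m'\<bar> = u l1 m' * u l2 m' * \<bar>W m'\<bar>"
        by (simp only: abs_mult[of "u l1 m' * u l2 m'"] abs_of_nonneg)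
      also have "\<dots> \<le> u l1 m' * u l2 m' * ?R"
        using nn W by (intro mult_left_mono)
      finally show "\<bar>u l1 m' * u l2 m' * W m'\<bar> \<le> u l1 m' * u l2 m' * ?R" .
    qed
    also have "\<dots> = (\<Sum>m'=1..n. u l1 m' * u l2 m') * ?R" by (rule sum_distrib_right[symmetric])
    also have "\<dots> \<le> p * ?R"
    proof (rule mult_right_mono)
      have "(\<Sum>m'=1..n. u l1 m' * u l2 m') \<le> (\<Sum>m'=1..n. ((u l1 m')\<^sup>2 + (u l2 m')\<^sup>2) / 2)"
      proof (rule sum_mono)
        fix m'
        show "u l1 m' * u l2 m' \<le> ((u l1 m')\<^sup>2 + (u l2 m')\<^sup>2) / 2"
          using sum_squares_bound[of "u l1 m'" "u l2 m'"] by simp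
      qed
      also have "\<dots> = ((\<Sum>m'=1..n. (u l1 m')\<^sup>2) + (\<Sum>m'=1..n. (u l2 m')\<^sup>2)) / 2"
        by (simp add: sum.distrib flip: sum_divide_distrib)
      also have "\<dots> \<le> (p + p) / 2"
        using usum[OF l1] usum[OF l2] by simp
      finally show "(\<Sum>m'=1..n. u l1 m' * u l2 m') \<le> p" by simp
      show "0 \<le> ?R" using W[of undefined] by linarith
    qed
    finally show ?thesis using p by (simp only: mult_le_cancel_left)
  qed
qed

section \<open>Gaussian smoothing\<close>

lemma density_PiM:
  fixes M :: "'c \<Rightarrow> 'b measure"
  assumes A: "finite A" and M: "\<And>i. prob_space (M i)"
    and D: "\<And>i. prob_space (density (M i) (f i))" and f[measurable]: "\<And>i. f i \<in> borel_measurable (M i)"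
  shows "density (PiM A M) (\<lambda>y. \<Prod>i\<in>A. f i (y i)) = PiM A (\<lambda>i. density (M i) (f i))"
proof -
  interpret P: product_sigma_finite M
    using M by (simp add: product_sigma_finite_def prob_space_imp_sigma_finite)
  interpret D: product_sigma_finite "\<lambda>i. density (M i) (f i)"
    using D by (simp add: product_sigma_finite_def prob_space_imp_sigma_finite)
  show ?thesis
  proof (rule D.PiM_eqI[OF A])
    show "sets (density (PiM A M) (\<lambda>y. \<Prod>i\<in>A. f i (y i))) = sets (PiM A (\<lambda>i. density (M i) (f i)))"
      by (simp cong: sets_PiM_cong)
    fix B assume "\<And>i. i \<in> A \<Longrightarrow> B i \<in> sets (density (M i) (f i))"
    then have B[measurable]: "\<And>i. i \<in> A \<Longrightarrow> B i \<in> sets (M i)" by simp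
    have "emeasure (density (PiM A M) (\<lambda>y. \<Prod>i\<in>A. f i (y i))) (Pi\<^sub>E A B)
        = (\<integral>\<^sup>+y. (\<Prod>i\<in>A. f i (y i)) * indicator (Pi\<^sub>E A B) y \<partial>PiM A M)"
      using A by (intro emeasure_density) (auto intro!: sets_PiM_I_finite)
    also have "\<dots> = (\<integral>\<^sup>+y. (\<Prod>i\<in>A. f i (y i) * indicator (B i) (y i)) \<partial>PiM A M)"
    proof (rule nn_integral_cong)
      fix y assume "y \<in> space (PiM A M)"
      then have "indicator (Pi\<^sub>E A B) y = (\<Prod>i\<in>A. indicator (B i) (y i) :: ennreal)"
        using A by (auto simp: indicator_def space_PiM PiE_def Pi_def prod_zero_iff)
      then show "(\<Prod>i\<in>A. f i (y i)) * indicator (Pi\<^sub>E A B) y = (\<Prod>i\<in>A. f i (y i) * indicator (B i) (y i))"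
        by (simp add: prod.distrib)
    qed
    also have "\<dots> = (\<Prod>i\<in>A. \<integral>\<^sup>+y. f i y * indicator (B i) y \<partial>M i)"
      using A by (intro P.product_nn_integral_prod) auto
    also have "\<dots> = (\<Prod>i\<in>A. emeasure (density (M i) (f i)) (B i))"
      by (intro prod.cong) (auto simp: emeasure_density)
    finally show "emeasure (density (PiM A M) (\<lambda>y. \<Prod>i\<in>A. f i (y i))) (Pi\<^sub>E A B)
        = (\<Prod>i\<in>A. emeasure (density (M i) (f i)) (B i))" .
  qed
qed

text \<open>Jensen's inequality from the tangent of the exponential at the mean. The nonnegative
  integral on the right may be infinite, so integrability of the exponential is not
  presupposed.\<close>

lemma (in prob_space) exp_expectation_le_nn_integral:
  assumes u: "integrable M u"
  shows "ennreal (exp (expectation u)) \<le> (\<integral>\<^sup>+x. ennreal (exp (u x)) \<partial>M)"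
proof (cases "(\<integral>\<^sup>+x. ennreal (exp (u x)) \<partial>M) = \<infinity>")
  case False
  have [measurable]: "u \<in> borel_measurable M" using u by auto
  let ?c = "expectation u"
  have e: "integrable M (\<lambda>x. exp (u x))"
    using False by (intro integrableI_nonneg) (auto simp: less_top)
  have "exp ?c = expectation (\<lambda>x. exp ?c * (1 + (u x - ?c)))"
    using u by (simp add: prob_space)
  also have "\<dots> \<le> expectation (\<lambda>x. exp (u x))"
  proof (rule integral_mono)
    show "integrable M (\<lambda>x. exp ?c * (1 + (u x - ?c)))" using u by simp
    fix x
    have "exp ?c * (1 + (u x - ?c)) \<le> exp ?c * exp (u x - ?c)"
      by (intro mult_left_mono exp_ge_add_one_self) auto
    then show "exp ?c * (1 + (u x - ?c)) \<le> exp (u x)" by (simp add: mult_exp_exp)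
  qed fact
  finally show ?thesis using e by (simp add: nn_integral_eq_integral ennreal_leI)
qed simp

abbreviation unit_normal :: "real \<Rightarrow> real measure" where
  "unit_normal \<mu> \<equiv> density lborel (\<lambda>x. ennreal (normal_density \<mu> 1 x))"

text \<open>The index set will consist of pairs of a label and a multi-index, so that one measure
  carries independent noise for all entries of all arrays.\<close>

definition gaussian :: "'c set \<Rightarrow> ('c \<Rightarrow> real) \<Rightarrow> ('c \<Rightarrow> real) measure" where
  "gaussian A x = PiM A (\<lambda>c. unit_normal (x c))"

lemma sets_gaussian [measurable_cong, simp]: "sets (gaussian A x) = sets (PiM A (\<lambda>_. borel))"
  unfolding gaussian_def by (intro sets_PiM_cong) auto

lemma prob_space_unit_normal: "prob_space (unit_normal \<mu>)"
  by (rule prob_space_normal_density) simp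

lemma prob_space_gaussian: "prob_space (gaussian A x)"
  unfolding gaussian_def by (intro prob_space_PiM prob_space_unit_normal)

lemma unit_normal_moments:
  "integrable (unit_normal \<mu>) (\<lambda>y. y)" "(\<integral>y. y \<partial>unit_normal \<mu>) = \<mu>"
  "integrable (unit_normal \<mu>) (\<lambda>y. y * y)" "(\<integral>y. y * y \<partial>unit_normal \<mu>) = \<mu> * \<mu> + 1"
proof -
  interpret prob_space "unit_normal \<mu>" by (rule prob_space_unit_normal)
  have one: "prob UNIV = 1" using prob_space by simp
  show i1: "integrable (unit_normal \<mu>) (\<lambda>y. y)"
    by (subst integrable_density) (auto intro: integrable_normal_moment_nz_1)
  show e1: "(\<integral>y. y \<partial>unit_normal \<mu>) = \<mu>"
    by (subst integral_density) (auto simp: integral_normal_moment_nz_1)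
  have i2: "integrable (unit_normal \<mu>) (\<lambda>y. (y - \<mu>)\<^sup>2)"
    by (subst integrable_density) (auto intro: integrable_normal_moment)
  have e2: "(\<integral>y. (y - \<mu>)\<^sup>2 \<partial>unit_normal \<mu>) = 1"
    using integral_normal_moment_even[of 1 \<mu> 1] by (subst integral_density) auto
  have eq: "(\<lambda>y. y * y) = (\<lambda>y. (y - \<mu>)\<^sup>2 + 2 * \<mu> * y - \<mu> * \<mu>)"
    by (simp add: power2_eq_square algebra_simps)
  show "integrable (unit_normal \<mu>) (\<lambda>y. y * y)" unfolding eq using i1 i2 by simp
  show "(\<integral>y. y * y \<partial>unit_normal \<mu>) = \<mu> * \<mu> + 1"
    unfolding eq using i1 i2 by (simp add: e1 e2 one)
qed

text \<open>The Cameron-Martin formula, obtained by completing the square in each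
  coordinate.\<close>

lemma gaussian_shift:
  assumes "finite A"
  shows "gaussian A x = density (gaussian A (\<lambda>_. 0)) (\<lambda>y. ennreal (exp (\<Sum>c\<in>A. x c * y c - (x c)\<^sup>2 / 2)))"
proof -
  have shift: "unit_normal m = density (unit_normal 0) (\<lambda>y. ennreal (exp (m * y - m\<^sup>2 / 2)))" for m
  proof -
    have "normal_density 0 1 y * exp (m * y - m\<^sup>2 / 2) = normal_density m 1 y" for y
      by (simp add: normal_density_def mult_exp_exp power2_eq_square field_simps)
    then show ?thesis
      by (subst density_density_eq) (auto simp flip: ennreal_mult' intro!: density_cong)
  qed
  have "gaussian A x = PiM A (\<lambda>c. density (unit_normal 0) (\<lambda>y. ennreal (exp (x c * y - (x c)\<^sup>2 / 2))))"
    unfolding gaussian_def by (subst shift) simp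
  also have "\<dots> = density (gaussian A (\<lambda>_. 0)) (\<lambda>y. \<Prod>c\<in>A. ennreal (exp (x c * y c - (x c)\<^sup>2 / 2)))"
    unfolding gaussian_def using assms
    by (subst density_PiM) (auto simp flip: shift intro: prob_space_unit_normal)
  finally show ?thesis using assms by (simp add: prod_ennreal exp_sum)
qed

text \<open>Jensen's inequality under the shifted law, applied to \<open>h - w\<close> with
  \<open>w\<close> the logarithm of the density. The mean of \<open>w\<close> is the relative
  entropy.\<close>

lemma gaussian_change_of_measure:
  assumes A: "finite A" and h: "integrable (gaussian A x) h"
  shows "ennreal (exp ((\<integral>y. h y \<partial>gaussian A x) - (\<Sum>c\<in>A. (x c)\<^sup>2) / 2))
     \<le> (\<integral>\<^sup>+y. ennreal (exp (h y)) \<partial>gaussian A (\<lambda>_. 0))"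
proof -
  interpret prob_space "gaussian A x" by (rule prob_space_gaussian)
  have hm[measurable]: "h \<in> borel_measurable (PiM A (\<lambda>_. borel))"
    using borel_measurable_integrable[OF h] by (simp cong: measurable_cong_sets)
  define w where "w y = (\<Sum>c\<in>A. x c * y c - (x c)\<^sup>2 / 2)" for y :: "'a \<Rightarrow> real"
  have [measurable]: "w \<in> borel_measurable (PiM A (\<lambda>_. borel))" unfolding w_def by measurable
  have comp: "integrable (gaussian A x) (\<lambda>y. y c) \<and> (\<integral>y. y c \<partial>gaussian A x) = x c" if c: "c \<in> A" for c
  proof -
    have d: "distr (gaussian A x) (unit_normal (x c)) (\<lambda>y. y c) = unit_normal (x c)"
      unfolding gaussian_def
      by (rule distr_PiM_component[OF prob_space_unit_normal c])
    have m: "(\<lambda>y. y c) \<in> measurable (gaussian A x) (unit_normal (x c))"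
      using c by measurable
    have "(\<integral>y. y c \<partial>gaussian A x) = (\<integral>u. u \<partial>distr (gaussian A x) (unit_normal (x c)) (\<lambda>y. y c))"
      by (rule integral_distr[symmetric, OF m]) simp
    moreover have "integrable (gaussian A x) (\<lambda>y. y c)"
      by (rule integrable_distr[OF m, of "\<lambda>u. u"]) (unfold d, rule unit_normal_moments(1))
    ultimately show ?thesis unfolding d unit_normal_moments(2) by blast
  qed
  have iw: "integrable (gaussian A x) w" unfolding w_def using comp by auto
  have "expectation w = (\<Sum>c\<in>A. x c * x c - (x c)\<^sup>2 / 2)"
    unfolding w_def using comp by (simp add: prob_space)
  also have "\<dots> = (\<Sum>c\<in>A. (x c)\<^sup>2) / 2"
    unfolding sum_divide_distrib by (intro sum.cong) (auto simp: power2_eq_square)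
  finally have ew: "expectation w = (\<Sum>c\<in>A. (x c)\<^sup>2) / 2" .
  have "ennreal (exp (expectation h - (\<Sum>c\<in>A. (x c)\<^sup>2) / 2)) = ennreal (exp (expectation (\<lambda>y. h y - w y)))"
    using h iw ew by simp
  also have "\<dots> \<le> (\<integral>\<^sup>+y. ennreal (exp (h y - w y)) \<partial>gaussian A x)"
    using h iw by (intro exp_expectation_le_nn_integral) simp
  also have "\<dots> = (\<integral>\<^sup>+y. ennreal (exp (w y)) * ennreal (exp (h y - w y)) \<partial>gaussian A (\<lambda>_. 0))"
    unfolding gaussian_shift[OF A, of x] w_def[symmetric] by (subst nn_integral_density) auto
  also have "\<dots> = (\<integral>\<^sup>+y. ennreal (exp (h y)) \<partial>gaussian A (\<lambda>_. 0))"
    by (simp add: mult_exp_exp flip: ennreal_mult)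
  finally show ?thesis .
qed

text \<open>Different labels use different coordinates, hence independent ones, and the moments
  factor over labels. When the two entries of a label coincide, the variance adds 1 to the product
  of the means.\<close>

lemma gaussian_multilinear_moments:
  fixes K :: "'l \<Rightarrow> 'k set" and x :: "'l \<times> 'k \<Rightarrow> real"
  assumes L: "finite L" and K: "\<And>l. l \<in> L \<Longrightarrow> finite (K l)"
    and k: "\<And>l. l \<in> L \<Longrightarrow> k l \<in> K l" and k': "\<And>l. l \<in> L \<Longrightarrow> k' l \<in> K l"
  defines "M \<equiv> gaussian (Sigma L K) x"
  shows "integrable M (\<lambda>y. \<Prod>l\<in>L. y (l, k l))"
    and "(\<integral>y. (\<Prod>l\<in>L. y (l, k l)) \<partial>M) = (\<Prod>l\<in>L. x (l, k l))"
    and "integrable M (\<lambda>y. (\<Prod>l\<in>L. y (l, k l)) * (\<Prod>l\<in>L. y (l, k' l)))"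
    and "(\<integral>y. (\<Prod>l\<in>L. y (l, k l)) * (\<Prod>l\<in>L. y (l, k' l)) \<partial>M)
      = (\<Prod>l\<in>L. x (l, k l) * x (l, k' l) + (if k l = k' l then 1 else 0))"
proof -
  interpret P: product_sigma_finite "\<lambda>c. unit_normal (x c)"
    by (simp add: product_sigma_finite_def prob_space_imp_sigma_finite prob_space_unit_normal)
  have A: "finite (Sigma L K)" using L K by auto
  note moments = unit_normal_moments finite_measure.integrable_const[OF prob_space.finite_measure[OF prob_space_unit_normal]]
    prob_space.prob_space[OF prob_space_unit_normal, simplified]
  \<comment> \<open>Selected coordinates contribute themselves and all others contribute 1, which
    turns a product over labels into a product over all coordinates, to which the product formula
    for integrals applies.\<close>
  define f where "f c u = (if snd c = k (fst c) then u else (1::real))" for c :: "'l \<times> 'k" and u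
  define g where "g c u = f c u * (if snd c = k' (fst c) then u else 1)" for c u
  have pf: "(\<Prod>c\<in>Sigma L K. f c (y c)) = (\<Prod>l\<in>L. y (l, k l))" for y
  proof -
    have "(\<Prod>c\<in>Sigma L K. f c (y c)) = (\<Prod>l\<in>L. \<Prod>m\<in>K l. if m = k l then y (l, m) else 1)"
      using L K by (subst prod.Sigma) (auto simp: f_def intro!: prod.cong)
    also have "\<dots> = (\<Prod>l\<in>L. y (l, k l))"
      using K k by (intro prod.cong) (auto simp: prod.delta)
    finally show ?thesis .
  qed
  have pg: "(\<Prod>c\<in>Sigma L K. g c (y c)) = (\<Prod>l\<in>L. y (l, k l)) * (\<Prod>l\<in>L. y (l, k' l))" for y
  proof -
    have "(\<Prod>c\<in>Sigma L K. if snd c = k' (fst c) then y c else 1)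
        = (\<Prod>l\<in>L. \<Prod>m\<in>K l. if m = k' l then y (l, m) else 1)"
      using L K by (subst prod.Sigma) (auto intro!: prod.cong)
    also have "\<dots> = (\<Prod>l\<in>L. y (l, k' l))"
      using K k' by (intro prod.cong) (auto simp: prod.delta)
    finally show ?thesis by (simp add: g_def prod.distrib pf)
  qed
  have fi: "integrable (unit_normal (x c)) (f c)" and fe: "(\<integral>u. f c u \<partial>unit_normal (x c)) = f c (x c)" for c
    by (cases "snd c = k (fst c)"; simp add: f_def[abs_def] moments)+
  have gi: "integrable (unit_normal (x c)) (g c)"
    and ge: "(\<integral>u. g c u \<partial>unit_normal (x c)) = g c (x c) + (if snd c = k (fst c) \<and> snd c = k' (fst c) then 1 else 0)" for c
    by (cases "snd c = k (fst c)"; cases "snd c = k' (fst c)"; simp add: g_def[abs_def] f_def[abs_def] moments)+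
  show "integrable M (\<lambda>y. \<Prod>l\<in>L. y (l, k l))"
    unfolding M_def gaussian_def pf[symmetric] using A fi by (rule P.product_integrable_prod)
  show "(\<integral>y. (\<Prod>l\<in>L. y (l, k l)) \<partial>M) = (\<Prod>l\<in>L. x (l, k l))"
    unfolding M_def gaussian_def pf[symmetric] P.product_integral_prod[OF A fi] fe ..
  show "integrable M (\<lambda>y. (\<Prod>l\<in>L. y (l, k l)) * (\<Prod>l\<in>L. y (l, k' l)))"
    unfolding M_def gaussian_def pg[symmetric] using A gi by (rule P.product_integrable_prod)
  have "(\<integral>y. (\<Prod>l\<in>L. y (l, k l)) * (\<Prod>l\<in>L. y (l, k' l)) \<partial>M)
      = (\<Prod>c\<in>Sigma L K. g c (x c) + (if snd c = k (fst c) \<and> snd c = k' (fst c) then 1 else 0))"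
    unfolding M_def gaussian_def pg[symmetric] P.product_integral_prod[OF A gi] ge ..
  also have "\<dots> = (\<Prod>l\<in>L. \<Prod>m\<in>K l. (if m = k l then x (l, m) else 1) * (if m = k' l then x (l, m) else 1)
      + (if m = k l \<and> m = k' l then 1 else 0))"
    using L K by (subst prod.Sigma) (auto simp: f_def g_def intro!: prod.cong)
  also have "\<dots> = (\<Prod>l\<in>L. x (l, k l) * x (l, k' l) + (if k l = k' l then 1 else 0))"
  proof (rule prod.cong[OF refl])
    fix l assume l: "l \<in> L"
    show "(\<Prod>m\<in>K l. (if m = k l then x (l, m) else 1) * (if m = k' l then x (l, m) else 1)
        + (if m = k l \<and> m = k' l then 1 else 0)) = x (l, k l) * x (l, k' l) + (if k l = k' l then 1 else 0)"
    proof (cases "k l = k' l")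
      case True
      then have "(\<Prod>m\<in>K l. (if m = k l then x (l, m) else 1) * (if m = k' l then x (l, m) else 1)
          + (if m = k l \<and> m = k' l then 1 else 0)) = (\<Prod>m\<in>K l. if m = k l then x (l, m) * x (l, m) + 1 else 1)"
        by (intro prod.cong) auto
      then show ?thesis using True K[OF l] k[OF l] by (simp add: prod.delta)
    next
      case False
      then have "(\<Prod>m\<in>K l. (if m = k l then x (l, m) else 1) * (if m = k' l then x (l, m) else 1)
          + (if m = k l \<and> m = k' l then 1 else 0))
          = (\<Prod>m\<in>K l. (if m = k l then x (l, m) else 1) * (if m = k' l then x (l, m) else 1))"
        by (intro prod.cong) auto
      then show ?thesis using False K[OF l] k[OF l] k'[OF l] by (simp add: prod.distrib prod.delta)
    qed
  qed
  finally show "(\<integral>y. (\<Prod>l\<in>L. y (l, k l)) * (\<Prod>l\<in>L. y (l, k' l)) \<partial>M)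
      = (\<Prod>l\<in>L. x (l, k l) * x (l, k' l) + (if k l = k' l then 1 else 0))" .
qed

text \<open>The Gaussian mean of a squared fibre sum is computed pair by pair; read backwards, the
  identity collects the pairs again on the finer fibres of \<open>key S\<close>.\<close>

lemma sum_fiber_power2:
  fixes w :: "'i \<Rightarrow> real"
  assumes "finite A" "finite T" "f ` A \<subseteq> T"
  shows "(\<Sum>k\<in>T. (\<Sum>i\<in>{i\<in>A. f i = k}. w i)\<^sup>2)
    = (\<Sum>i\<in>A. \<Sum>i'\<in>A. if f i = f i' then w i * w i' else 0)"
proof -
  have "(\<Sum>k\<in>T. (\<Sum>i\<in>{i\<in>A. f i = k}. w i)\<^sup>2)
      = (\<Sum>k\<in>T. \<Sum>i\<in>A. \<Sum>i'\<in>A. if k = f i then (if f i = f i' then w i * w i' else 0) else 0)"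
  proof (rule sum.cong[OF refl])
    fix k
    have "(\<Sum>i\<in>{i\<in>A. f i = k}. w i)\<^sup>2 = (\<Sum>i\<in>A. \<Sum>i'\<in>A. (if f i = k then w i else 0) * (if f i' = k then w i' else 0))"
      using assms(1) by (simp add: power2_eq_square sum_product sum.inter_filter)
    also have "\<dots> = (\<Sum>i\<in>A. \<Sum>i'\<in>A. if k = f i then (if f i = f i' then w i * w i' else 0) else 0)"
      by (intro sum.cong) auto
    finally show "(\<Sum>i\<in>{i\<in>A. f i = k}. w i)\<^sup>2
      = (\<Sum>i\<in>A. \<Sum>i'\<in>A. if k = f i then (if f i = f i' then w i * w i' else 0) else 0)" .
  qed
  also have "\<dots> = (\<Sum>i\<in>A. \<Sum>i'\<in>A. \<Sum>k\<in>T. if k = f i then (if f i = f i' then w i * w i' else 0) else 0)"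
    by (subst sum.swap, rule sum.cong[OF refl], rule sum.swap)
  also have "\<dots> = (\<Sum>i\<in>A. \<Sum>i'\<in>A. if f i = f i' then w i * w i' else 0)"
    using assms by (intro sum.cong) (auto simp: sum.delta)
  finally show ?thesis .
qed

text \<open>Donsker-Varadhan duality: a Gaussian vector centred at \<open>x\<close> has relative entropy \<open>\<bar>x\<bar>\<^sup>2 / 2\<close> with
  respect to the centred one, the multilinear form has mean equal to its value at \<open>x\<close>, and in the
  mean of the quadratic term every array may be replaced by independent noise, which merges its
  block with the one of the fibre map \<open>g\<close>.\<close>

lemma gaussian_pac_bayes:
  fixes A :: "'i set" and L :: "'l set" and K :: "'l \<Rightarrow> 'k set" and k :: "'l \<Rightarrow> 'i \<Rightarrow> 'k"
    and g :: "'i \<Rightarrow> 'm" and key :: "'l set \<Rightarrow> 'i \<Rightarrow> 'n" and b w :: "'i \<Rightarrow> real"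
  assumes A: "finite A" and L: "finite L" and K: "\<And>l. l \<in> L \<Longrightarrow> finite (K l)"
    and k: "\<And>l i. l \<in> L \<Longrightarrow> i \<in> A \<Longrightarrow> k l i \<in> K l"
    and T: "finite T" "g ` A \<subseteq> T"
    and U: "\<And>S. S \<subseteq> L \<Longrightarrow> finite (U S)" "\<And>S. S \<subseteq> L \<Longrightarrow> key S ` A \<subseteq> U S"
    and key: "\<And>S i i'. S \<subseteq> L \<Longrightarrow> i \<in> A \<Longrightarrow> i' \<in> A \<Longrightarrow>
        key S i = key S i' \<longleftrightarrow> g i = g i' \<and> (\<forall>l\<in>L - S. k l i = k l i')"
  shows "ennreal (exp (\<theta> * (\<Sum>i\<in>A. b i * (\<Prod>l\<in>L. x (l, k l i)))
        - \<theta>\<^sup>2 * (\<Sum>S\<in>Pow L. \<Sum>m\<in>U S. (\<Sum>i\<in>{i\<in>A. key S i = m}. w i * (\<Prod>l\<in>S. x (l, k l i)))\<^sup>2)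
        - (\<Sum>c\<in>Sigma L K. (x c)\<^sup>2) / 2))
    \<le> (\<integral>\<^sup>+y. ennreal (exp (\<theta> * (\<Sum>i\<in>A. b i * (\<Prod>l\<in>L. y (l, k l i)))
        - \<theta>\<^sup>2 * (\<Sum>m\<in>T. (\<Sum>i\<in>{i\<in>A. g i = m}. w i * (\<Prod>l\<in>L. y (l, k l i)))\<^sup>2))) \<partial>gaussian (Sigma L K) (\<lambda>_. 0))"
proof -
  let ?G = "gaussian (Sigma L K) x"
  define F where "F y = (\<Sum>i\<in>A. b i * (\<Prod>l\<in>L. y (l, k l i)))" for y :: "'l \<times> 'k \<Rightarrow> real"
  define V where "V y = (\<Sum>m\<in>T. (\<Sum>i\<in>{i\<in>A. g i = m}. w i * (\<Prod>l\<in>L. y (l, k l i)))\<^sup>2)" for y :: "'l \<times> 'k \<Rightarrow> real"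
  define Q where "Q = (\<Sum>S\<in>Pow L. \<Sum>m\<in>U S. (\<Sum>i\<in>{i\<in>A. key S i = m}. w i * (\<Prod>l\<in>S. x (l, k l i)))\<^sup>2)"
  note mom = gaussian_multilinear_moments[of L K, OF L K]
  have m1: "integrable ?G (\<lambda>y. \<Prod>l\<in>L. y (l, k l i))"
      "(\<integral>y. (\<Prod>l\<in>L. y (l, k l i)) \<partial>?G) = (\<Prod>l\<in>L. x (l, k l i))" if "i \<in> A" for i
    using mom(1,2)[of "\<lambda>l. k l i" "\<lambda>l. k l i"] k[OF _ that] by auto
  have m2: "integrable ?G (\<lambda>y. (\<Prod>l\<in>L. y (l, k l i)) * (\<Prod>l\<in>L. y (l, k l i')))"
      "(\<integral>y. (\<Prod>l\<in>L. y (l, k l i)) * (\<Prod>l\<in>L. y (l, k l i')) \<partial>?G)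
        = (\<Prod>l\<in>L. x (l, k l i) * x (l, k l i') + (if k l i = k l i' then 1 else 0))"
    if "i \<in> A" "i' \<in> A" for i i'
    using mom(3,4)[of "\<lambda>l. k l i" "\<lambda>l. k l i'"] k[OF _ that(1)] k[OF _ that(2)] by auto
  have F: "integrable ?G F" "(\<integral>y. F y \<partial>?G) = F x"
    unfolding F_def using m1 by auto
  define pw where "pw i i' = (if g i = g i' then w i * w i' else 0)" for i i'
  have Veq: "V y = (\<Sum>i\<in>A. \<Sum>i'\<in>A. pw i i' * ((\<Prod>l\<in>L. y (l, k l i)) * (\<Prod>l\<in>L. y (l, k l i'))))" for y
    unfolding V_def sum_fiber_power2[OF A T] by (intro sum.cong) (auto simp: pw_def)
  have V: "integrable ?G V"
    unfolding Veq using m2 by auto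
  have "(\<integral>y. V y \<partial>?G)
      = (\<Sum>i\<in>A. \<Sum>i'\<in>A. pw i i' * (\<Prod>l\<in>L. x (l, k l i) * x (l, k l i') + (if k l i = k l i' then 1 else 0)))"
    unfolding Veq using m2 by simp
  also have "\<dots> = (\<Sum>i\<in>A. \<Sum>i'\<in>A. \<Sum>S\<in>Pow L. if key S i = key S i'
      then (w i * (\<Prod>l\<in>S. x (l, k l i))) * (w i' * (\<Prod>l\<in>S. x (l, k l i'))) else 0)"
  proof (intro sum.cong refl)
    fix i i' assume i: "i \<in> A" "i' \<in> A"
    \<comment> \<open>For labels in \<open>S\<close> the array is kept. For the others the noise
      survives only if both indices agree on the block, and this refines the fibres of
      \<open>g\<close> to those of \<open>key S\<close>.\<close>
    have "(\<Prod>l\<in>L. x (l, k l i) * x (l, k l i') + (if k l i = k l i' then 1 else 0))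
        = (\<Sum>S\<in>Pow L. (\<Prod>l\<in>S. x (l, k l i) * x (l, k l i')) * (\<Prod>l\<in>L - S. if k l i = k l i' then 1 else 0))"
      using L by (rule prod_add)
    also have "pw i i' * \<dots> = (\<Sum>S\<in>Pow L. if key S i = key S i'
      then (w i * (\<Prod>l\<in>S. x (l, k l i))) * (w i' * (\<Prod>l\<in>S. x (l, k l i'))) else 0)"
      unfolding sum_distrib_left
    proof (rule sum.cong[OF refl])
      fix S assume "S \<in> Pow L"
      then have S: "S \<subseteq> L" by simp
      have "(\<Prod>l\<in>L - S. if k l i = k l i' then 1 else 0 :: real) = (if \<forall>l\<in>L - S. k l i = k l i' then 1 else 0)"
        using L by auto
      then show "pw i i' * ((\<Prod>l\<in>S. x (l, k l i) * x (l, k l i')) * (\<Prod>l\<in>L - S. if k l i = k l i' then 1 else 0))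
          = (if key S i = key S i' then (w i * (\<Prod>l\<in>S. x (l, k l i))) * (w i' * (\<Prod>l\<in>S. x (l, k l i'))) else 0)"
        using key[OF S i] by (simp add: pw_def prod.distrib)
    qed
    finally show "pw i i' * (\<Prod>l\<in>L. x (l, k l i) * x (l, k l i') + (if k l i = k l i' then 1 else 0))
        = (\<Sum>S\<in>Pow L. if key S i = key S i'
      then (w i * (\<Prod>l\<in>S. x (l, k l i))) * (w i' * (\<Prod>l\<in>S. x (l, k l i'))) else 0)" .
  qed
  also have "\<dots> = (\<Sum>S\<in>Pow L. \<Sum>i\<in>A. \<Sum>i'\<in>A. if key S i = key S i'
      then (w i * (\<Prod>l\<in>S. x (l, k l i))) * (w i' * (\<Prod>l\<in>S. x (l, k l i'))) else 0)"
  proof -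
    have sw: "(\<Sum>i\<in>A. \<Sum>i'\<in>A. \<Sum>S\<in>Pow L. f i i' S) = (\<Sum>S\<in>Pow L. \<Sum>i\<in>A. \<Sum>i'\<in>A. f i i' S)"
      for f :: "'i \<Rightarrow> 'i \<Rightarrow> 'l set \<Rightarrow> real"
      by (subst (2) sum.swap, rule sum.cong[OF refl], rule sum.swap)
    show ?thesis by (rule sw)
  qed
  also have "\<dots> = Q"
    unfolding Q_def
  proof (rule sum.cong[OF refl])
    fix S assume "S \<in> Pow L"
    then have S: "S \<subseteq> L" by simp
    show "(\<Sum>i\<in>A. \<Sum>i'\<in>A. if key S i = key S i'
        then (w i * (\<Prod>l\<in>S. x (l, k l i))) * (w i' * (\<Prod>l\<in>S. x (l, k l i'))) else 0)
      = (\<Sum>m\<in>U S. (\<Sum>i\<in>{i\<in>A. key S i = m}. w i * (\<Prod>l\<in>S. x (l, k l i)))\<^sup>2)"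
      by (rule sum_fiber_power2[OF A U(1)[OF S] U(2)[OF S], symmetric])
  qed
  finally have EV: "(\<integral>y. V y \<partial>?G) = Q" .
  have "finite (Sigma L K)" using L K by auto
  moreover have "integrable ?G (\<lambda>y. \<theta> * F y - \<theta>\<^sup>2 * V y)" using F V by simp
  ultimately have "ennreal (exp ((\<integral>y. \<theta> * F y - \<theta>\<^sup>2 * V y \<partial>?G) - (\<Sum>c\<in>Sigma L K. (x c)\<^sup>2) / 2))
     \<le> (\<integral>\<^sup>+y. ennreal (exp (\<theta> * F y - \<theta>\<^sup>2 * V y)) \<partial>gaussian (Sigma L K) (\<lambda>_. 0))"
    by (rule gaussian_change_of_measure)
  moreover have "(\<integral>y. \<theta> * F y - \<theta>\<^sup>2 * V y \<partial>?G) = \<theta> * F x - \<theta>\<^sup>2 * Q"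
    using F V EV by simp
  ultimately show ?thesis unfolding F_def V_def Q_def by simp
qed

text \<open>The extremal array in the ball of radius \<open>sqrt p\<close> is a multiple of
  \<open>h\<close>. This turns the bound for a supremum with one additional array into a bound for a
  squared norm.\<close>

lemma power2_sum_le_of_duality:
  fixes h :: "'k \<Rightarrow> real"
  assumes p: "0 \<le> p" and R: "0 \<le> R"
    and le: "\<And>z. (\<Sum>k\<in>T. (z k)\<^sup>2) \<le> p \<Longrightarrow> (\<Sum>k\<in>T. z k * h k) \<le> R"
  shows "p * (\<Sum>k\<in>T. (h k)\<^sup>2) \<le> R\<^sup>2"
proof (cases "(\<Sum>k\<in>T. (h k)\<^sup>2) = 0")
  case False
  define H where "H = (\<Sum>k\<in>T. (h k)\<^sup>2)"
  have H: "H > 0" using False sum_nonneg[of T "\<lambda>k. (h k)\<^sup>2"] by (auto simp: H_def less_le)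
  define c where "c = sqrt p / sqrt H"
  have c2: "c\<^sup>2 * H = p" using H p by (simp add: c_def power_divide)
  have "(\<Sum>k\<in>T. (c * h k)\<^sup>2) = c\<^sup>2 * H"
    by (simp add: power_mult_distrib H_def sum_distrib_left)
  then have "(\<Sum>k\<in>T. (c * h k) * h k) \<le> R" using c2 by (intro le) simp
  also have "(\<Sum>k\<in>T. (c * h k) * h k) = c * H"
    by (simp add: H_def sum_distrib_left power2_eq_square mult.assoc)
  finally have "c * H \<le> R" .
  moreover have "0 \<le> c * H" using H p by (simp add: c_def)
  ultimately have "(c * H)\<^sup>2 \<le> R\<^sup>2" by (rule power_mono)
  moreover have "(c * H)\<^sup>2 = p * H" using c2 by (simp add: power_mult_distrib power2_eq_square)
  ultimately show ?thesis by (simp add: H_def)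
qed simp

lemma prod_ennreal_le_1: "(\<And>k. k \<in> J \<Longrightarrow> f k \<le> (1 :: ennreal)) \<Longrightarrow> (\<Prod>k\<in>J. f k) \<le> 1"
proof (induction J rule: infinite_finite_induct)
  case (insert k J)
  then show ?case using mult_mono[of "f k" 1 "\<Prod>k\<in>J. f k" 1] by simp
qed auto

text \<open>Given the other columns, the coefficients are constants and the entries of column
  \<open>j\<close> are independent. The inner integral factors over the rows, and self-normalization
  bounds each factor for whatever value its coefficient takes.\<close>

lemma nn_integral_self_normalized_le_1:
  fixes \<nu> :: "nat \<times> nat \<Rightarrow> real measure"
  assumes \<nu>: "\<And>k. prob_space (\<nu> k)" and sets: "\<And>k. sets (\<nu> k) = sets borel"
    and j: "j \<in> {1..d}"
    and Y[measurable]: "Y \<in> borel_measurable borel" and v[measurable]: "v \<in> borel_measurable borel"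
    and sn: "\<And>k. k \<in> {1..n} \<times> {1..d} \<Longrightarrow> self_normalized (\<nu> k) Y v"
    and G[measurable]: "\<And>m. m \<in> {1..n} \<Longrightarrow> G m \<in> borel_measurable (PiM ({1..n} \<times> {1..d}) \<nu>)"
    and indep: "\<And>m \<omega> \<omega>'. m \<in> {1..n} \<Longrightarrow>
        (\<And>k. k \<in> {1..n} \<times> {1..d} \<Longrightarrow> snd k \<noteq> j \<Longrightarrow> \<omega> k = \<omega>' k) \<Longrightarrow> G m \<omega> = G m \<omega>'"
  shows "(\<integral>\<^sup>+\<omega>. ennreal (exp (\<Sum>m=1..n. G m \<omega> * Y (\<omega> (m, j)) - (G m \<omega>)\<^sup>2 * (v (\<omega> (m, j)))\<^sup>2))
    \<partial>PiM ({1..n} \<times> {1..d}) \<nu>) \<le> 1"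
proof -
  interpret product_sigma_finite \<nu>
    using \<nu> by (simp add: product_sigma_finite_def prob_space_imp_sigma_finite)
  let ?K = "{1..n} \<times> {1..d}"
  define I where "I = {k \<in> ?K. snd k \<noteq> j}"
  define J where "J = {1..n} \<times> {j}"
  have IJ: "I \<inter> J = {}" "finite I" "finite J" "I \<union> J = ?K" using j by (auto simp: I_def J_def)
  define h where "h \<omega> = ennreal (exp (\<Sum>m=1..n. G m \<omega> * Y (\<omega> (m, j)) - (G m \<omega>)\<^sup>2 * (v (\<omega> (m, j)))\<^sup>2))" for \<omega>
  have comp: "(\<lambda>\<omega>. f (\<omega> (m, j))) \<in> borel_measurable (PiM ?K \<nu>)"
    if f: "f \<in> borel_measurable borel" and m: "m \<in> {1..n}" for f :: "real \<Rightarrow> real" and m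
  proof -
    have "(\<lambda>\<omega>. \<omega> (m, j)) \<in> measurable (PiM ?K \<nu>) (\<nu> (m, j))"
      using m j by (intro measurable_component_singleton) auto
    then have "(\<lambda>\<omega>. \<omega> (m, j)) \<in> borel_measurable (PiM ?K \<nu>)"
      by (simp add: sets cong: measurable_cong_sets)
    then show ?thesis using f by measurable
  qed
  have hm: "h \<in> borel_measurable (PiM ?K \<nu>)"
    unfolding h_def using comp[OF Y] comp[OF v] G
    by (intro measurable_compose[OF _ measurable_ennreal] borel_measurable_exp borel_measurable_sum
        borel_measurable_diff borel_measurable_times borel_measurable_power) auto
  have "integral\<^sup>N (PiM ?K \<nu>) h = (\<integral>\<^sup>+x. (\<integral>\<^sup>+y. h (merge I J (x, y)) \<partial>PiM J \<nu>) \<partial>PiM I \<nu>)"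
    using product_nn_integral_fold[OF IJ(1,2,3), of h] hm by (simp add: IJ(4))
  also have "\<dots> \<le> (\<integral>\<^sup>+x. 1 \<partial>PiM I \<nu>)"
  proof (rule nn_integral_mono)
    \<comment> \<open>The entries of column \<open>j\<close> may be left undefined when the
      coefficients are evaluated, since these depend on the other columns only.\<close>
    fix x
    define s where "s m = G m (merge I J (x, undefined))" for m
    have s: "G m (merge I J (x, y)) = s m" if "m \<in> {1..n}" for m y
      unfolding s_def using that by (intro indep) (auto simp: merge_def I_def)
    have "(\<integral>\<^sup>+y. h (merge I J (x, y)) \<partial>PiM J \<nu>)
        = (\<integral>\<^sup>+y. (\<Prod>k\<in>J. ennreal (exp (s (fst k) * Y (y k) - (s (fst k))\<^sup>2 * (v (y k))\<^sup>2))) \<partial>PiM J \<nu>)"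
    proof (rule nn_integral_cong)
      fix y
      have "h (merge I J (x, y)) = ennreal (exp (\<Sum>m=1..n. s m * Y (y (m, j)) - (s m)\<^sup>2 * (v (y (m, j)))\<^sup>2))"
        unfolding h_def by (intro arg_cong[where f = "\<lambda>u. ennreal (exp u)"] sum.cong)
          (use s in \<open>auto simp: merge_def I_def J_def\<close>)
      also have "\<dots> = ennreal (exp (\<Sum>k\<in>J. s (fst k) * Y (y k) - (s (fst k))\<^sup>2 * (v (y k))\<^sup>2))"
      proof -
        have "J = (\<lambda>m. (m, j)) ` {1..n}" by (auto simp: J_def)
        then show ?thesis by (simp add: sum.reindex inj_on_def)
      qed
      also have "\<dots> = (\<Prod>k\<in>J. ennreal (exp (s (fst k) * Y (y k) - (s (fst k))\<^sup>2 * (v (y k))\<^sup>2)))"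
        using IJ by (simp add: exp_sum prod_ennreal)
      finally show "h (merge I J (x, y)) = (\<Prod>k\<in>J. ennreal (exp (s (fst k) * Y (y k) - (s (fst k))\<^sup>2 * (v (y k))\<^sup>2)))" .
    qed
    also have "\<dots> = (\<Prod>k\<in>J. \<integral>\<^sup>+u. ennreal (exp (s (fst k) * Y u - (s (fst k))\<^sup>2 * (v u)\<^sup>2)) \<partial>\<nu> k)"
      using IJ sets by (intro product_nn_integral_prod) (auto cong: measurable_cong_sets)
    also have "\<dots> \<le> 1"
      using sn IJ(4) by (intro prod_ennreal_le_1) (auto simp: self_normalized_def)
    finally show "(\<integral>\<^sup>+y. h (merge I J (x, y)) \<partial>PiM J \<nu>) \<le> 1" .
  qed
  also have "\<dots> = 1"
    using prob_space.emeasure_space_1[OF prob_space_PiM[OF \<nu>]] by simp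
  finally show ?thesis unfolding h_def[abs_def] .
qed

lemma power_sum_le_card_power:
  fixes a b :: real
  assumes "finite A" "0 \<le> a" "0 \<le> b" "\<And>s. s \<in> A \<Longrightarrow> 0 \<le> u s"
  shows "(a + b + (\<Sum>s\<in>A. u s)) ^ q \<le> real (2 + card A) ^ q * (a ^ q + b ^ q + (\<Sum>s\<in>A. u s ^ q))"
proof -
  define B where "B = insert a (insert b (u ` A))"
  define m where "m = Max B"
  have fin: "finite B" "B \<noteq> {}" using assms by (auto simp: B_def)
  have le: "x \<le> m" if "x \<in> B" for x
    using fin that by (auto simp: m_def)
  have m: "m \<in> B" unfolding m_def using fin by (rule Max_in)
  have "(\<Sum>s\<in>A. u s) \<le> real (card A) * m"
    using le by (intro sum_bounded_above) (auto simp: B_def)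
  then have "a + b + (\<Sum>s\<in>A. u s) \<le> real (2 + card A) * m"
    using le[of a] le[of b] by (simp add: B_def algebra_simps)
  then have "(a + b + (\<Sum>s\<in>A. u s)) ^ q \<le> (real (2 + card A) * m) ^ q"
    using assms by (intro power_mono) (auto intro!: add_nonneg_nonneg sum_nonneg)
  also have "\<dots> = real (2 + card A) ^ q * m ^ q" by (rule power_mult_distrib)
  also have "\<dots> \<le> real (2 + card A) ^ q * (a ^ q + b ^ q + (\<Sum>s\<in>A. u s ^ q))"
  proof (rule mult_left_mono)
    have s: "u s ^ q \<le> (\<Sum>s\<in>A. u s ^ q)" if "s \<in> A" for s
      using assms that by (intro member_le_sum) auto
    have nn: "0 \<le> a ^ q" "0 \<le> b ^ q" "0 \<le> (\<Sum>s\<in>A. u s ^ q)"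
      using assms by (auto intro!: sum_nonneg)
    from m show "m ^ q \<le> a ^ q + b ^ q + (\<Sum>s\<in>A. u s ^ q)"
      unfolding B_def using s nn by fastforce
  qed simp
  finally show ?thesis .
qed

text \<open>Raise \<open>s \<le> exp s\<close> with \<open>s = ln y / q\<close> to the power
  \<open>q\<close>. This converts the bound on the mean of \<open>Z\<close> into moments of its
  logarithm.\<close>

lemma ln_power_le:
  fixes y :: real
  assumes "1 \<le> y"
  shows "ln y ^ q \<le> real q ^ q * y"
proof (cases "q = 0")
  case False
  define s where "s = ln y / q"
  have s: "0 \<le> s" using assms by (simp add: s_def)
  have "s ^ q \<le> exp s ^ q" using s exp_ge_add_one_self[of s] by (intro power_mono) linarith+
  also have "\<dots> = y" using assms False by (simp add: s_def flip: exp_of_nat_mult)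
  finally have "real q ^ q * s ^ q \<le> real q ^ q * y" by (intro mult_left_mono) auto
  then show ?thesis using False by (simp add: s_def flip: power_mult_distrib)
qed (use assms in simp)

lemma power_add_le_add_power:
  fixes a b :: real
  assumes "0 \<le> a" "0 \<le> b" "0 < q"
  shows "a ^ q + b ^ q \<le> (a + b) ^ q"
proof -
  obtain q' where q: "q = Suc q'" using assms(3) gr0_conv_Suc by auto
  have "a ^ q + b ^ q = a * a ^ q' + b * b ^ q'" by (simp add: q)
  also have "\<dots> \<le> a * (a + b) ^ q' + b * (a + b) ^ q'"
    using assms by (intro add_mono mult_left_mono power_mono) auto
  also have "\<dots> = (a + b) ^ q" by (simp add: q algebra_simps)
  finally show ?thesis .
qed

section \<open>Integrating out one column\<close>

text \<open>The moment bound is required of a measurable majorant \<open>R\<close>, so that the supremum over the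
  uncountably many arrays need not be shown to be measurable.\<close>

definition moment_dominated ::
  "'w measure \<Rightarrow> nat \<Rightarrow> nat \<Rightarrow> real \<Rightarrow> 'l set \<Rightarrow> ('l \<Rightarrow> nat set) \<Rightarrow> ((nat \<Rightarrow> nat) \<Rightarrow> 'w \<Rightarrow> real) \<Rightarrow> nat \<Rightarrow> real \<Rightarrow> bool" where
  "moment_dominated M n d p L B b q r \<longleftrightarrow>
     (\<exists>R\<in>borel_measurable M. (\<forall>\<omega>. 0 \<le> R \<omega>) \<and>
        (AE \<omega> in M. \<forall>x. (\<forall>l\<in>L. (\<Sum>k\<in>multi_idx n (B l). (x l k)\<^sup>2) \<le> p) \<longrightarrow>
           (\<Sum>i\<in>multi_idx n {1..d}. b i \<omega> * (\<Prod>l\<in>L. x l (restrict i (B l)))) \<le> R \<omega>) \<and>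
        (\<integral>\<^sup>+\<omega>. ennreal (R \<omega> ^ q) \<partial>M) \<le> ennreal (r ^ q))"

text \<open>The majorant for \<open>b\<close> is kept. The competitor \<open>y\<close> may depend on
  \<omega>, which allows a random sign to be absorbed into an array.\<close>

lemma moment_dominated_mono:
  assumes "moment_dominated M n d p L B b q r"
    and "\<And>x \<omega>. \<omega> \<in> space M \<Longrightarrow> (\<forall>l\<in>L. (\<Sum>k\<in>multi_idx n (B l). (x l k)\<^sup>2) \<le> p) \<Longrightarrow>
      \<exists>y. (\<forall>l\<in>L. (\<Sum>k\<in>multi_idx n (B l). (y l k)\<^sup>2) \<le> p) \<and>
        (\<Sum>i\<in>multi_idx n {1..d}. b' i \<omega> * (\<Prod>l\<in>L. x l (restrict i (B l))))
        \<le> (\<Sum>i\<in>multi_idx n {1..d}. b i \<omega> * (\<Prod>l\<in>L. y l (restrict i (B l))))"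
  shows "moment_dominated M n d p L B b' q r"
proof -
  obtain R where R: "R \<in> borel_measurable M" "\<And>\<omega>. 0 \<le> R \<omega>"
      "(\<integral>\<^sup>+\<omega>. ennreal (R \<omega> ^ q) \<partial>M) \<le> ennreal (r ^ q)"
    and ae: "AE \<omega> in M. \<forall>x. (\<forall>l\<in>L. (\<Sum>k\<in>multi_idx n (B l). (x l k)\<^sup>2) \<le> p) \<longrightarrow>
           (\<Sum>i\<in>multi_idx n {1..d}. b i \<omega> * (\<Prod>l\<in>L. x l (restrict i (B l)))) \<le> R \<omega>"
    using assms(1) by (auto simp: moment_dominated_def)
  from ae AE_space have "AE \<omega> in M. \<forall>x. (\<forall>l\<in>L. (\<Sum>k\<in>multi_idx n (B l). (x l k)\<^sup>2) \<le> p) \<longrightarrow>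
           (\<Sum>i\<in>multi_idx n {1..d}. b' i \<omega> * (\<Prod>l\<in>L. x l (restrict i (B l)))) \<le> R \<omega>"
  proof eventually_elim
    fix \<omega> assume 1: "\<forall>x. (\<forall>l\<in>L. (\<Sum>k\<in>multi_idx n (B l). (x l k)\<^sup>2) \<le> p) \<longrightarrow>
           (\<Sum>i\<in>multi_idx n {1..d}. b i \<omega> * (\<Prod>l\<in>L. x l (restrict i (B l)))) \<le> R \<omega>"
      and \<omega>: "\<omega> \<in> space M"
    show "\<forall>x. (\<forall>l\<in>L. (\<Sum>k\<in>multi_idx n (B l). (x l k)\<^sup>2) \<le> p) \<longrightarrow>
           (\<Sum>i\<in>multi_idx n {1..d}. b' i \<omega> * (\<Prod>l\<in>L. x l (restrict i (B l)))) \<le> R \<omega>"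
    proof (intro allI impI)
      fix x assume "\<forall>l\<in>L. (\<Sum>k\<in>multi_idx n (B l). (x l k)\<^sup>2) \<le> p"
      from assms(2)[OF \<omega> this] obtain y where y: "\<forall>l\<in>L. (\<Sum>k\<in>multi_idx n (B l). (y l k)\<^sup>2) \<le> p"
        "(\<Sum>i\<in>multi_idx n {1..d}. b' i \<omega> * (\<Prod>l\<in>L. x l (restrict i (B l))))
        \<le> (\<Sum>i\<in>multi_idx n {1..d}. b i \<omega> * (\<Prod>l\<in>L. y l (restrict i (B l))))" by blast
      from 1 y(1) have "(\<Sum>i\<in>multi_idx n {1..d}. b i \<omega> * (\<Prod>l\<in>L. y l (restrict i (B l)))) \<le> R \<omega>"
        by blast
      with y(2) show "(\<Sum>i\<in>multi_idx n {1..d}. b' i \<omega> * (\<Prod>l\<in>L. x l (restrict i (B l)))) \<le> R \<omega>"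
        by linarith
    qed
  qed
  then show ?thesis using R unfolding moment_dominated_def by blast
qed

text \<open>The three terms are the entropy, the logarithm of the partition function
  \<open>Z\<close> and the variance. By \<open>ln_power_le\<close> the second costs a factor of
  order \<open>q / p\<close>, hence at most \<open>Q\<close>. The third consists of squares, so its
  moment of order \<open>q\<close> uses moments of order \<open>2 * q\<close>.\<close>

lemma nn_integral_majorant_power_le:
  fixes Z :: "'w \<Rightarrow> ennreal" and p r Q :: real and \<kappa> q :: nat
  assumes A: "finite A" "card A \<le> 2 ^ \<kappa>" and k: "0 \<le> k" "k \<le> \<kappa>" and r: "0 < r" and p: "0 < p"
    and q: "0 < q" "real q \<le> Q * p"
    and [measurable]: "Z \<in> borel_measurable M" "\<And>S. S \<in> A \<Longrightarrow> R S \<in> borel_measurable M"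
    and M: "prob_space M" and Z: "(\<integral>\<^sup>+\<omega>. Z \<omega> \<partial>M) \<le> 1"
    and R: "\<And>S. S \<in> A \<Longrightarrow> (\<integral>\<^sup>+\<omega>. ennreal (R S \<omega> ^ (2 * q)) \<partial>M) \<le> ennreal (r ^ (2 * q))"
  shows "(\<integral>\<^sup>+\<omega>. ennreal ((r * k / 2 + r / p * ln (max 1 (enn2real (Z \<omega>))) + (\<Sum>S\<in>A. (R S \<omega>)\<^sup>2 / r)) ^ q) \<partial>M)
    \<le> ennreal (((2 + 2 ^ \<kappa>) * (\<kappa> + 2 * Q + 2 ^ \<kappa>) * r) ^ q)"
proof -
  interpret prob_space M by (rule M)
  define N where "N = (2 + 2 ^ \<kappa> :: real)"
  have "0 < Q * p" using q by linarith
  then have Q: "Q > 0" using p by (simp add: zero_less_mult_iff)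
  have N0: "N > 0" by (simp add: N_def add_pos_pos)
  have N: "real (2 + card A) \<le> N"
    using of_nat_mono[OF A(2), where 'a = real] by (simp add: N_def)
  have "ennreal ((r * k / 2 + r / p * ln (max 1 (enn2real (Z \<omega>))) + (\<Sum>S\<in>A. (R S \<omega>)\<^sup>2 / r)) ^ q)
      \<le> ennreal (N ^ q) * (ennreal ((\<kappa> * r) ^ q) + ennreal ((Q * r) ^ q) * (1 + Z \<omega>)
          + (\<Sum>S\<in>A. ennreal (1 / r ^ q) * ennreal (R S \<omega> ^ (2 * q))))" (is "?l \<le> ?r") for \<omega>
  proof (cases "Z \<omega> = \<infinity>")
    case True
    \<comment> \<open>Here \<open>enn2real\<close> returns 0 and the left side says nothing about
      \<open>Z\<close>, but the right side is infinite.\<close>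
    have "ennreal ((Q * r) ^ q) * (1 + Z \<omega>) = \<infinity>"
      using True Q r by (simp add: ennreal_mult_top ennreal_mult_eq_top_iff)
    then have "?r = \<infinity>" using N0 by (simp add: ennreal_mult_top ennreal_mult_eq_top_iff)
    then show ?thesis by simp
  next
    case False
    define z where "z = enn2real (Z \<omega>)"
    have z: "Z \<omega> = ennreal z" "0 \<le> z" using False by (auto simp: z_def less_top)
    have "(r * k / 2 + r / p * ln (max 1 z) + (\<Sum>S\<in>A. (R S \<omega>)\<^sup>2 / r)) ^ q
        \<le> real (2 + card A) ^ q * ((r * k / 2) ^ q + (r / p * ln (max 1 z)) ^ q + (\<Sum>S\<in>A. ((R S \<omega>)\<^sup>2 / r) ^ q))"
      using A r p k by (intro power_sum_le_card_power) auto
    also have "\<dots> \<le> N ^ q * ((\<kappa> * r) ^ q + (Q * r) ^ q * (1 + z) + (\<Sum>S\<in>A. 1 / r ^ q * R S \<omega> ^ (2 * q)))"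
    proof (rule mult_mono)
      show "real (2 + card A) ^ q \<le> N ^ q" using N by (intro power_mono) auto
      have "r * k / 2 \<le> \<kappa> * r" using k r mult_right_mono[of k \<kappa> r] by (simp add: mult.commute)
      then have 1: "(r * k / 2) ^ q \<le> (\<kappa> * r) ^ q" using k r by (intro power_mono) auto
      have "(r / p * ln (max 1 z)) ^ q = (r / p) ^ q * ln (max 1 z) ^ q" by (rule power_mult_distrib)
      also have "\<dots> \<le> (r / p) ^ q * (real q ^ q * max 1 z)"
        using r p by (intro mult_left_mono ln_power_le) auto
      also have "\<dots> = (r / p * real q) ^ q * max 1 z"
        by (simp only: power_mult_distrib mult.assoc)
      also have "\<dots> \<le> (Q * r) ^ q * (1 + z)"
      proof (rule mult_mono)
        have "r / p * real q \<le> Q * r" using q(2) p r by (simp add: divide_le_eq mult.commute mult.left_commute)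
        then show "(r / p * real q) ^ q \<le> (Q * r) ^ q" using r p by (intro power_mono) auto
      qed (use r Q z in auto)
      finally have 2: "(r / p * ln (max 1 z)) ^ q \<le> (Q * r) ^ q * (1 + z)" .
      have 3: "(\<Sum>S\<in>A. ((R S \<omega>)\<^sup>2 / r) ^ q) \<le> (\<Sum>S\<in>A. 1 / r ^ q * R S \<omega> ^ (2 * q))"
        by (intro sum_mono) (simp add: power_divide power_mult)
      show "(r * k / 2) ^ q + (r / p * ln (max 1 z)) ^ q + (\<Sum>S\<in>A. ((R S \<omega>)\<^sup>2 / r) ^ q)
          \<le> (\<kappa> * r) ^ q + (Q * r) ^ q * (1 + z) + (\<Sum>S\<in>A. 1 / r ^ q * R S \<omega> ^ (2 * q))"
        using 1 2 3 by linarith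
      show "0 \<le> (r * k / 2) ^ q + (r / p * ln (max 1 z)) ^ q + (\<Sum>S\<in>A. ((R S \<omega>)\<^sup>2 / r) ^ q)"
        using r k p by (intro add_nonneg_nonneg sum_nonneg) auto
    qed (use N0 in auto)
    finally have "?l \<le> ennreal (N ^ q * ((\<kappa> * r) ^ q + (Q * r) ^ q * (1 + z) + (\<Sum>S\<in>A. 1 / r ^ q * R S \<omega> ^ (2 * q))))"
      unfolding z_def by (rule ennreal_leI)
    also have "\<dots> = ?r"
    proof -
      have e: "ennreal (1 / r ^ q) * ennreal (R S \<omega> ^ (2 * q)) = ennreal (1 / r ^ q * R S \<omega> ^ (2 * q))" for S
        using r by (intro ennreal_mult[symmetric]) (auto simp: power_mult)
      have s: "(\<Sum>S\<in>A. ennreal (1 / r ^ q * R S \<omega> ^ (2 * q))) = ennreal (\<Sum>S\<in>A. 1 / r ^ q * R S \<omega> ^ (2 * q))"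
        using r by (intro sum_ennreal) (auto simp: power_mult)
      have "0 \<le> (\<Sum>S\<in>A. 1 / r ^ q * R S \<omega> ^ (2 * q))"
        using r by (intro sum_nonneg) (auto simp: power_mult)
      then show ?thesis
        unfolding e s using r Q z N0 by (simp add: ennreal_mult ennreal_plus)
    qed
    finally show ?thesis .
  qed
  then have "(\<integral>\<^sup>+\<omega>. ennreal ((r * k / 2 + r / p * ln (max 1 (enn2real (Z \<omega>))) + (\<Sum>S\<in>A. (R S \<omega>)\<^sup>2 / r)) ^ q) \<partial>M)
      \<le> (\<integral>\<^sup>+\<omega>. ennreal (N ^ q) * (ennreal ((\<kappa> * r) ^ q) + ennreal ((Q * r) ^ q) * (1 + Z \<omega>)
          + (\<Sum>S\<in>A. ennreal (1 / r ^ q) * ennreal (R S \<omega> ^ (2 * q)))) \<partial>M)"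
    by (rule nn_integral_mono)
  also have "\<dots> = ennreal (N ^ q) * (ennreal ((\<kappa> * r) ^ q) + ennreal ((Q * r) ^ q) * (1 + (\<integral>\<^sup>+\<omega>. Z \<omega> \<partial>M))
          + (\<Sum>S\<in>A. ennreal (1 / r ^ q) * (\<integral>\<^sup>+\<omega>. ennreal (R S \<omega> ^ (2 * q)) \<partial>M)))"
    by (simp add: nn_integral_cmult nn_integral_add nn_integral_sum emeasure_space_1)
  also have "\<dots> \<le> ennreal (N ^ q) * (ennreal ((\<kappa> * r) ^ q) + ennreal ((Q * r) ^ q) * (1 + 1)
          + (\<Sum>S\<in>A. ennreal (1 / r ^ q) * ennreal (r ^ (2 * q))))"
    using Z R by (intro mult_left_mono add_mono sum_mono) auto
  also have "\<dots> = ennreal (N ^ q * ((\<kappa> * r) ^ q + (Q * r) ^ q * 2 + real (card A) * r ^ q))"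
  proof -
    have "ennreal (1 / r ^ q) * ennreal (r ^ (2 * q)) = ennreal (r ^ q)"
      using r by (simp add: mult_2 power_add flip: ennreal_mult)
    then have "(\<Sum>S\<in>A. ennreal (1 / r ^ q) * ennreal (r ^ (2 * q))) = ennreal (real (card A) * r ^ q)"
      using r by (simp add: ennreal_mult ennreal_of_nat_eq_real_of_nat)
    moreover have "ennreal ((Q * r) ^ q) * (1 + 1) = ennreal ((Q * r) ^ q * 2)"
      using Q r by (simp add: ennreal_mult one_add_one)
    ultimately show ?thesis
      using r Q by (simp add: N_def ennreal_mult ennreal_plus)
  qed
  also have "\<dots> \<le> ennreal ((N * (\<kappa> + 2 * Q + 2 ^ \<kappa>) * r) ^ q)"
  proof (rule ennreal_leI)
    have pos: "0 \<le> Q * r" "0 \<le> r" using Q r by auto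
    \<comment> \<open>Powers of order at least 1 are superadditive, so the terms can be collected
      inside a single power; the number of terms and the factor 2 then enter the constant without
      depending on \<open>q\<close>.\<close>
    have "(\<kappa> * r) ^ q + (Q * r) ^ q * 2 + real (card A) * r ^ q
        \<le> (\<kappa> * r) ^ q + ((Q * r) ^ q + (Q * r) ^ q) + (2 ^ \<kappa> * r) ^ q"
    proof -
      have "real (card A) \<le> 2 ^ \<kappa>"
        using of_nat_mono[OF A(2), where 'a = real] by simp
      also have "\<dots> \<le> (2 ^ \<kappa>) ^ q" using q(1) by (intro self_le_power) auto
      finally have "real (card A) * r ^ q \<le> (2 ^ \<kappa>) ^ q * r ^ q" using r by (intro mult_right_mono) auto
      then show ?thesis by (simp add: power_mult_distrib)
    qed
    also have "\<dots> \<le> (\<kappa> * r) ^ q + (Q * r + Q * r) ^ q + (2 ^ \<kappa> * r) ^ q"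
      using pos q(1) power_add_le_add_power[of "Q * r" "Q * r" q] by simp
    also have "\<dots> \<le> (\<kappa> * r + (Q * r + Q * r)) ^ q + (2 ^ \<kappa> * r) ^ q"
      using pos q(1) power_add_le_add_power[of "\<kappa> * r" "Q * r + Q * r" q] by simp
    also have "\<dots> \<le> (\<kappa> * r + (Q * r + Q * r) + 2 ^ \<kappa> * r) ^ q"
      using pos q(1) power_add_le_add_power[of "\<kappa> * r + (Q * r + Q * r)" "2 ^ \<kappa> * r" q] by simp
    also have "\<kappa> * r + (Q * r + Q * r) + 2 ^ \<kappa> * r = (\<kappa> + 2 * Q + 2 ^ \<kappa>) * r"
      by (simp add: algebra_simps)
    finally have "N ^ q * ((\<kappa> * r) ^ q + (Q * r) ^ q * 2 + real (card A) * r ^ q)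
        \<le> N ^ q * ((\<kappa> + 2 * Q + 2 ^ \<kappa>) * r) ^ q"
      by (intro mult_left_mono) (auto simp: N_def)
    then show "N ^ q * ((\<kappa> * r) ^ q + (Q * r) ^ q * 2 + real (card A) * r ^ q)
        \<le> (N * (\<kappa> + 2 * Q + 2 ^ \<kappa>) * r) ^ q"
      by (simp add: power_mult_distrib mult.assoc)
  qed
  finally show ?thesis unfolding N_def .
qed

text \<open>For each \<omega> the single number \<open>Z \<omega>\<close> controls the form at all
  arrays simultaneously, by \<open>gaussian_pac_bayes\<close>, while its mean is at most 1 because
  \<open>Y\<close> is self-normalized by \<open>v\<close>. The variance for a subset
  \<open>S\<close> of kept arrays is a squared norm on the block made of \<open>j\<close> and the
  blocks turned into noise; the fresh label \<open>t\<close> stands for the array dual to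
  it.\<close>

lemma moment_dominated_step:
  fixes \<nu> :: "nat \<times> nat \<Rightarrow> real measure" and p r Q :: real and \<kappa> q n d :: nat and L :: "'l set"
    and c :: "(nat \<Rightarrow> nat) \<Rightarrow> (nat \<times> nat \<Rightarrow> real) \<Rightarrow> real"
  defines "P \<equiv> PiM ({1..n} \<times> {1..d}) \<nu>"
  assumes \<nu>: "\<And>k. prob_space (\<nu> k)" and sets: "\<And>k. sets (\<nu> k) = sets borel"
    and L: "finite L" "card L \<le> \<kappa>" "t \<notin> L" and B: "\<And>l. l \<in> L \<Longrightarrow> B l \<subseteq> {1..d}"
    and j: "j \<in> {1..d}"
    and Y[measurable]: "Y \<in> borel_measurable borel" and v[measurable]: "v \<in> borel_measurable borel"
    and sn: "\<And>k. k \<in> {1..n} \<times> {1..d} \<Longrightarrow> self_normalized (\<nu> k) Y v"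
    and c: "\<And>i. i \<in> multi_idx n {1..d} \<Longrightarrow> c i \<in> borel_measurable P"
    and indep: "\<And>i \<omega> \<omega>'. i \<in> multi_idx n {1..d} \<Longrightarrow>
        (\<And>k. k \<in> {1..n} \<times> {1..d} \<Longrightarrow> snd k \<noteq> j \<Longrightarrow> \<omega> k = \<omega>' k) \<Longrightarrow> c i \<omega> = c i \<omega>'"
    and r: "0 < r" and p: "0 < p" and q: "0 < q" "real q \<le> Q * p"
    and dom: "\<And>S. S \<subseteq> L \<Longrightarrow> moment_dominated P n d p (insert t S) (B(t := insert j (\<Union>l\<in>L - S. B l)))
        (\<lambda>i \<omega>. c i \<omega> * v (\<omega> (i j, j))) (2 * q) r"
  shows "moment_dominated P n d p L B (\<lambda>i \<omega>. c i \<omega> * Y (\<omega> (i j, j))) q ((2 + 2 ^ \<kappa>) * (\<kappa> + 2 * Q + 2 ^ \<kappa>) * r)"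
proof -
  interpret P: prob_space P unfolding P_def by (rule prob_space_PiM) (rule \<nu>)
  define A where "A = multi_idx n {1..d}"
  define K where "K l = multi_idx n (B l)" for l
  define U where "U S = insert j (\<Union>l\<in>L - S. B l)" for S
  \<comment> \<open>This choice balances the two costs: after division by \<theta> the entropy
    \<open>card L * p / 2\<close> is of order \<open>r\<close>, and so is the variance term
    \<open>\<theta> * (R S \<omega>)\<^sup>2 / p\<close> when \<open>R S\<close> is of order
    \<open>r\<close>.\<close>
  define \<theta> where "\<theta> = p / r"
  let ?G = "gaussian (Sigma L K) (\<lambda>_. 0)"
  interpret G: prob_space ?G by (rule prob_space_gaussian)
  interpret PG: pair_sigma_finite P ?G ..
  have finA: "finite A" by (simp add: A_def)
  have finK: "finite (K l)" if "l \<in> L" for l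
    using B[OF that] finite_subset unfolding K_def by (intro finite_multi_idx) blast
  have US: "U S \<subseteq> {1..d}" for S using B j by (auto simp: U_def)
  have rest: "restrict i (B l) \<in> K l" if "l \<in> L" "i \<in> A" for l i
    using that B unfolding K_def A_def by (intro restrict_multi_idx) auto
  have ij: "i j \<in> {1..n}" if "i \<in> A" for i using that j by (auto simp: A_def multi_idx_def)
  define e where "e \<omega> y = \<theta> * (\<Sum>i\<in>A. (c i \<omega> * Y (\<omega> (i j, j))) * (\<Prod>l\<in>L. y (l, restrict i (B l))))
      - \<theta>\<^sup>2 * (\<Sum>m\<in>{1..n}. (\<Sum>i\<in>{i\<in>A. i j = m}. (c i \<omega> * v (\<omega> (i j, j))) * (\<Prod>l\<in>L. y (l, restrict i (B l))))\<^sup>2)"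
    for \<omega> y
  define Z where "Z \<omega> = (\<integral>\<^sup>+y. ennreal (exp (e \<omega> y)) \<partial>?G)" for \<omega>
  have comp: "(\<lambda>\<omega>. \<omega> k) \<in> borel_measurable P" if "k \<in> {1..n} \<times> {1..d}" for k
  proof -
    have "(\<lambda>\<omega>. \<omega> k) \<in> measurable P (\<nu> k)"
      unfolding P_def using that by (rule measurable_component_singleton)
    then show ?thesis by (simp add: sets cong: measurable_cong_sets)
  qed
  have ycomp: "(\<lambda>y. y k) \<in> borel_measurable ?G" if "k \<in> Sigma L K" for k
    using measurable_component_singleton[OF that, of "\<lambda>_. borel :: real measure"]
    by (simp cong: measurable_cong_sets)
  have em: "(\<lambda>(\<omega>, y). ennreal (exp (e \<omega> y))) \<in> borel_measurable (P \<Otimes>\<^sub>M ?G)"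
  proof -
    have 1: "(\<lambda>x. c i (fst x)) \<in> borel_measurable (P \<Otimes>\<^sub>M ?G)" if "i \<in> A" for i
      using measurable_compose[OF measurable_fst c] that by (simp add: A_def)
    have 2: "(\<lambda>x. f (fst x (i j, j))) \<in> borel_measurable (P \<Otimes>\<^sub>M ?G)"
      if "f \<in> borel_measurable borel" "i \<in> A" for i and f :: "real \<Rightarrow> real"
    proof -
      have "(i j, j) \<in> {1..n} \<times> {1..d}" using ij[OF that(2)] j by blast
      from measurable_compose[OF measurable_compose[OF measurable_fst comp[OF this]] that(1)] show ?thesis .
    qed
    have 3: "(\<lambda>x. snd x (l, restrict i (B l))) \<in> borel_measurable (P \<Otimes>\<^sub>M ?G)" if "l \<in> L" "i \<in> A" for l i
    proof -
      have "(l, restrict i (B l)) \<in> Sigma L K" using rest[OF that] that by blast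
      from measurable_compose[OF measurable_snd ycomp[OF this]] show ?thesis .
    qed
    have [measurable]: "(\<lambda>x. e (fst x) (snd x)) \<in> borel_measurable (P \<Otimes>\<^sub>M ?G)"
      unfolding e_def
      by (intro borel_measurable_sum borel_measurable_diff borel_measurable_times
        borel_measurable_power borel_measurable_prod borel_measurable_const 1 2 3 Y v) auto
    show ?thesis unfolding case_prod_unfold by measurable
  qed
  have Zm: "Z \<in> borel_measurable P"
    unfolding Z_def using em by (rule G.borel_measurable_nn_integral)
  have Z1: "(\<integral>\<^sup>+\<omega>. Z \<omega> \<partial>P) \<le> 1"
  proof -
    \<comment> \<open>With the smoothed arrays \<open>y\<close> held fixed, grouping the
      multi-indices by their value at \<open>j\<close> exhibits the exponent as a self-normalized
      sum over the rows of column \<open>j\<close>.\<close>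
    have "(\<integral>\<^sup>+\<omega>. Z \<omega> \<partial>P) = (\<integral>\<^sup>+y. (\<integral>\<^sup>+\<omega>. ennreal (exp (e \<omega> y)) \<partial>P) \<partial>?G)"
      unfolding Z_def using em by (rule PG.Fubini'[symmetric])
    also have "\<dots> \<le> (\<integral>\<^sup>+y. 1 \<partial>?G)"
    proof (rule nn_integral_mono)
      fix y
      define g where "g m \<omega> = \<theta> * (\<Sum>i\<in>{i\<in>A. i j = m}. c i \<omega> * (\<Prod>l\<in>L. y (l, restrict i (B l))))" for m \<omega>
      have e: "e \<omega> y = (\<Sum>m=1..n. g m \<omega> * Y (\<omega> (m, j)) - (g m \<omega>)\<^sup>2 * (v (\<omega> (m, j)))\<^sup>2)" for \<omega>
      proof -
        have "\<theta> * (\<Sum>i\<in>A. (c i \<omega> * Y (\<omega> (i j, j))) * (\<Prod>l\<in>L. y (l, restrict i (B l))))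
            = \<theta> * (\<Sum>m=1..n. \<Sum>i\<in>{i\<in>A. i j = m}. (c i \<omega> * Y (\<omega> (i j, j))) * (\<Prod>l\<in>L. y (l, restrict i (B l))))"
          using finA ij by (subst sum.group) auto
        also have "\<dots> = (\<Sum>m=1..n. g m \<omega> * Y (\<omega> (m, j)))"
          unfolding g_def sum_distrib_left sum_distrib_right by (intro sum.cong) (auto simp: mult_ac)
        finally have 1: "\<theta> * (\<Sum>i\<in>A. (c i \<omega> * Y (\<omega> (i j, j))) * (\<Prod>l\<in>L. y (l, restrict i (B l))))
            = (\<Sum>m=1..n. g m \<omega> * Y (\<omega> (m, j)))" .
        have 2: "\<theta>\<^sup>2 * (\<Sum>i\<in>{i\<in>A. i j = m}. (c i \<omega> * v (\<omega> (i j, j))) * (\<Prod>l\<in>L. y (l, restrict i (B l))))\<^sup>2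
            = (g m \<omega>)\<^sup>2 * (v (\<omega> (m, j)))\<^sup>2" for m
        proof -
          have "\<theta> * (\<Sum>i\<in>{i\<in>A. i j = m}. (c i \<omega> * v (\<omega> (i j, j))) * (\<Prod>l\<in>L. y (l, restrict i (B l))))
              = g m \<omega> * v (\<omega> (m, j))"
            unfolding g_def sum_distrib_left sum_distrib_right by (intro sum.cong) (auto simp: mult_ac)
          then show ?thesis by (simp only: power_mult_distrib[symmetric])
        qed
        have "\<theta>\<^sup>2 * (\<Sum>m\<in>{1..n}. (\<Sum>i\<in>{i\<in>A. i j = m}. (c i \<omega> * v (\<omega> (i j, j))) * (\<Prod>l\<in>L. y (l, restrict i (B l))))\<^sup>2)
            = (\<Sum>m=1..n. (g m \<omega>)\<^sup>2 * (v (\<omega> (m, j)))\<^sup>2)"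
          by (simp only: sum_distrib_left 2)
        then show ?thesis unfolding e_def 1 sum_subtractf by simp
      qed
      show "(\<integral>\<^sup>+\<omega>. ennreal (exp (e \<omega> y)) \<partial>P) \<le> 1"
        unfolding e P_def
      proof (rule nn_integral_self_normalized_le_1[OF \<nu> sets j Y v sn])
        show "g m \<in> borel_measurable (PiM ({1..n} \<times> {1..d}) \<nu>)" for m
          unfolding g_def P_def[symmetric] using c by (auto simp: A_def)
        show "g m \<omega> = g m \<omega>'" if "\<And>k. k \<in> {1..n} \<times> {1..d} \<Longrightarrow> snd k \<noteq> j \<Longrightarrow> \<omega> k = \<omega>' k" for m \<omega> \<omega>'
          unfolding g_def using indep[of _ \<omega> \<omega>'] that by (auto simp: A_def intro!: sum.cong)
      qed
    qed
    finally show ?thesis by (simp add: G.emeasure_space_1)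
  qed
  define good where "good S R \<longleftrightarrow> R \<in> borel_measurable P \<and> (\<forall>\<omega>. 0 \<le> R \<omega>) \<and>
        (AE \<omega> in P. \<forall>x. (\<forall>l\<in>insert t S. (\<Sum>k\<in>multi_idx n ((B(t := U S)) l). (x l k)\<^sup>2) \<le> p) \<longrightarrow>
           (\<Sum>i\<in>A. (c i \<omega> * v (\<omega> (i j, j))) * (\<Prod>l\<in>insert t S. x l (restrict i ((B(t := U S)) l)))) \<le> R \<omega>) \<and>
        (\<integral>\<^sup>+\<omega>. ennreal (R \<omega> ^ (2 * q)) \<partial>P) \<le> ennreal (r ^ (2 * q))" for S R
  have "\<exists>R. good S R" if "S \<subseteq> L" for S
    using dom[OF that] unfolding good_def moment_dominated_def U_def A_def by blast
  then obtain R where good: "\<And>S. S \<subseteq> L \<Longrightarrow> good S (R S)" by metis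
  have R: "R S \<in> borel_measurable P" "0 \<le> R S \<omega>"
      "(\<integral>\<^sup>+\<omega>. ennreal (R S \<omega> ^ (2 * q)) \<partial>P) \<le> ennreal (r ^ (2 * q))"
    and ae: "AE \<omega> in P. \<forall>x. (\<forall>l\<in>insert t S. (\<Sum>k\<in>multi_idx n ((B(t := U S)) l). (x l k)\<^sup>2) \<le> p) \<longrightarrow>
           (\<Sum>i\<in>A. (c i \<omega> * v (\<omega> (i j, j))) * (\<Prod>l\<in>insert t S. x l (restrict i ((B(t := U S)) l)))) \<le> R S \<omega>"
    if "S \<subseteq> L" for S \<omega>
    using good[OF that] unfolding good_def by blast+
  \<comment> \<open>The outcome of solving the smoothed inequality for the form. The maximum with 1
    keeps the logarithm, and hence the majorant, nonnegative.\<close>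
  define R' where "R' \<omega> = r * real (card L) / 2 + r / p * ln (max 1 (enn2real (Z \<omega>))) + (\<Sum>S\<in>Pow L. (R S \<omega>)\<^sup>2 / r)" for \<omega>
  have "R' \<in> borel_measurable P" unfolding R'_def using Zm R(1) by measurable
  moreover have "0 \<le> R' \<omega>" for \<omega> using r p by (auto simp: R'_def intro!: add_nonneg_nonneg sum_nonneg)
  moreover have "(\<integral>\<^sup>+\<omega>. ennreal (R' \<omega> ^ q) \<partial>P) \<le> ennreal (((2 + 2 ^ \<kappa>) * (\<kappa> + 2 * Q + 2 ^ \<kappa>) * r) ^ q)"
    unfolding R'_def using L R Zm Z1 r p q
    by (intro nn_integral_majorant_power_le P.prob_space_axioms) (auto simp: card_Pow power_increasing)
  moreover have "AE \<omega> in P. \<forall>x. (\<forall>l\<in>L. (\<Sum>k\<in>multi_idx n (B l). (x l k)\<^sup>2) \<le> p) \<longrightarrow>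
           (\<Sum>i\<in>A. (c i \<omega> * Y (\<omega> (i j, j))) * (\<Prod>l\<in>L. x l (restrict i (B l)))) \<le> R' \<omega>"
  proof -
    have "AE \<omega> in P. \<forall>S\<in>Pow L. \<forall>x. (\<forall>l\<in>insert t S. (\<Sum>k\<in>multi_idx n ((B(t := U S)) l). (x l k)\<^sup>2) \<le> p) \<longrightarrow>
           (\<Sum>i\<in>A. (c i \<omega> * v (\<omega> (i j, j))) * (\<Prod>l\<in>insert t S. x l (restrict i ((B(t := U S)) l)))) \<le> R S \<omega>"
      using L(1) ae by (intro AE_finite_allI) auto
    moreover have "AE \<omega> in P. Z \<omega> \<noteq> \<infinity>"
      using Zm Z1 by (intro nn_integral_PInf_AE) (auto simp: top_unique)
    ultimately show ?thesis
    proof eventually_elim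
      fix \<omega>
      assume D: "\<forall>S\<in>Pow L. \<forall>x. (\<forall>l\<in>insert t S. (\<Sum>k\<in>multi_idx n ((B(t := U S)) l). (x l k)\<^sup>2) \<le> p) \<longrightarrow>
           (\<Sum>i\<in>A. (c i \<omega> * v (\<omega> (i j, j))) * (\<Prod>l\<in>insert t S. x l (restrict i ((B(t := U S)) l)))) \<le> R S \<omega>"
        and Zfin: "Z \<omega> \<noteq> \<infinity>"
      show "\<forall>x. (\<forall>l\<in>L. (\<Sum>k\<in>multi_idx n (B l). (x l k)\<^sup>2) \<le> p) \<longrightarrow>
           (\<Sum>i\<in>A. (c i \<omega> * Y (\<omega> (i j, j))) * (\<Prod>l\<in>L. x l (restrict i (B l)))) \<le> R' \<omega>"
      proof (intro allI impI)
        fix x :: "'l \<Rightarrow> (nat \<Rightarrow> nat) \<Rightarrow> real"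
        assume x: "\<forall>l\<in>L. (\<Sum>k\<in>multi_idx n (B l). (x l k)\<^sup>2) \<le> p"
        define w where "w i = c i \<omega> * v (\<omega> (i j, j))" for i
        define F where "F = (\<Sum>i\<in>A. (c i \<omega> * Y (\<omega> (i j, j))) * (\<Prod>l\<in>L. x l (restrict i (B l))))"
        define h where "h S m = (\<Sum>i\<in>{i\<in>A. restrict i (U S) = m}. w i * (\<Prod>l\<in>S. x l (restrict i (B l))))" for S m
        \<comment> \<open>Pairing \<open>h S\<close> with an array \<open>z\<close> on the merged
          block gives a form of the family covered by \<open>dom\<close>, with \<open>z\<close> as
          the array labelled \<open>t\<close>; duality then returns the squared norm.\<close>
        have hS: "p * (\<Sum>m\<in>multi_idx n (U S). (h S m)\<^sup>2) \<le> (R S \<omega>)\<^sup>2" if S: "S \<subseteq> L" for S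
        proof (rule power2_sum_le_of_duality)
          fix z :: "(nat \<Rightarrow> nat) \<Rightarrow> real" assume z: "(\<Sum>k\<in>multi_idx n (U S). (z k)\<^sup>2) \<le> p"
          have tS: "t \<notin> S" using S L by auto
          have "(\<Sum>m\<in>multi_idx n (U S). z m * h S m)
              = (\<Sum>m\<in>multi_idx n (U S). \<Sum>i\<in>{i\<in>A. restrict i (U S) = m}.
                  w i * (z (restrict i (U S)) * (\<Prod>l\<in>S. x l (restrict i (B l)))))"
            unfolding h_def sum_distrib_left by (intro sum.cong) (auto simp: mult_ac)
          also have "\<dots> = (\<Sum>i\<in>A. w i * (z (restrict i (U S)) * (\<Prod>l\<in>S. x l (restrict i (B l)))))"
            using finA finite_subset[OF US]
            by (intro sum.group) (auto simp: A_def intro: restrict_multi_idx[OF _ US])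
          also have "\<dots> = (\<Sum>i\<in>A. w i * (\<Prod>l\<in>insert t S. (x(t := z)) l (restrict i ((B(t := U S)) l))))"
          proof (intro sum.cong refl arg_cong2[where f = times])
            fix i
            have "(\<Prod>l\<in>S. (x(t := z)) l (restrict i ((B(t := U S)) l))) = (\<Prod>l\<in>S. x l (restrict i (B l)))"
              using tS by (intro prod.cong) auto
            then show "z (restrict i (U S)) * (\<Prod>l\<in>S. x l (restrict i (B l)))
                = (\<Prod>l\<in>insert t S. (x(t := z)) l (restrict i ((B(t := U S)) l)))"
              using tS finite_subset[OF S L(1)] by simp
          qed
          also have "\<dots> \<le> R S \<omega>"
            unfolding w_def using S x z tS
            by (intro D[rule_format]) (auto simp: subset_iff)
          finally show "(\<Sum>m\<in>multi_idx n (U S). z m * h S m) \<le> R S \<omega>" .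
        qed (use p R(2) S in auto)
        have hsum: "(\<Sum>S\<in>Pow L. \<Sum>m\<in>multi_idx n (U S). (h S m)\<^sup>2) \<le> (\<Sum>S\<in>Pow L. (R S \<omega>)\<^sup>2) / p"
          unfolding sum_divide_distrib
          using hS p by (intro sum_mono) (auto simp: le_divide_eq mult.commute)
        define X where "X = (\<Sum>c\<in>Sigma L K. (x (fst c) (snd c))\<^sup>2)"
        have X: "X \<le> real (card L) * p"
        proof -
          have "X = (\<Sum>l\<in>L. \<Sum>k\<in>K l. (x l k)\<^sup>2)"
            unfolding X_def using L finK by (subst sum.Sigma) (auto simp: case_prod_unfold)
          also have "\<dots> \<le> real (card L) * p" using x unfolding K_def by (intro sum_bounded_above) auto
          finally show ?thesis .
        qed
        have key: "restrict i (U S) = restrict i' (U S) \<longleftrightarrow>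
            i j = i' j \<and> (\<forall>l\<in>L - S. restrict i (B l) = restrict i' (B l))" for S and i i' :: "nat \<Rightarrow> nat"
          by (auto simp: U_def restrict_def fun_eq_iff)
        have "ennreal (exp (\<theta> * F - \<theta>\<^sup>2 * (\<Sum>S\<in>Pow L. \<Sum>m\<in>multi_idx n (U S). (h S m)\<^sup>2) - X / 2)) \<le> Z \<omega>"
          unfolding F_def h_def X_def Z_def e_def w_def
          using gaussian_pac_bayes[of A L K "\<lambda>l i. restrict i (B l)" "{1..n}" "\<lambda>i. i j"
              "\<lambda>S. multi_idx n (U S)" "\<lambda>S i. restrict i (U S)" \<theta> "\<lambda>i. c i \<omega> * Y (\<omega> (i j, j))"
              "\<lambda>c. x (fst c) (snd c)" "\<lambda>i. c i \<omega> * v (\<omega> (i j, j))", OF finA L(1) finK rest]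
            ij key finite_subset[OF US] restrict_multi_idx[OF _ US]
          by (auto simp: A_def image_subset_iff)
        also have "Z \<omega> = ennreal (enn2real (Z \<omega>))" using Zfin by (simp add: less_top)
        finally have le: "exp (\<theta> * F - \<theta>\<^sup>2 * (\<Sum>S\<in>Pow L. \<Sum>m\<in>multi_idx n (U S). (h S m)\<^sup>2) - X / 2) \<le> enn2real (Z \<omega>)"
          by (simp add: ennreal_le_iff)
        then have "exp (\<theta> * F - \<theta>\<^sup>2 * (\<Sum>S\<in>Pow L. \<Sum>m\<in>multi_idx n (U S). (h S m)\<^sup>2) - X / 2) \<le> max 1 (enn2real (Z \<omega>))"
          by simp
        then have "\<theta> * F - \<theta>\<^sup>2 * (\<Sum>S\<in>Pow L. \<Sum>m\<in>multi_idx n (U S). (h S m)\<^sup>2) - X / 2 \<le> ln (max 1 (enn2real (Z \<omega>)))"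
          by (subst ln_ge_iff) auto
        moreover have "\<theta>\<^sup>2 * (\<Sum>S\<in>Pow L. \<Sum>m\<in>multi_idx n (U S). (h S m)\<^sup>2) \<le> \<theta>\<^sup>2 * ((\<Sum>S\<in>Pow L. (R S \<omega>)\<^sup>2) / p)"
          using hsum by (intro mult_left_mono) auto
        ultimately have "\<theta> * F \<le> real (card L) * p / 2 + ln (max 1 (enn2real (Z \<omega>))) + \<theta>\<^sup>2 * ((\<Sum>S\<in>Pow L. (R S \<omega>)\<^sup>2) / p)"
          using X by linarith
        then have "r / p * (\<theta> * F) \<le> r / p * (real (card L) * p / 2 + ln (max 1 (enn2real (Z \<omega>))) + \<theta>\<^sup>2 * ((\<Sum>S\<in>Pow L. (R S \<omega>)\<^sup>2) / p))"
          using r p by (intro mult_left_mono) auto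
        also have "r / p * (\<theta> * F) = F" using r p by (simp add: \<theta>_def)
        also have "r / p * (real (card L) * p / 2 + ln (max 1 (enn2real (Z \<omega>))) + \<theta>\<^sup>2 * ((\<Sum>S\<in>Pow L. (R S \<omega>)\<^sup>2) / p)) = R' \<omega>"
          using r p by (simp add: R'_def \<theta>_def power2_eq_square distrib_left sum_divide_distrib[symmetric])
        finally show "(\<Sum>i\<in>A. (c i \<omega> * Y (\<omega> (i j, j))) * (\<Prod>l\<in>L. x l (restrict i (B l)))) \<le> R' \<omega>"
          unfolding F_def .
      qed
    qed
  qed
  ultimately show ?thesis unfolding moment_dominated_def A_def by blast
qed

section \<open>Coverings of multiplicity at most two and merging of blocks\<close>

definition covering :: "nat set \<Rightarrow> 'l set \<Rightarrow> ('l \<Rightarrow> nat set) \<Rightarrow> bool" where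
  "covering Q L B \<longleftrightarrow> finite L \<and> (\<forall>l\<in>L. B l \<noteq> {} \<and> B l \<subseteq> Q) \<and> (\<forall>j\<in>Q. card {l \<in> L. j \<in> B l} \<in> {1, 2})"

text \<open>If the merged block contains \<open>i\<close> and \<open>i\<close> differs from
  \<open>j\<close>, then at least one label counted for \<open>i\<close> has been absorbed, which
  pays for the new label \<open>t\<close>. Only \<open>j\<close> can gain a block. Nothing loses its
  last block, since an absorbed block lives on inside \<open>t\<close>.\<close>

lemma merge_count:
  fixes B :: "'l \<Rightarrow> 'a set" and i j :: 'a
  assumes L: "finite L" "t \<notin> L" "S \<subseteq> L"
  defines "B' \<equiv> B(t := insert j (\<Union>l\<in>L - S. B l))"
  shows "i \<noteq> j \<Longrightarrow> card {l \<in> insert t S. i \<in> B' l} \<le> card {l \<in> L. i \<in> B l}"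
    and "card {l \<in> insert t S. j \<in> B' l} \<le> card {l \<in> L. j \<in> B l} + 1"
    and "1 \<le> card {l \<in> insert t S. j \<in> B' l}"
    and "1 \<le> card {l \<in> L. i \<in> B l} \<Longrightarrow> 1 \<le> card {l \<in> insert t S. i \<in> B' l}"
proof -
  have fS: "finite S" using L finite_subset by blast
  have B'S: "B' l = B l" if "l \<in> S" for l using that L by (auto simp: B'_def)
  show "card {l \<in> insert t S. i \<in> B' l} \<le> card {l \<in> L. i \<in> B l}" if ij: "i \<noteq> j"
  proof (cases "i \<in> B' t")
    case True
    then obtain l0 where l0: "l0 \<in> L - S" "i \<in> B l0" using ij by (auto simp: B'_def)
    have "{l \<in> insert t S. i \<in> B' l} \<subseteq> insert t ({l \<in> L. i \<in> B l} - {l0})"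
      using B'S L l0 by auto
    then have "card {l \<in> insert t S. i \<in> B' l} \<le> card (insert t ({l \<in> L. i \<in> B l} - {l0}))"
      using L by (intro card_mono) auto
    also have "\<dots> = Suc (card ({l \<in> L. i \<in> B l} - {l0}))" using L by (subst card_insert_disjoint) auto
    also have "\<dots> = card {l \<in> L. i \<in> B l}" using L l0 by (intro card_Suc_Diff1) auto
    finally show ?thesis .
  next
    case False
    then have "{l \<in> insert t S. i \<in> B' l} \<subseteq> {l \<in> L. i \<in> B l}" using B'S L by auto
    then show ?thesis using L by (intro card_mono) auto
  qed
  have "{l \<in> insert t S. j \<in> B' l} \<subseteq> insert t {l \<in> L. j \<in> B l}" using B'S L by auto
  then have "card {l \<in> insert t S. j \<in> B' l} \<le> card (insert t {l \<in> L. j \<in> B l})"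
    using L by (intro card_mono) auto
  also have "\<dots> = card {l \<in> L. j \<in> B l} + 1" using L by (subst card_insert_disjoint) auto
  finally show "card {l \<in> insert t S. j \<in> B' l} \<le> card {l \<in> L. j \<in> B l} + 1" .
  have ge: "1 \<le> card {l \<in> insert t S. i \<in> B' l}" if "l \<in> insert t S" "i \<in> B' l" for i l
  proof -
    have "{l \<in> insert t S. i \<in> B' l} \<noteq> {}" using that by blast
    then show ?thesis using fS by (simp add: Suc_le_eq card_gt_0_iff)
  qed
  show "1 \<le> card {l \<in> insert t S. j \<in> B' l}"
    by (rule ge[of t]) (auto simp: B'_def)
  show "1 \<le> card {l \<in> insert t S. i \<in> B' l}" if "1 \<le> card {l \<in> L. i \<in> B l}"
  proof -
    have "{l \<in> L. i \<in> B l} \<noteq> {}" using that by (metis card.empty not_one_le_zero)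
    then obtain l where l: "l \<in> L" "i \<in> B l" by blast
    show ?thesis
    proof (cases "l \<in> S")
      case True
      then show ?thesis using l B'S by (intro ge[of l]) auto
    next
      case False
      then show ?thesis using l by (intro ge[of t]) (auto simp: B'_def)
    qed
  qed
qed

text \<open>The two merges belong to the two steps for column \<open>j\<close>. This coordinate
  starts in no block and gains at most one each time, so it ends with multiplicity one or two; all
  other multiplicities stay in that range.\<close>

lemma covering_merge_twice:
  assumes cov: "covering Q L B" and j: "j \<notin> Q" and t: "t \<notin> L" and S: "S \<subseteq> L"
    and t': "t' \<notin> insert t S" and S': "S' \<subseteq> insert t S"
  defines "B1 \<equiv> B(t := insert j (\<Union>l\<in>L - S. B l))"
  defines "B2 \<equiv> B1(t' := insert j (\<Union>l\<in>insert t S - S'. B1 l))"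
  shows "covering (insert j Q) (insert t' S') B2"
proof -
  have L: "finite L" using cov by (simp add: covering_def)
  have L1: "finite (insert t S)" using L S finite_subset by blast
  note m1 = merge_count[OF L t S, where B = B and j = j, folded B1_def]
  note m2 = merge_count[OF L1 t' S', where B = B1 and j = j, folded B2_def]
  have B1: "B1 l \<noteq> {} \<and> B1 l \<subseteq> insert j Q" if "l \<in> insert t S" for l
    using that cov S by (auto simp: B1_def covering_def)
  have B2: "B2 l \<noteq> {} \<and> B2 l \<subseteq> insert j Q" if "l \<in> insert t' S'" for l
  proof (cases "l = t'")
    case True
    then show ?thesis using B1 by (auto simp: B2_def)
  next
    case False
    then show ?thesis using that B1[of l] S' by (auto simp: B2_def)
  qed
  have "card {l \<in> insert t' S'. i \<in> B2 l} \<in> {1, 2}" if i: "i \<in> insert j Q" for i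
  proof (cases "i = j")
    case True
    have "{l \<in> L. j \<in> B l} = {}" using cov j by (auto simp: covering_def)
    then have "card {l \<in> L. j \<in> B l} = 0" by (simp only: card.empty)
    then have "card {l \<in> insert t S. j \<in> B1 l} \<le> 1" using m1(2) by linarith
    then show ?thesis using m2(2,3) True by auto
  next
    case False
    then have "card {l \<in> L. i \<in> B l} \<in> {1, 2}" using i cov by (auto simp: covering_def)
    then show ?thesis using m1(1)[OF False] m1(4)[of i] m2(1)[OF False] m2(4)[of i] by auto
  qed
  then show ?thesis
    using B2 finite_subset[OF S' L1] unfolding covering_def by blast
qed

text \<open>The factor lost in \<open>moment_dominated_step\<close> with
  \<open>\<kappa> = 2 * d\<close> and \<open>Q = 2 * 4 ^ d\<close>, bounds on the number of arrays
  and on the ratio of moment order to \<open>p\<close> that hold throughout the induction.\<close>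

definition step_constant :: "nat \<Rightarrow> real" where
  "step_constant d = (2 + 2 ^ (2 * d)) * (real (2 * d) + 2 * (2 * 4 ^ d) + 2 ^ (2 * d))"

lemma step_constant_pos: "0 < step_constant d"
  unfolding step_constant_def by (intro mult_pos_pos add_pos_pos add_nonneg_pos) auto

text \<open>The factor \<open>v \<bar>X\<bar>\<close> left by the first step is not centred. As the
  block of \<open>t\<close> contains \<open>j\<close>, a sign depending on the entry in column
  \<open>j\<close> can be moved into the array \<open>x t\<close> without increasing its norm. The
  condition on \<open>v 0\<close> accounts for \<open>sgn 0 = 0\<close>.\<close>

lemma moment_dominated_sign:
  assumes t: "t \<in> L" and j: "j \<in> B t" and L: "finite L"
    and dom: "moment_dominated M n d p L B (\<lambda>i \<omega>. c i \<omega> * (sgn (\<omega> (i j, j)) * v \<bar>\<omega> (i j, j)\<bar>)) q r"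
    and v0: "v 0 = 0"
  shows "moment_dominated M n d p L B (\<lambda>i \<omega>. c i \<omega> * v \<bar>\<omega> (i j, j)\<bar>) q r"
proof (rule moment_dominated_mono[OF dom])
  fix x :: "'a \<Rightarrow> (nat \<Rightarrow> nat) \<Rightarrow> real" and \<omega> :: "nat \<times> nat \<Rightarrow> real"
  assume x: "\<forall>l\<in>L. (\<Sum>k\<in>multi_idx n (B l). (x l k)\<^sup>2) \<le> p"
  define y where "y l k = (if l = t then sgn (\<omega> (k j, j)) * x l k else x l k)" for l k
  have sq: "(sgn u)\<^sup>2 \<le> 1" for u :: real by (simp add: sgn_if)
  have "(\<Sum>k\<in>multi_idx n (B l). (y l k)\<^sup>2) \<le> (\<Sum>k\<in>multi_idx n (B l). (x l k)\<^sup>2)" for l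
    using sq by (intro sum_mono) (auto simp: y_def power_mult_distrib mult_left_le_one_le)
  then have "\<forall>l\<in>L. (\<Sum>k\<in>multi_idx n (B l). (y l k)\<^sup>2) \<le> p" using x order_trans by blast
  moreover have eq: "c i \<omega> * v \<bar>\<omega> (i j, j)\<bar> * (\<Prod>l\<in>L. x l (restrict i (B l)))
      = c i \<omega> * (sgn (\<omega> (i j, j)) * v \<bar>\<omega> (i j, j)\<bar>) * (\<Prod>l\<in>L. y l (restrict i (B l)))" for i
  proof -
    define u where "u = \<omega> (i j, j)"
    have "(\<Prod>l\<in>L - {t}. y l (restrict i (B l))) = (\<Prod>l\<in>L - {t}. x l (restrict i (B l)))"
      by (intro prod.cong) (auto simp: y_def)
    then have e: "(\<Prod>l\<in>L. y l (restrict i (B l))) = sgn u * (\<Prod>l\<in>L. x l (restrict i (B l)))"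
      unfolding prod.remove[OF L t] using j by (simp add: y_def u_def)
    have "sgn u * v \<bar>u\<bar> * sgn u = v \<bar>u\<bar>" using v0 by (auto simp: sgn_if)
    then show ?thesis unfolding e u_def[symmetric] by (auto simp: mult_ac)
  qed
  ultimately show "\<exists>y. (\<forall>l\<in>L. (\<Sum>k\<in>multi_idx n (B l). (y l k)\<^sup>2) \<le> p) \<and>
      (\<Sum>i\<in>multi_idx n {1..d}. c i \<omega> * v \<bar>\<omega> (i j, j)\<bar> * (\<Prod>l\<in>L. x l (restrict i (B l))))
      \<le> (\<Sum>i\<in>multi_idx n {1..d}. c i \<omega> * (sgn (\<omega> (i j, j)) * v \<bar>\<omega> (i j, j)\<bar>) * (\<Prod>l\<in>L. y l (restrict i (B l))))"
    by (intro exI[of _ y] conjI) (assumption, simp only: eq order_refl)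
qed

text \<open>Here \<open>j\<close> counts the columns that are still random, and the arrays live on
  the columns already removed. Removing a column introduces two labels, multiplies the moment order
  by four and costs two factors \<open>step_constant d\<close>. With no random column left, the
  claim is the deterministic bound for coverings.\<close>

lemma moment_dominated_iterate:
  fixes \<nu> :: "nat \<times> nat \<Rightarrow> real measure" and p r :: real and n d N :: nat
  defines "P \<equiv> PiM ({1..n} \<times> {1..d}) \<nu>"
  assumes \<nu>: "\<And>k. prob_space (\<nu> k)" and sets: "\<And>k. sets (\<nu> k) = sets borel"
    and law: "\<And>k. k \<in> {1..n} \<times> {1..d} \<Longrightarrow> symmetric_exponential_law (\<nu> k)"
    and p: "0 < p" and N: "0 < N" "real N \<le> 2 * p" and r: "0 < r"
    and det: "\<And>L B (x :: nat \<Rightarrow> _). covering {1..d} L B \<Longrightarrow> (\<And>l. l \<in> L \<Longrightarrow> (\<Sum>k\<in>multi_idx n (B l). (x l k)\<^sup>2) \<le> p) \<Longrightarrow>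
        (\<Sum>i\<in>multi_idx n {1..d}. a i * (\<Prod>l\<in>L. x l (restrict i (B l)))) \<le> r"
  assumes "j \<le> d" "covering {j+1..d} L B" "L \<subseteq> {..<2 * (d - j)}"
  shows "moment_dominated P n d p L B (\<lambda>i \<omega>. a i * (\<Prod>j'=1..j. \<omega> (i j', j') / 2)) (N * 4 ^ (d - j))
    (step_constant d ^ (2 * j) * r)"
  using assms(10-)
proof (induction j arbitrary: L B)
  case 0
  interpret P: prob_space P unfolding P_def by (rule prob_space_PiM) (rule \<nu>)
  have "covering {1..d} L B" using 0 by simp
  then have "\<forall>x. (\<forall>l\<in>L. (\<Sum>k\<in>multi_idx n (B l). (x l k)\<^sup>2) \<le> p) \<longrightarrow>
      (\<Sum>i\<in>multi_idx n {1..d}. a i * (\<Prod>l\<in>L. x l (restrict i (B l)))) \<le> r"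
    using det by blast
  then show ?case
    unfolding moment_dominated_def using r by (intro bexI[of _ "\<lambda>_. r"]) (auto simp: P.emeasure_space_1)
next
  case (Suc j)
  define J where "J = Suc j"
  \<comment> \<open>Labels below \<open>t\<close> may be in use by the columns already removed;
    \<open>t\<close> and \<open>t + 1\<close> are the fresh labels of the two steps.\<close>
  define t where "t = 2 * (d - J)"
  define q where "q = N * 4 ^ (d - J)"
  define C where "C = step_constant d"
  define r0 where "r0 = C ^ (2 * j) * r"
  define c where "c i \<omega> = a i * (\<Prod>j'=1..j. \<omega> (i j', j') / 2)" for i and \<omega> :: "nat \<times> nat \<Rightarrow> real"
  have C: "0 < C" unfolding C_def by (rule step_constant_pos)
  have J: "J \<in> {1..d}" using Suc.prems by (simp add: J_def)
  have cov: "covering {J+1..d} L B" and Lt: "L \<subseteq> {..<t}" using Suc.prems by (auto simp: J_def t_def)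
  have L: "finite L" using cov by (simp add: covering_def)
  have tt: "2 * (d - j) = t + 2" "d - j = Suc (d - J)" using J by (auto simp: t_def J_def)
  \<comment> \<open>The order reached after both steps is \<open>q * 4 = N * 4 ^ (d - j)\<close>,
    which explains the value \<open>2 * 4 ^ d\<close> of \<open>Q\<close>.\<close>
  have qq: "0 < q" "real q * 4 \<le> (2 * 4 ^ d) * p"
  proof -
    have "real q * 4 = real N * 4 ^ (d - j)" by (simp add: q_def tt)
    also have "\<dots> \<le> (2 * p) * 4 ^ d" using N p by (intro mult_mono power_increasing) auto
    finally show "real q * 4 \<le> (2 * 4 ^ d) * p" by (simp add: mult_ac)
  qed (use N in \<open>simp add: q_def\<close>)
  have td: "t + 2 \<le> 2 * d" using J by (auto simp: t_def)
  have cardL: "card L' \<le> 2 * d" if "L' \<subseteq> {..<t + 1}" for L'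
    using card_mono[OF _ that] td by simp
  have cm: "c i \<in> borel_measurable P" if i: "i \<in> multi_idx n {1..d}" for i
    unfolding c_def
  proof (intro borel_measurable_times borel_measurable_const borel_measurable_prod borel_measurable_divide)
    fix j' assume "j' \<in> {1..j}"
    then have "(i j', j') \<in> {1..n} \<times> {1..d}" using i J by (auto simp: multi_idx_def J_def)
    then have "(\<lambda>\<omega>. \<omega> (i j', j')) \<in> measurable P (\<nu> (i j', j'))"
      unfolding P_def by (rule measurable_component_singleton)
    then show "(\<lambda>\<omega>. \<omega> (i j', j')) \<in> borel_measurable P" by (simp add: sets cong: measurable_cong_sets)
  qed
  have ci: "c i \<omega> = c i \<omega>'" if i: "i \<in> multi_idx n {1..d}"
    and "\<And>k. k \<in> {1..n} \<times> {1..d} \<Longrightarrow> snd k \<noteq> J \<Longrightarrow> \<omega> k = \<omega>' k" for i \<omega> \<omega>'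
  proof -
    have "\<omega> (i j', j') = \<omega>' (i j', j')" if j': "j' \<in> {1..j}" for j'
      using i j' J \<open>\<And>k. k \<in> {1..n} \<times> {1..d} \<Longrightarrow> snd k \<noteq> J \<Longrightarrow> \<omega> k = \<omega>' k\<close>[of "(i j', j')"]
      by (auto simp: multi_idx_def J_def PiE_def Pi_def)
    then show ?thesis unfolding c_def by (intro arg_cong2[where f = times] prod.cong) auto
  qed
  note step = moment_dominated_step[where \<nu> = \<nu> and n = n and d = d and \<kappa> = "2 * d" and Q = "2 * 4 ^ d"
      and p = p and c = c and j = J, folded P_def step_constant_def, folded C_def,
      OF \<nu> sets _ _ _ _ J _ _ _ cm ci _ p]
  have BJ: "B l \<subseteq> {1..d}" if "l \<in> L" for l
  proof -
    have "B l \<subseteq> {J+1..d}" using cov that unfolding covering_def by blast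
    also have "\<dots> \<subseteq> {1..d}" by auto
    finally show ?thesis .
  qed
  \<comment> \<open>First step: \<open>X / 2\<close> is traded for its random variance proxy
    \<open>sqrt (\<bar>X\<bar> / 2)\<close>.\<close>
  have "moment_dominated P n d p L B (\<lambda>i \<omega>. c i \<omega> * (\<omega> (i J, J) / 2)) q (C * (C * r0))"
  proof (rule step[where v = "\<lambda>x. sqrt (\<bar>x\<bar> / 2)" and t = t])
    fix S assume S: "S \<subseteq> L"
    define B1 where "B1 = B(t := insert J (\<Union>l\<in>L - S. B l))"
    have St: "insert t S \<subseteq> {..<t + 1}" using S Lt by auto
    have B1: "B1 l \<subseteq> {1..d}" if "l \<in> insert t S" for l
      using that BJ S J by (auto simp: B1_def)
    have fin1: "finite (insert t S)" using S L finite_subset by blast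
    \<comment> \<open>Second step: with the sign restored the factor is centred, and its variance
      proxy 1 leaves nothing random in column \<open>J\<close>.\<close>
    have "moment_dominated P n d p (insert t S) B1
        (\<lambda>i \<omega>. c i \<omega> * (sgn (\<omega> (i J, J)) * sqrt (\<bar>\<omega> (i J, J)\<bar> / 2))) (2 * q) (C * r0)"
    proof (rule step[where Y = "\<lambda>x. sgn x * sqrt (\<bar>x\<bar> / 2)" and v = "\<lambda>_. 1" and t = "t + 1"])
      fix S' assume S': "S' \<subseteq> insert t S"
      have "t \<notin> L" using Lt by auto
      moreover have "t + 1 \<notin> insert t S" using S Lt by auto
      moreover have "J \<notin> {J+1..d}" by simp
      ultimately have "covering (insert J {J+1..d}) (insert (t + 1) S')
          (B1(t + 1 := insert J (\<Union>l\<in>insert t S - S'. B1 l)))"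
        unfolding B1_def by (intro covering_merge_twice cov S S')
      moreover have "insert J {J+1..d} = {j+1..d}" using J by (auto simp: J_def)
      moreover have "insert (t + 1) S' \<subseteq> {..<2 * (d - j)}" using order_trans[OF S' St] unfolding tt(1) by auto
      ultimately have "moment_dominated P n d p (insert (t + 1) S')
          (B1(t + 1 := insert J (\<Union>l\<in>insert t S - S'. B1 l))) c (N * 4 ^ (d - j)) r0"
        using Suc.IH[of "insert (t + 1) S'"] Suc.prems(1) unfolding c_def[abs_def] r0_def C_def by simp
      moreover have "N * 4 ^ (d - j) = 2 * (2 * q)" by (simp add: q_def tt)
      ultimately show "moment_dominated P n d p (insert (t + 1) S')
          (B1(t + 1 := insert J (\<Union>l\<in>insert t S - S'. B1 l))) (\<lambda>i \<omega>. c i \<omega> * 1) (2 * (2 * q)) r0"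
        by simp
    next
      show "self_normalized (\<nu> k) (\<lambda>x. sgn x * sqrt (\<bar>x\<bar> / 2)) (\<lambda>_. 1)" if "k \<in> {1..n} \<times> {1..d}" for k
        by (rule self_normalized_sqrt_exponential) (rule law[OF that])
      show "card (insert t S) \<le> 2 * d" by (rule cardL[OF St])
      show "t + 1 \<notin> insert t S" using S Lt by auto
      have "real (2 * q) \<le> real q * 4" by simp
      also note qq(2)
      finally show "real (2 * q) \<le> 2 * 4 ^ d * p" .
    qed (use fin1 B1 C r qq in \<open>auto simp: r0_def\<close>)
    then show "moment_dominated P n d p (insert t S) (B(t := insert J (\<Union>l\<in>L - S. B l)))
        (\<lambda>i \<omega>. c i \<omega> * sqrt (\<bar>\<omega> (i J, J)\<bar> / 2)) (2 * q) (C * r0)"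
      unfolding B1_def[symmetric]
      using fin1 by (intro moment_dominated_sign[where v = "\<lambda>u. sqrt (u / 2)" and t = t]) (auto simp: B1_def)
  next
    show "self_normalized (\<nu> k) (\<lambda>x. x / 2) (\<lambda>x. sqrt (\<bar>x\<bar> / 2))" if "k \<in> {1..n} \<times> {1..d}" for k
      by (rule self_normalized_exponential) (rule law[OF that])
    show "card L \<le> 2 * d" using Lt by (intro cardL) auto
    show "t \<notin> L" using Lt by auto
    have "real q \<le> real q * 4" by simp
    also note qq(2)
    finally show "real q \<le> 2 * 4 ^ d * p" .
  qed (use L BJ C r qq in \<open>auto simp: r0_def\<close>)
  moreover have "(\<Prod>j'=1..Suc j. \<omega> (i j', j') / 2) = (\<Prod>j'=1..j. \<omega> (i j', j') / 2) * (\<omega> (i J, J) / 2)"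
    for i and \<omega> :: "nat \<times> nat \<Rightarrow> real"
    by (simp add: J_def)
  ultimately show ?case
    using step_constant_pos[of d] by (simp add: c_def C_def q_def J_def r0_def mult.assoc)
qed

section \<open>The moment bound\<close>

lemma partition_norm_cong:
  assumes J: "partition_on {1..d} J"
    and N: "\<And>m j t. m \<in> {1..n} \<Longrightarrow> j \<in> {1..d} \<Longrightarrow> N m j t = N' m j t"
  shows "partition_norm n d N p J a = partition_norm n d N' p J a"
  unfolding partition_norm_def
proof (rule sum.cong[OF refl])
  fix s assume s: "s \<in> (\<Pi>\<^sub>E I\<in>J. I)"
  have "s I \<in> {1..d}" if "I \<in> J" for I
    using PiE_mem[OF s that] J that by (auto simp: partition_on_def)
  then have "(\<Sum>m=1..n. hat_fun (N m (s I)) (L2_set (x I) {k \<in> multi_idx n I. k (s I) = m}))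
      = (\<Sum>m=1..n. hat_fun (N' m (s I)) (L2_set (x I) {k \<in> multi_idx n I. k (s I) = m}))"
    if "I \<in> J" for I and x :: "nat set \<Rightarrow> (nat \<Rightarrow> nat) \<Rightarrow> real"
    using that by (intro sum.cong) (auto simp: hat_fun_def N)
  then show "(SUP x\<in>{x. \<forall>I\<in>J. (\<Sum>m=1..n. hat_fun (N m (s I)) (L2_set (x I) {k \<in> multi_idx n I. k (s I) = m})) \<le> p}.
        \<Sum>i\<in>multi_idx n {1..d}. a i * (\<Prod>I\<in>J. x I (restrict i I)))
      = (SUP x\<in>{x. \<forall>I\<in>J. (\<Sum>m=1..n. hat_fun (N' m (s I)) (L2_set (x I) {k \<in> multi_idx n I. k (s I) = m})) \<le> p}.
        \<Sum>i\<in>multi_idx n {1..d}. a i * (\<Prod>I\<in>J. x I (restrict i I)))"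
    by simp
qed

text \<open>The iteration starts with no arrays, where the supremum is the chaos itself divided by
  \<open>2 ^ d\<close>. Using it for the coefficients and their negatives controls the absolute
  value. A strictly positive \<open>r\<close> is required by the choice of \<theta> in the
  steps.\<close>

lemma exponential_chaos_moment_bound:
  fixes \<nu> :: "nat \<times> nat \<Rightarrow> real measure" and p r :: real and n d :: nat and a :: "(nat \<Rightarrow> nat) \<Rightarrow> real"
  defines "P \<equiv> PiM ({1..n} \<times> {1..d}) \<nu>"
  defines "F \<equiv> chaos n d a (\<lambda>i j \<omega>. \<omega> (i, j))"
  assumes \<nu>: "\<And>k. prob_space (\<nu> k)" and sets: "\<And>k. sets (\<nu> k) = sets borel"
    and law: "\<And>k. k \<in> {1..n} \<times> {1..d} \<Longrightarrow> symmetric_exponential_law (\<nu> k)"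
    and tail: "\<And>m j t. m \<in> {1..n} \<Longrightarrow> j \<in> {1..d} \<Longrightarrow> t > 0 \<Longrightarrow> T m j t = t"
    and p: "2 \<le> p" and d: "1 \<le> d"
    and r: "0 < r" "(\<Sum>J | partition_on {1..d} J. partition_norm n d T p J a) \<le> r"
  shows "integrable P (\<lambda>\<omega>. \<bar>F \<omega>\<bar> powr p)"
    and "Lp_norm P p F \<le> 3 * 2 ^ d * step_constant d ^ (2 * d) * r"
proof -
  interpret P: prob_space P unfolding P_def by (rule prob_space_PiM) (rule \<nu>)
  \<comment> \<open>The powers in \<open>moment_dominated\<close> are natural numbers, so
    \<open>p\<close> is rounded up, which at most doubles it.\<close>
  define N where "N = nat \<lceil>p\<rceil>"
  define C where "C = step_constant d ^ (2 * d) * r"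
  define D where "D = 2 ^ d * C"
  have C: "0 < C" using step_constant_pos[of d] r by (simp add: C_def)
  then have D: "0 < D" by (simp add: D_def)
  have N: "p \<le> real N" "0 < N" "real N \<le> 2 * p"
    using p unfolding N_def by linarith+
  have det: "(\<Sum>i\<in>multi_idx n {1..d}. (s * a i) * (\<Prod>l\<in>L. x l (restrict i (B l)))) \<le> r"
    if cov: "covering {1..d} L B" and x: "\<And>l. l \<in> L \<Longrightarrow> (\<Sum>k\<in>multi_idx n (B l). (x l k)\<^sup>2) \<le> p"
      and s: "\<bar>s\<bar> = 1" for L B s and x :: "nat \<Rightarrow> _"
  proof -
    \<comment> \<open>A covering has no empty blocks, so the bound for shared blocks may be started
      without fixed coordinates.\<close>
    have "\<bar>\<Sum>i\<in>multi_idx n {1..d}. a i * (if \<forall>j\<in>{}. i j = undefined j then 1 else 0) * (\<Prod>l\<in>L. x l (restrict i (B l)))\<bar>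
        \<le> (\<Sum>J | partition_on {1..d} J. partition_norm n d T p J a)"
      using p d cov x by (intro shared_blocks_bound[OF tail]) (auto simp: covering_def)
    also note r(2)
    finally have "\<bar>\<Sum>i\<in>multi_idx n {1..d}. a i * (\<Prod>l\<in>L. x l (restrict i (B l)))\<bar> \<le> r" by simp
    moreover have "(\<Sum>i\<in>multi_idx n {1..d}. (s * a i) * (\<Prod>l\<in>L. x l (restrict i (B l))))
        = s * (\<Sum>i\<in>multi_idx n {1..d}. a i * (\<Prod>l\<in>L. x l (restrict i (B l))))"
      by (simp add: sum_distrib_left mult.assoc)
    ultimately show ?thesis using s by (cases "s \<ge> 0") auto
  qed
  have dom: "moment_dominated P n d p ({} :: nat set) (\<lambda>_. {}) (\<lambda>i \<omega>. (s * a i) * (\<Prod>j=1..d. \<omega> (i j, j) / 2)) N C"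
    if s: "\<bar>s\<bar> = 1" for s
    using moment_dominated_iterate[where \<nu> = \<nu> and j = d and L = "{}" and B = "\<lambda>_. {}",
        OF \<nu> sets law _ N(2,3) r(1) det[OF _ _ s]] p
    by (simp add: P_def C_def covering_def)
  have Feq: "(\<Sum>i\<in>multi_idx n {1..d}. (s * a i) * (\<Prod>j=1..d. \<omega> (i j, j) / 2)) = s * (F \<omega> / 2 ^ d)" for s \<omega>
    by (simp add: F_def chaos_def prod_dividef sum_distrib_left sum_divide_distrib mult.assoc)
  have "\<exists>R\<in>borel_measurable P. (\<forall>\<omega>. 0 \<le> R \<omega>) \<and> (AE \<omega> in P. s * (F \<omega> / 2 ^ d) \<le> R \<omega>) \<and>
      (\<integral>\<^sup>+\<omega>. ennreal (R \<omega> ^ N) \<partial>P) \<le> ennreal (C ^ N)" if s: "\<bar>s\<bar> = 1" for s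
    using dom[OF s] unfolding moment_dominated_def
    by (simp only: prod.empty mult_1_right Feq) simp
  from this[of 1] this[of "-1"] obtain R1 R2 where
    m[measurable]: "R1 \<in> borel_measurable P" "R2 \<in> borel_measurable P"
    and R0: "\<And>\<omega>. 0 \<le> R1 \<omega>" "\<And>\<omega>. 0 \<le> R2 \<omega>"
    and ae: "AE \<omega> in P. F \<omega> / 2 ^ d \<le> R1 \<omega>" "AE \<omega> in P. - (F \<omega> / 2 ^ d) \<le> R2 \<omega>"
    and R: "(\<integral>\<^sup>+\<omega>. ennreal (R1 \<omega> ^ N) \<partial>P) \<le> ennreal (C ^ N)" "(\<integral>\<^sup>+\<omega>. ennreal (R2 \<omega> ^ N) \<partial>P) \<le> ennreal (C ^ N)"
    by auto
  have Fm[measurable]: "F \<in> borel_measurable P"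
    unfolding F_def chaos_def[abs_def]
  proof (intro borel_measurable_times borel_measurable_const borel_measurable_prod borel_measurable_sum)
    fix i j assume "i \<in> multi_idx n {1..d}" "j \<in> {1..d}"
    then have "(i j, j) \<in> {1..n} \<times> {1..d}" by (auto simp: multi_idx_def)
    then have "(\<lambda>\<omega>. \<omega> (i j, j)) \<in> measurable P (\<nu> (i j, j))"
      unfolding P_def by (rule measurable_component_singleton)
    then show "(\<lambda>\<omega>. \<omega> (i j, j)) \<in> borel_measurable P" by (simp add: sets cong: measurable_cong_sets)
  qed
  have enn: "ennreal (x * (1 + c * (a + b))) = ennreal x * (1 + ennreal c * (ennreal a + ennreal b))"
    if "0 \<le> x" "0 \<le> c" "0 \<le> a" "0 \<le> b" for x a b c :: real
    using that by (simp add: ennreal_mult ennreal_plus)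
  have pw: "AE \<omega> in P. ennreal (\<bar>F \<omega>\<bar> powr p)
      \<le> ennreal (D powr p) * (1 + ennreal (1 / C ^ N) * (ennreal (R1 \<omega> ^ N) + ennreal (R2 \<omega> ^ N)))"
    using ae
  proof eventually_elim
    fix \<omega> assume 1: "F \<omega> / 2 ^ d \<le> R1 \<omega>" "- (F \<omega> / 2 ^ d) \<le> R2 \<omega>"
    define u where "u = \<bar>F \<omega>\<bar> / D"
    have u0: "0 \<le> u" using D by (simp add: u_def)
    \<comment> \<open>The 1 covers the values of \<open>u\<close> below 1, where the larger exponent
      would be of no use. Together with the two majorants it gives the constant 3.\<close>
    have "u powr p \<le> 1 + u ^ N"
    proof (cases "u \<le> 1")
      case True
      then have "u powr p \<le> 1 powr p" using u0 p by (intro powr_mono2) auto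
      then show ?thesis using u0 by (simp add: add_increasing2)
    next
      case False
      then have "u powr p \<le> u powr real N" using N by (intro powr_mono) auto
      then show ?thesis using False by (simp add: powr_realpow)
    qed
    also have "u ^ N \<le> 1 / C ^ N * (R1 \<omega> ^ N + R2 \<omega> ^ N)"
    proof -
      have "u = \<bar>F \<omega> / 2 ^ d\<bar> / C" by (simp add: u_def D_def abs_divide)
      then have "u ^ N = 1 / C ^ N * \<bar>F \<omega> / 2 ^ d\<bar> ^ N" by (simp only: power_divide[of _ C]) simp
      also have "\<bar>F \<omega> / 2 ^ d\<bar> ^ N \<le> R1 \<omega> ^ N + R2 \<omega> ^ N"
      proof (cases "0 \<le> F \<omega>")
        case True
        then have "\<bar>F \<omega> / 2 ^ d\<bar> ^ N \<le> R1 \<omega> ^ N" using 1 by (intro power_mono) auto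
        then show ?thesis using R0(2)[of \<omega>] zero_le_power[of "R2 \<omega>" N] by linarith
      next
        case False
        then have "\<bar>F \<omega> / 2 ^ d\<bar> ^ N \<le> R2 \<omega> ^ N"
          using 1 by (intro power_mono) (auto simp: divide_nonpos_pos)
        then show ?thesis using R0(1)[of \<omega>] zero_le_power[of "R1 \<omega>" N] by linarith
      qed
      then have "1 / C ^ N * \<bar>F \<omega> / 2 ^ d\<bar> ^ N \<le> 1 / C ^ N * (R1 \<omega> ^ N + R2 \<omega> ^ N)"
        using C by (intro mult_left_mono) auto
      finally show ?thesis .
    qed
    finally have "u powr p \<le> 1 + 1 / C ^ N * (R1 \<omega> ^ N + R2 \<omega> ^ N)" by simp
    then have "D powr p * u powr p \<le> D powr p * (1 + 1 / C ^ N * (R1 \<omega> ^ N + R2 \<omega> ^ N))"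
      by (intro mult_left_mono) auto
    moreover have "D powr p * u powr p = \<bar>F \<omega>\<bar> powr p"
      using D u0 by (simp add: u_def flip: powr_mult)
    ultimately have "ennreal (\<bar>F \<omega>\<bar> powr p) \<le> ennreal (D powr p * (1 + 1 / C ^ N * (R1 \<omega> ^ N + R2 \<omega> ^ N)))"
      by (simp add: ennreal_leI)
    also have "\<dots> = ennreal (D powr p) * (1 + ennreal (1 / C ^ N) * (ennreal (R1 \<omega> ^ N) + ennreal (R2 \<omega> ^ N)))"
      using R0 C by (intro enn) auto
    finally show "ennreal (\<bar>F \<omega>\<bar> powr p)
      \<le> ennreal (D powr p) * (1 + ennreal (1 / C ^ N) * (ennreal (R1 \<omega> ^ N) + ennreal (R2 \<omega> ^ N)))" .
  qed
  have "(\<integral>\<^sup>+\<omega>. ennreal (\<bar>F \<omega>\<bar> powr p) \<partial>P)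
      \<le> (\<integral>\<^sup>+\<omega>. ennreal (D powr p) * (1 + ennreal (1 / C ^ N) * (ennreal (R1 \<omega> ^ N) + ennreal (R2 \<omega> ^ N))) \<partial>P)"
    by (rule nn_integral_mono_AE[OF pw])
  also have "\<dots> = ennreal (D powr p) * (1 + ennreal (1 / C ^ N) *
      ((\<integral>\<^sup>+\<omega>. ennreal (R1 \<omega> ^ N) \<partial>P) + (\<integral>\<^sup>+\<omega>. ennreal (R2 \<omega> ^ N) \<partial>P)))"
    by (simp add: nn_integral_cmult nn_integral_add P.emeasure_space_1)
  also have "\<dots> \<le> ennreal (D powr p) * (1 + ennreal (1 / C ^ N) * (ennreal (C ^ N) + ennreal (C ^ N)))"
    using R by (intro mult_left_mono add_mono) auto
  also have "\<dots> = ennreal (D powr p * (1 + 1 / C ^ N * (C ^ N + C ^ N)))"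
    using C by (intro enn[symmetric]) auto
  also have "D powr p * (1 + 1 / C ^ N * (C ^ N + C ^ N)) = 3 * D powr p"
    using C by simp
  finally have le: "(\<integral>\<^sup>+\<omega>. ennreal (\<bar>F \<omega>\<bar> powr p) \<partial>P) \<le> ennreal (3 * D powr p)" .
  then show int: "integrable P (\<lambda>\<omega>. \<bar>F \<omega>\<bar> powr p)"
    by (intro integrableI_nonneg) (auto intro: order_le_less_trans)
  have "(\<integral>\<omega>. \<bar>F \<omega>\<bar> powr p \<partial>P) \<le> 3 * D powr p"
    using le int by (simp add: nn_integral_eq_integral ennreal_le_iff)
  then have "Lp_norm P p F \<le> (3 * D powr p) powr (1 / p)"
    unfolding Lp_norm_def using p by (intro powr_mono2) auto
  also have "\<dots> = 3 powr (1 / p) * D" using D p by (simp add: powr_mult powr_powr)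
  also have "\<dots> \<le> 3 * D"
    using D p powr_mono[of "1 / p" 1 3] by (intro mult_right_mono) auto
  finally show "Lp_norm P p F \<le> 3 * 2 ^ d * step_constant d ^ (2 * d) * r"
    by (simp add: D_def C_def mult_ac)
qed

section \<open>Passage to the coordinate process on a product space\<close>

definition entry_law :: "'a measure \<Rightarrow> nat \<Rightarrow> nat \<Rightarrow> (nat \<Rightarrow> nat \<Rightarrow> 'a \<Rightarrow> real) \<Rightarrow> nat \<times> nat \<Rightarrow> real measure" where
  "entry_law M n d X k = (if k \<in> {1..n} \<times> {1..d} then distr M borel (X (fst k) (snd k)) else return borel 0)"

definition entries :: "nat \<Rightarrow> nat \<Rightarrow> (nat \<Rightarrow> nat \<Rightarrow> 'a \<Rightarrow> real) \<Rightarrow> 'a \<Rightarrow> nat \<times> nat \<Rightarrow> real" where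
  "entries n d X \<omega> = (\<lambda>k\<in>{1..n} \<times> {1..d}. X (fst k) (snd k) \<omega>)"

lemma sets_entry_law: "sets (entry_law M n d X k) = sets borel"
  by (simp add: entry_law_def)

lemma tail_fun_distr:
  assumes "Y \<in> borel_measurable M"
  shows "tail_fun M Y t = - ln (measure (distr M borel Y) {x. t \<le> \<bar>x\<bar>})"
proof -
  have "measure (distr M borel Y) {x. t \<le> \<bar>x\<bar>} = measure M (Y -` {x. t \<le> \<bar>x\<bar>} \<inter> space M)"
    using assms by (intro measure_distr) auto
  also have "Y -` {x. t \<le> \<bar>x\<bar>} \<inter> space M = {\<omega> \<in> space M. t \<le> \<bar>Y \<omega>\<bar>}" by auto
  finally show ?thesis by (simp add: tail_fun_def)
qed

lemma symmetric_exponential_law_distr: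
  assumes "prob_space M" and Y[measurable]: "Y \<in> borel_measurable M"
    and sym: "distr M borel Y = distr M borel (\<lambda>\<omega>. - Y \<omega>)" and tail: "\<forall>t>0. tail_fun M Y t = t"
  shows "symmetric_exponential_law (distr M borel Y)"
  unfolding symmetric_exponential_law_def
proof (intro conjI allI impI)
  interpret prob_space M by fact
  show "prob_space (distr M borel Y)" by (rule prob_space_distr) fact
  show "distr (distr M borel Y) borel uminus = distr M borel Y"
    unfolding sym by (subst sym[symmetric]) (simp add: distr_distr comp_def)
  fix t :: real assume t: "0 < t"
  define m where "m = measure (distr M borel Y) {x. t \<le> \<bar>x\<bar>}"
  have "- ln m = t" using tail t tail_fun_distr[OF Y, of t] by (simp add: m_def)
  moreover have "0 \<le> m" by (simp add: m_def)
  \<comment> \<open>If \<open>m\<close> were 0, the convention \<open>ln 0 = 0\<close> would force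
    \<open>t = 0\<close>.\<close>
  ultimately have "0 < m" using t by (cases "m = 0") auto
  then show "measure (distr M borel Y) {x. t \<le> \<bar>x\<bar>} = exp (- t)"
    using \<open>- ln m = t\<close> unfolding m_def[symmetric] by (metis exp_ln minus_minus)
qed simp

context
  fixes M :: "'a measure" and n d :: nat and X :: "nat \<Rightarrow> nat \<Rightarrow> 'a \<Rightarrow> real"
  assumes fam: "symmetric_exponential_family M n d X" and nd: "1 \<le> n" "1 \<le> d"
begin

lemma family_prob_space: "prob_space M"
  using fam by (simp add: symmetric_exponential_family_def)

lemma family_measurable: "k \<in> {1..n} \<times> {1..d} \<Longrightarrow> X (fst k) (snd k) \<in> borel_measurable M"
  using fam prob_space.indep_vars_def2[OF family_prob_space, of "\<lambda>_. borel" "\<lambda>(i, j). X i j" "{1..n} \<times> {1..d}"]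
  unfolding symmetric_exponential_family_def by auto

lemma family_entry_law: "k \<in> {1..n} \<times> {1..d} \<Longrightarrow> symmetric_exponential_law (entry_law M n d X k)"
  using fam family_measurable[of k] unfolding entry_law_def
  by (auto simp: symmetric_exponential_family_def intro!: symmetric_exponential_law_distr)

text \<open>The point mass at 0 outside the index set makes every factor a probability measure, in
  the form in which the product lemmas expect the family.\<close>

lemma prob_space_entry_law: "prob_space (entry_law M n d X k)"
  using family_measurable[of k] unfolding entry_law_def
  by (auto intro!: prob_space.prob_space_distr[OF family_prob_space] prob_space_return)

lemma entries_measurable: "entries n d X \<in> measurable M (PiM ({1..n} \<times> {1..d}) (entry_law M n d X))"
  unfolding entries_def[abs_def]
proof (rule measurable_restrict)
  fix k assume "k \<in> {1..n} \<times> {1..d}"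
  then show "X (fst k) (snd k) \<in> measurable M (entry_law M n d X k)"
    using family_measurable[of k] by (simp add: sets_entry_law cong: measurable_cong_sets)
qed

lemma distr_entries:
  "distr M (PiM ({1..n} \<times> {1..d}) (entry_law M n d X)) (entries n d X) = PiM ({1..n} \<times> {1..d}) (entry_law M n d X)"
proof -
  interpret prob_space M by (rule family_prob_space)
  let ?K = "{1..n} \<times> {1..d}"
  have "?K \<noteq> {}" using nd by auto
  have "indep_vars (\<lambda>_. borel) (\<lambda>k. X (fst k) (snd k)) ?K"
    using fam by (simp add: symmetric_exponential_family_def case_prod_unfold)
  then have "distr M (PiM ?K (\<lambda>_. borel)) (\<lambda>x. \<lambda>k\<in>?K. X (fst k) (snd k) x) = PiM ?K (\<lambda>k. distr M borel (X (fst k) (snd k)))"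
    using family_measurable by (subst (asm) indep_vars_iff_distr_eq_PiM'[OF \<open>?K \<noteq> {}\<close>]) auto
  also have "\<dots> = PiM ?K (entry_law M n d X)"
    by (intro PiM_cong) (auto simp: entry_law_def)
  finally show ?thesis
    unfolding entries_def[abs_def]
    by (subst distr_cong[OF refl sets_PiM_cong[OF refl sets_entry_law] refl])
qed

lemma chaos_entries: "chaos n d a X \<omega> = chaos n d a (\<lambda>i j \<omega>. \<omega> (i, j)) (entries n d X \<omega>)"
proof -
  have "(\<Prod>j=1..d. X (i j) j \<omega>) = (\<Prod>j=1..d. entries n d X \<omega> (i j, j))" if "i \<in> multi_idx n {1..d}" for i
  proof (rule prod.cong[OF refl])
    fix j assume j: "j \<in> {1..d}"
    with that have "(i j, j) \<in> {1..n} \<times> {1..d}" by (auto simp: multi_idx_def)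
    then show "X (i j) j \<omega> = entries n d X \<omega> (i j, j)" by (simp add: entries_def)
  qed
  then show ?thesis unfolding chaos_def by simp
qed

lemma chaos_coordinates_measurable:
  "chaos n d a (\<lambda>i j \<omega>. \<omega> (i, j)) \<in> borel_measurable (PiM ({1..n} \<times> {1..d}) (entry_law M n d X))"
  unfolding chaos_def[abs_def]
proof (intro borel_measurable_times borel_measurable_const borel_measurable_prod borel_measurable_sum)
  fix i j assume "i \<in> multi_idx n {1..d}" "j \<in> {1..d}"
  then have "(i j, j) \<in> {1..n} \<times> {1..d}" by (auto simp: multi_idx_def)
  then have "(\<lambda>\<omega>. \<omega> (i j, j)) \<in> measurable (PiM ({1..n} \<times> {1..d}) (entry_law M n d X)) (entry_law M n d X (i j, j))"
    by (rule measurable_component_singleton)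
  then show "(\<lambda>\<omega>. \<omega> (i j, j)) \<in> borel_measurable (PiM ({1..n} \<times> {1..d}) (entry_law M n d X))"
    by (simp add: sets_entry_law cong: measurable_cong_sets)
qed

lemma integrable_chaos_iff:
  "integrable M (\<lambda>\<omega>. \<bar>chaos n d a X \<omega>\<bar> powr p) \<longleftrightarrow>
   integrable (PiM ({1..n} \<times> {1..d}) (entry_law M n d X)) (\<lambda>\<omega>. \<bar>chaos n d a (\<lambda>i j \<omega>. \<omega> (i, j)) \<omega>\<bar> powr p)"
proof -
  have "(\<lambda>\<omega>. \<bar>chaos n d a (\<lambda>i j \<omega>. \<omega> (i, j)) \<omega>\<bar> powr p)
      \<in> borel_measurable (PiM ({1..n} \<times> {1..d}) (entry_law M n d X))"
    using chaos_coordinates_measurable by measurable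
  from integrable_distr_eq[OF entries_measurable this] show ?thesis
    unfolding distr_entries chaos_entries ..
qed

lemma Lp_norm_chaos:
  "Lp_norm M p (chaos n d a X)
    = Lp_norm (PiM ({1..n} \<times> {1..d}) (entry_law M n d X)) p (chaos n d a (\<lambda>i j \<omega>. \<omega> (i, j)))"
proof -
  have "(\<lambda>\<omega>. \<bar>chaos n d a (\<lambda>i j \<omega>. \<omega> (i, j)) \<omega>\<bar> powr p)
      \<in> borel_measurable (PiM ({1..n} \<times> {1..d}) (entry_law M n d X))"
    using chaos_coordinates_measurable by measurable
  from integral_distr[OF entries_measurable this] show ?thesis
    unfolding Lp_norm_def distr_entries chaos_entries by simp
qed

lemma distr_coordinate:
  assumes k: "k \<in> {1..n} \<times> {1..d}"
  shows "distr (PiM ({1..n} \<times> {1..d}) (entry_law M n d X)) borel (\<lambda>\<omega>. \<omega> k) = distr M borel (X (fst k) (snd k))"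
proof -
  have "distr (PiM ({1..n} \<times> {1..d}) (entry_law M n d X)) (entry_law M n d X k) (\<lambda>\<omega>. \<omega> k) = entry_law M n d X k"
    using prob_space_entry_law k by (rule distr_PiM_component)
  then show ?thesis
    using k by (subst distr_cong[OF refl sets_entry_law[symmetric, of M n d X k] refl]) (simp add: entry_law_def)
qed

lemma coordinate_measurable:
  "k \<in> {1..n} \<times> {1..d} \<Longrightarrow> (\<lambda>\<omega>. \<omega> k) \<in> borel_measurable (PiM ({1..n} \<times> {1..d}) (entry_law M n d X))"
  using measurable_component_singleton[of k "{1..n} \<times> {1..d}" "entry_law M n d X"]
  by (simp add: sets_entry_law cong: measurable_cong_sets)

lemma tail_fun_coordinate:
  assumes "k \<in> {1..n} \<times> {1..d}"
  shows "tail_fun (PiM ({1..n} \<times> {1..d}) (entry_law M n d X)) (\<lambda>\<omega>. \<omega> k) t = tail_fun M (X (fst k) (snd k)) t"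
  by (simp only: tail_fun_distr[OF coordinate_measurable[OF assms]] tail_fun_distr[OF family_measurable[OF assms]]
      distr_coordinate[OF assms])

text \<open>Realizes the joint law of an arbitrary family on the type
  \<open>canonical_sample\<close>, where a constant assumed for that type can be applied.\<close>

lemma symmetric_exponential_family_coordinates:
  "symmetric_exponential_family (PiM ({1..n} \<times> {1..d}) (entry_law M n d X)) n d (\<lambda>i j \<omega>. \<omega> (i, j))"
proof -
  let ?K = "{1..n} \<times> {1..d}"
  let ?P = "PiM ?K (entry_law M n d X)"
  interpret P: prob_space ?P by (rule prob_space_PiM) (rule prob_space_entry_law)
  have "?K \<noteq> {}" using nd by auto
  have "distr ?P (PiM ?K (\<lambda>_. borel)) (\<lambda>\<omega>. \<lambda>k\<in>?K. \<omega> k) = distr ?P ?P (\<lambda>\<omega>. \<omega>)"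
    by (intro distr_cong sets_PiM_cong) (auto simp: sets_entry_law space_PiM PiE_def extensional_restrict)
  also have "\<dots> = ?P" by (rule distr_id2) simp
  also have "\<dots> = PiM ?K (\<lambda>k. distr ?P borel (\<lambda>\<omega>. \<omega> k))"
    by (intro PiM_cong refl) (simp only: distr_coordinate entry_law_def if_True)
  finally have "P.indep_vars (\<lambda>_. borel) (\<lambda>k \<omega>. \<omega> k) ?K"
    using coordinate_measurable by (subst P.indep_vars_iff_distr_eq_PiM'[OF \<open>?K \<noteq> {}\<close>]) auto
  moreover have "distr ?P borel (\<lambda>\<omega>. \<omega> k) = distr ?P borel (\<lambda>\<omega>. - \<omega> k)" if k: "k \<in> ?K" for k
  proof -
    have "distr ?P borel (\<lambda>\<omega>. - \<omega> k) = distr (distr ?P borel (\<lambda>\<omega>. \<omega> k)) borel uminus"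
      using coordinate_measurable[OF k] by (subst distr_distr) (auto simp: comp_def)
    also have "\<dots> = distr ?P borel (\<lambda>\<omega>. \<omega> k)"
      using family_entry_law[OF k] k unfolding distr_coordinate[OF k]
      by (simp only: symmetric_exponential_law_def entry_law_def if_True)
    finally show ?thesis by simp
  qed
  moreover have "tail_fun ?P (\<lambda>\<omega>. \<omega> (i, j)) t = t" if "i \<in> {1..n}" "j \<in> {1..d}" "0 < t" for i j t
    using tail_fun_coordinate[of "(i, j)" t] fam that by (simp add: symmetric_exponential_family_def)
  ultimately show ?thesis
    unfolding symmetric_exponential_family_def
    using P.prob_space_axioms by (simp add: case_prod_unfold)
qed

end

text \<open>With all coordinates fixed and no arrays, \<open>shared_blocks_bound\<close> puts an
  absolute value below this sum.\<close>

lemma sum_partition_norm_nonneg: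
  fixes p :: real
  assumes "\<And>m j t. m \<in> {1..n} \<Longrightarrow> j \<in> {1..d} \<Longrightarrow> t > 0 \<Longrightarrow> N m j t = t" and "1 \<le> p" "1 \<le> d"
  shows "0 \<le> (\<Sum>J | partition_on {1..d} J. partition_norm n d N p J a)"
proof -
  have "\<bar>\<Sum>i\<in>multi_idx n {1..d}. a i * (if \<forall>j\<in>{1..d}. i j = undefined j then 1 else 0) * (\<Prod>l\<in>({}::nat set). 0)\<bar>
      \<le> (\<Sum>J | partition_on {1..d} J. partition_norm n d N p J a)"
    using assms by (intro shared_blocks_bound[where x = "\<lambda>_ _. 0" and B = "\<lambda>_. {}"]) auto
  then show ?thesis by linarith
qed

lemma chaos_moment_bound_exists:
  assumes d: "1 \<le> d"
  shows "chaos_moment_bound TYPE('a) d (3 * 2 ^ d * step_constant d ^ (2 * d))"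
  unfolding chaos_moment_bound_def
proof (intro allI impI)
  fix n :: nat and M :: "'a measure" and X a and p :: real
  assume n: "1 \<le> n" and fam: "symmetric_exponential_family M n d X" and p: "2 \<le> p"
  let ?L = "3 * 2 ^ d * step_constant d ^ (2 * d)"
  define T where "T = (\<lambda>i j. tail_fun M (X i j))"
  define r where "r = (\<Sum>J | partition_on {1..d} J. partition_norm n d T p J a)"
  have tail: "T m j t = t" if "m \<in> {1..n}" "j \<in> {1..d}" "t > 0" for m j t
    using fam that by (simp add: T_def symmetric_exponential_family_def)
  have r: "0 \<le> r" unfolding r_def using tail p d by (intro sum_partition_norm_nonneg) auto
  note bound = exponential_chaos_moment_bound[where \<nu> = "entry_law M n d X" and a = a, OF prob_space_entry_law[OF fam n d] sets_entry_law
      family_entry_law[OF fam n d] tail p d]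
  have "integrable M (\<lambda>\<omega>. \<bar>chaos n d a X \<omega>\<bar> powr p)"
    unfolding integrable_chaos_iff[OF fam n d] using bound(1)[where r = "r + 1"] r by (simp add: r_def)
  \<comment> \<open>Since \<open>r\<close> may vanish, the bound is applied to a slightly larger
    positive number, and the excess is arbitrarily small.\<close>
  moreover have "Lp_norm M p (chaos n d a X) \<le> ?L * r"
  proof (rule field_le_epsilon)
    fix e :: real assume e: "0 < e"
    have L: "0 < ?L" using step_constant_pos[of d] by simp
    have "Lp_norm M p (chaos n d a X) \<le> ?L * (r + e / ?L)"
      unfolding Lp_norm_chaos[OF fam n d]
      by (rule bound(2)) (use r e L in \<open>auto simp: r_def intro!: add_nonneg_pos divide_pos_pos\<close>)
    also have "\<dots> = ?L * r + e"
      by (simp only: distrib_left times_divide_eq_right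
          nonzero_mult_div_cancel_left[OF less_imp_neq[OF L, symmetric]])
    finally show "Lp_norm M p (chaos n d a X) \<le> ?L * r + e" .
  qed
  ultimately show "integrable M (\<lambda>\<omega>. \<bar>chaos n d a X \<omega>\<bar> powr p) \<and>
      Lp_norm M p (chaos n d a X) \<le> ?L * (\<Sum>J | partition_on {1..d} J.
        partition_norm n d (\<lambda>i j. tail_fun M (X i j)) p J a)"
    by (simp add: r_def T_def)
qed

text \<open>Integrability, the norm of the chaos and the tail functions are determined by the joint
  law of the entries, and the coordinate process has the same joint law.\<close>

lemma chaos_moment_bound_transfer:
  assumes d: "1 \<le> d" and L: "chaos_moment_bound TYPE(canonical_sample) d L"
  shows "chaos_moment_bound TYPE('a) d L"
  unfolding chaos_moment_bound_def
proof (intro allI impI)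
  fix n :: nat and M :: "'a measure" and X a and p :: real
  assume n: "1 \<le> n" and fam: "symmetric_exponential_family M n d X" and p: "2 \<le> p"
  let ?P = "PiM ({1..n} \<times> {1..d}) (entry_law M n d X)"
  have "integrable ?P (\<lambda>\<omega>. \<bar>chaos n d a (\<lambda>i j \<omega>. \<omega> (i, j)) \<omega>\<bar> powr p) \<and>
      Lp_norm ?P p (chaos n d a (\<lambda>i j \<omega>. \<omega> (i, j))) \<le> L * (\<Sum>J | partition_on {1..d} J.
        partition_norm n d (\<lambda>i j. tail_fun ?P (\<lambda>\<omega>. \<omega> (i, j))) p J a)"
    using L n p symmetric_exponential_family_coordinates[OF fam n d]
    unfolding chaos_moment_bound_def by blast
  moreover have "partition_norm n d (\<lambda>i j. tail_fun ?P (\<lambda>\<omega>. \<omega> (i, j))) p J a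
      = partition_norm n d (\<lambda>i j. tail_fun M (X i j)) p J a" if "partition_on {1..d} J" for J
    using that
  proof (rule partition_norm_cong)
    fix m j t assume "m \<in> {1..n}" "j \<in> {1..d}"
    then show "tail_fun ?P (\<lambda>\<omega>. \<omega> (m, j)) t = tail_fun M (X m j) t"
      using tail_fun_coordinate[OF fam n d, of "(m, j)" t] by simp
  qed
  ultimately show "integrable M (\<lambda>\<omega>. \<bar>chaos n d a X \<omega>\<bar> powr p) \<and>
      Lp_norm M p (chaos n d a X) \<le> L * (\<Sum>J | partition_on {1..d} J.
        partition_norm n d (\<lambda>i j. tail_fun M (X i j)) p J a)"
    by (simp add: integrable_chaos_iff[OF fam n d] Lp_norm_chaos[OF fam n d])
qed

theorem theorem3p4:
  fixes d :: nat
  assumes "d \<ge> 1"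
  shows "(\<exists>L>0. chaos_moment_bound TYPE(canonical_sample) d L) \<and>
         (\<forall>L. chaos_moment_bound TYPE(canonical_sample) d L \<longrightarrow> chaos_moment_bound TYPE('a) d L)"
proof (intro conjI allI impI)
  show "\<exists>L>0. chaos_moment_bound TYPE(canonical_sample) d L"
    using chaos_moment_bound_exists[OF assms] step_constant_pos[of d]
    by (intro exI[of _ "3 * 2 ^ d * step_constant d ^ (2 * d)"]) simp
  fix L assume "chaos_moment_bound TYPE(canonical_sample) d L"
  then show "chaos_moment_bound TYPE('a) d L" by (rule chaos_moment_bound_transfer[OF assms])
qed

end
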